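(* Let $k$ be a field, let $\mathcal{C}$ be a connected Schurian $k$-category, let $c_0$ be an object of $\mathcal{C}$, and let $U$ be the universal grading of $\mathcal{C}$ by the group $\pi_1(CW(\mathcal{C}),c_0)$. Then the corresponding Hurewicz morphism $$h:\mathrm{Hom}\big(\pi_1(CW(\mathcal{C}),c_0),k^+\big)\to \mathrm{HH}^1(\mathcal{C})$$ is an isomorphism of $k$-vector spaces.
   Context: A $k$-category is a small category $\mathcal{C}$ (object set $\mathcal{C}_0$) such that each morphism set ${}_y\mathcal{C}_x$ from $x$ to $y$ is a $k$-vector space, composition is $k$-bilinear, and the $k$-multiples of the identity of each object are central in its endomorphism ring. Walks. Each non-zero morphism $f$ from $x$ to $y$ gives two virtual morphisms: $(f,1)$ with source $x$ and target $y$ (identified with $f$), and $(f,-1)$ with source $y$ and target $x$. A walk from $x$ to $y$ is a sequence $w=(f_n,\epsilon_n),\dots,(f_1,\epsilon_1)$ of virtual morphisms such that the target of $(f_i,\epsilon_i)$ is the source of $(f_{i+1},\epsilon_{i+1})$, the source of $(f_1,\epsilon_1)$ is $x$ and the target of $(f_n,\epsilon_n)$ is $y$; its inverse is $w^{-1}=(f_1,-\epsilon_1),\dots,(f_n,-\epsilon_n)$. A $k$-category is connected if for every pair of objects $(x,y)$ there is a walk from $x$ to $y$. Gradings. A grading $X$ of $\mathcal{C}$ by a group $\Gamma_X$ is a decomposition ${}_y\mathcal{C}_x=\bigoplus_{s\in\Gamma_X}X^s{}_y\mathcal{C}_x$ for all $x,y$, with $X^t{}_z\mathcal{C}_y\,X^s{}_y\mathcal{C}_x\subset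 X^{ts}{}_z\mathcal{C}_x$. A non-zero $f\in X^s{}_y\mathcal{C}_x$ is homogeneous with $\deg_Xf=s$. Schurian. $\mathcal{C}$ is Schurian if each ${}_y\mathcal{C}_x$ has dimension $0$ or $1$ over $k$. Fix a non-zero element ${}_ye_x$ in each one-dimensional ${}_y\mathcal{C}_x$, with ${}_xe_x$ the identity of $x$. The CW-complex $CW(\mathcal{C})$ of a Schurian $\mathcal{C}$ is the $2$-dimensional CW-complex with: - $0$-cells: the objects of $\mathcal{C}$; - $1$-cells: one for each ${}_ye_x$ with $x\neq y$ (again denoted ${}_ye_x$), attached to $x$ and $y$ (so if ${}_y\mathcal{C}_x\ne 0\ne{}_x\mathcal{C}_y$ there are two $1$-cells between $x$ and $y$); - for each ordered triple $(x,y,z)$ of pairwise distinct objects such that ${}_y\mathcal{C}_x$, ${}_z\mathcal{C}_y$ and ${}_z\mathcal{C}_x$ are non-zero and ${}_ze_y\,{}_ye_x\neq 0$, one $2$-cell attached along ${}_ye_x$, ${}_ze_y$, ${}_ze_x$ (making the path ${}_ye_x$ followed by ${}_ze_y$ homotopic to ${}_ze_x$); - for each unordered pair of distinct objects $x,y$ such that ${}_y\mathcal{C}_x$ and ${}_x\mathcal{C}_y$ are non-zero and ${}_xe_y\,{}_ye_x\neq 0$ (equivalently ${}_ye_x\,{}_xe_y\neq 0$), exactly one $2$-cell attached along ${}_ye_x$ and ${}_xe_y$ (making the loop ${}_ye_x$ followed by ${}_xe_y$ null-homotopic). Loops. A closed walk $w=(f_n,\epsilon_n),\dots,(f_1,\epsilon_1)$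 at $c_0$ describes a loop in $CW(\mathcal{C})$: on $[\frac{i-1}{n},\frac in]$ it traverses the $1$-cell of $f_i$ (the cell ${}_ye_x$ if $0\neq f_i\in{}_y\mathcal{C}_x$, constant if $x=y$) from the source to the target of $(f_i,\epsilon_i)$. Its class is $[w]$. Products in $\pi_1$ are written like walks, right to left: $[w][w']$ is the class of $w'$ followed by $w$. Universal grading. Choose for each object $x$ a walk ${}_xu_{c_0}$ from $c_0$ to $x$, with ${}_{c_0}u_{c_0}$ the identity of $c_0$ ("connector walks"). The universal grading $U$ of $\mathcal{C}$ by $\pi_1(CW(\mathcal{C}),c_0)$ is the one with $\deg_U{}_ye_x=[\,{}_yu_{c_0}^{-1}\,{}_ye_x\,{}_xu_{c_0}]$ for every non-zero ${}_y\mathcal{C}_x$. Hochschild-Mitchell cohomology. A $k$-derivation $d$ of $\mathcal{C}$ is a family of $k$-linear maps ${}_yd_x:{}_y\mathcal{C}_x\to{}_y\mathcal{C}_x$ with ${}_zd_x(gf)={}_zd_y(g)f+g\,{}_yd_x(f)$ for $f\in{}_y\mathcal{C}_x$, $g\in{}_z\mathcal{C}_y$. For a family $a=(a_x)_{x\in\mathcal{C}_0}$ with $a_x\in{}_x\mathcal{C}_x$, the inner derivation $d_a$ is $f\mapsto a_yf-fa_x$ for $f\in{}_y\mathcal{C}_x$. $\mathrm{HH}^1(\mathcal{C})$ is the vector space of derivations modulo inner derivations. Hurewicz morphism. $k^+$ is the additive group of $k$. For a grading $X$ of $\mathcal{C}$, the Hurewicz morphism $h:\mathrm{Hom}(\Gamma_X,k^+)\to\mathrm{HH}^1(\mathcal{C})$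 sends a group homomorphism $\chi:\Gamma_X\to k^+$ to the class of the derivation given on homogeneous $f\in{}_y\mathcal{C}_x$ by ${}_yh(\chi)_x(f)=\chi(\deg_Xf)f$ and extended linearly. *)

theory Defs
  imports "HOL-Analysis.Analysis" "HOL-Algebra.Module" "HOL-Algebra.AbelCoset"
begin

section \<open>Linear categories\<close>

text \<open>
  Indices follow the convention in which \<open>Mor C y x\<close> is the space of morphisms from \<open>x\<close> to \<open>y\<close>,
  and \<open>Comp C z y x g f\<close> is \<open>g\<close> after \<open>f\<close>. Morphism spaces are carried by arbitrary subsets of
  \<open>'m\<close>, each with its own operations; different ones may overlap as sets.
  Only the additive structure and the scalar multiplication of a \<open>module\<close> record are used:
  the ring fields \<open>mult\<close> and \<open>one\<close> carry no meaning.
\<close>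

record ('o, 'k, 'm) kcat =
  Obj :: "'o set"
  Mor :: "'o \<Rightarrow> 'o \<Rightarrow> ('k, 'm) module"
  Comp :: "'o \<Rightarrow> 'o \<Rightarrow> 'o \<Rightarrow> 'm \<Rightarrow> 'm \<Rightarrow> 'm"
  Id :: "'o \<Rightarrow> 'm"

locale k_category =
  fixes K :: "('k, 'r) ring_scheme" and C :: "('o, 'k, 'm) kcat"
  assumes field: "Ring.field K"
    and Mor_module: "\<lbrakk>x \<in> Obj C; y \<in> Obj C\<rbrakk> \<Longrightarrow> Module.module K (Mor C y x)"
    and Comp_closed: "\<lbrakk>x \<in> Obj C; y \<in> Obj C; z \<in> Obj C;
        g \<in> carrier (Mor C z y); f \<in> carrier (Mor C y x)\<rbrakk>
      \<Longrightarrow> Comp C z y x g f \<in> carrier (Mor C z x)"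
    and Comp_add_left: "\<lbrakk>x \<in> Obj C; y \<in> Obj C; z \<in> Obj C;
        g \<in> carrier (Mor C z y); g' \<in> carrier (Mor C z y); f \<in> carrier (Mor C y x)\<rbrakk>
      \<Longrightarrow> Comp C z y x (g \<oplus>\<^bsub>Mor C z y\<^esub> g') f = Comp C z y x g f \<oplus>\<^bsub>Mor C z x\<^esub> Comp C z y x g' f"
    and Comp_add_right: "\<lbrakk>x \<in> Obj C; y \<in> Obj C; z \<in> Obj C;
        g \<in> carrier (Mor C z y); f \<in> carrier (Mor C y x); f' \<in> carrier (Mor C y x)\<rbrakk>
      \<Longrightarrow> Comp C z y x g (f \<oplus>\<^bsub>Mor C y x\<^esub> f') = Comp C z y x g f \<oplus>\<^bsub>Mor C z x\<^esub> Comp C z y x g f'"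
    and Comp_smult_left: "\<lbrakk>x \<in> Obj C; y \<in> Obj C; z \<in> Obj C; a \<in> carrier K;
        g \<in> carrier (Mor C z y); f \<in> carrier (Mor C y x)\<rbrakk>
      \<Longrightarrow> Comp C z y x (a \<odot>\<^bsub>Mor C z y\<^esub> g) f = a \<odot>\<^bsub>Mor C z x\<^esub> Comp C z y x g f"
    and Comp_smult_right: "\<lbrakk>x \<in> Obj C; y \<in> Obj C; z \<in> Obj C; a \<in> carrier K;
        g \<in> carrier (Mor C z y); f \<in> carrier (Mor C y x)\<rbrakk>
      \<Longrightarrow> Comp C z y x g (a \<odot>\<^bsub>Mor C y x\<^esub> f) = a \<odot>\<^bsub>Mor C z x\<^esub> Comp C z y x g f"
    and Comp_assoc: "\<lbrakk>x \<in> Obj C; y \<in> Obj C; z \<in> Obj C; w \<in> Obj C;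
        h \<in> carrier (Mor C w z); g \<in> carrier (Mor C z y); f \<in> carrier (Mor C y x)\<rbrakk>
      \<Longrightarrow> Comp C w z x h (Comp C z y x g f) = Comp C w y x (Comp C w z y h g) f"
    and Id_closed: "x \<in> Obj C \<Longrightarrow> Id C x \<in> carrier (Mor C x x)"
    and Id_left: "\<lbrakk>x \<in> Obj C; y \<in> Obj C; f \<in> carrier (Mor C y x)\<rbrakk>
      \<Longrightarrow> Comp C y y x (Id C y) f = f"
    and Id_right: "\<lbrakk>x \<in> Obj C; y \<in> Obj C; f \<in> carrier (Mor C y x)\<rbrakk>
      \<Longrightarrow> Comp C y x x f (Id C x) = f"
    and Id_central: "\<lbrakk>x \<in> Obj C; a \<in> carrier K; f \<in> carrier (Mor C x x)\<rbrakk>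
      \<Longrightarrow> Comp C x x x (a \<odot>\<^bsub>Mor C x x\<^esub> Id C x) f = Comp C x x x f (a \<odot>\<^bsub>Mor C x x\<^esub> Id C x)"

definition nonzero_Mor :: "('o, 'k, 'm) kcat \<Rightarrow> 'o \<Rightarrow> 'o \<Rightarrow> bool" where
  "nonzero_Mor C y x \<longleftrightarrow> carrier (Mor C y x) \<noteq> {\<zero>\<^bsub>Mor C y x\<^esub>}"

definition one_dimensional :: "('k, 'r) ring_scheme \<Rightarrow> ('k, 'v) module \<Rightarrow> bool" where
  "one_dimensional K V \<longleftrightarrow>
     (\<exists>b\<in>carrier V. \<forall>v\<in>carrier V. \<exists>!a. a \<in> carrier K \<and> v = a \<odot>\<^bsub>V\<^esub> b)"

definition schurian :: "('k, 'r) ring_scheme \<Rightarrow> ('o, 'k, 'm) kcat \<Rightarrow> bool" where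
  "schurian K C \<longleftrightarrow> (\<forall>x\<in>Obj C. \<forall>y\<in>Obj C.
     carrier (Mor C y x) = {\<zero>\<^bsub>Mor C y x\<^esub>} \<or> one_dimensional K (Mor C y x))"

definition basis_choice :: "('o, 'k, 'm) kcat \<Rightarrow> ('o \<Rightarrow> 'o \<Rightarrow> 'm) \<Rightarrow> bool" where
  "basis_choice C e \<longleftrightarrow>
     (\<forall>x\<in>Obj C. \<forall>y\<in>Obj C. nonzero_Mor C y x \<longrightarrow>
        e y x \<in> carrier (Mor C y x) \<and> e y x \<noteq> \<zero>\<^bsub>Mor C y x\<^esub>) \<and>
     (\<forall>x\<in>Obj C. e x x = Id C x)"

section \<open>Walks\<close>

text \<open>
  \<open>Pos y f x\<close> and \<open>Neg y f x\<close> are the virtual morphisms \<open>(f, 1)\<close> and \<open>(f, -1)\<close> of a morphism \<open>f\<close>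
  from \<open>x\<close> to \<open>y\<close>. Walks are non-empty lists written from right to left: the last list element is
  traversed first.
\<close>

datatype ('o, 'm) virtual = Pos 'o 'm 'o | Neg 'o 'm 'o

fun vsource :: "('o, 'm) virtual \<Rightarrow> 'o" where
  "vsource (Pos y f x) = x" |
  "vsource (Neg y f x) = y"

fun vtarget :: "('o, 'm) virtual \<Rightarrow> 'o" where
  "vtarget (Pos y f x) = y" |
  "vtarget (Neg y f x) = x"

fun vinverse :: "('o, 'm) virtual \<Rightarrow> ('o, 'm) virtual" where
  "vinverse (Pos y f x) = Neg y f x" |
  "vinverse (Neg y f x) = Pos y f x"

fun virtual_in :: "('o, 'k, 'm) kcat \<Rightarrow> ('o, 'm) virtual \<Rightarrow> bool" where
  "virtual_in C (Pos y f x) \<longleftrightarrow>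
     x \<in> Obj C \<and> y \<in> Obj C \<and> f \<in> carrier (Mor C y x) \<and> f \<noteq> \<zero>\<^bsub>Mor C y x\<^esub>" |
  "virtual_in C (Neg y f x) \<longleftrightarrow>
     x \<in> Obj C \<and> y \<in> Obj C \<and> f \<in> carrier (Mor C y x) \<and> f \<noteq> \<zero>\<^bsub>Mor C y x\<^esub>"

definition is_walk :: "('o, 'k, 'm) kcat \<Rightarrow> 'o \<Rightarrow> ('o, 'm) virtual list \<Rightarrow> 'o \<Rightarrow> bool" where
  "is_walk C y w x \<longleftrightarrow> w \<noteq> [] \<and> (\<forall>v\<in>set w. virtual_in C v) \<and>
     successively (\<lambda>v v'. vsource v = vtarget v') w \<and>
     vsource (last w) = x \<and> vtarget (hd w) = y"

definition walk_inverse :: "('o, 'm) virtual list \<Rightarrow> ('o, 'm) virtual list" where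
  "walk_inverse w = rev (map vinverse w)"

definition connected_category :: "('o, 'k, 'm) kcat \<Rightarrow> bool" where
  "connected_category C \<longleftrightarrow> (\<forall>x\<in>Obj C. \<forall>y\<in>Obj C. \<exists>w. is_walk C y w x)"

definition connectors ::
  "('o, 'k, 'm) kcat \<Rightarrow> 'o \<Rightarrow> ('o \<Rightarrow> ('o, 'm) virtual list) \<Rightarrow> bool" where
  "connectors C c0 u \<longleftrightarrow> (\<forall>x\<in>Obj C. is_walk C x (u x) c0) \<and> u c0 = [Pos c0 (Id C c0) c0]"

section \<open>Attaching cells\<close>

text \<open>
  Attaching to \<open>X\<close>, for each \<open>i \<in> I\<close>, a copy of the disc \<open>D\<close> with boundary \<open>S\<close> along
  \<open>\<phi> i : S \<rightarrow> X\<close>. The underlying set of the result is \<open>X\<close> together with the open cells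
  \<open>{i} \<times> (D - S)\<close>; its topology is the quotient topology of the disjoint union of \<open>X\<close> and the discs.
\<close>

definition characteristic_map ::
  "'d set \<Rightarrow> ('i \<Rightarrow> 'd \<Rightarrow> 'p) \<Rightarrow> 'i \<Rightarrow> 'd \<Rightarrow> 'p + 'i \<times> 'd" where
  "characteristic_map S \<phi> i p = (if p \<in> S then Inl (\<phi> i p) else Inr (i, p))"

definition attach_open ::
  "'p topology \<Rightarrow> ('d::topological_space) set \<Rightarrow> 'd set \<Rightarrow> 'i set \<Rightarrow> ('i \<Rightarrow> 'd \<Rightarrow> 'p)
    \<Rightarrow> ('p + 'i \<times> 'd) set \<Rightarrow> bool" where
  "attach_open X D S I \<phi> U \<longleftrightarrow>
     U \<subseteq> Inl ` topspace X \<union> Inr ` (I \<times> (D - S)) \<and>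
     openin X (Inl -` U) \<and>
     (\<forall>i\<in>I. openin (top_of_set D) {p \<in> D. characteristic_map S \<phi> i p \<in> U})"

definition attach_cells ::
  "'p topology \<Rightarrow> ('d::topological_space) set \<Rightarrow> 'd set \<Rightarrow> 'i set \<Rightarrow> ('i \<Rightarrow> 'd \<Rightarrow> 'p)
    \<Rightarrow> ('p + 'i \<times> 'd) topology" where
  "attach_cells X D S I \<phi> = topology (attach_open X D S I \<phi>)"

lemma openin_attach_cells: "openin (attach_cells X D S I \<phi>) U \<longleftrightarrow> attach_open X D S I \<phi> U"
proof -
  have "istopology (attach_open X D S I \<phi>)"
    unfolding istopology_def
  proof (intro conjI allI impI)
    fix U V assume U: "attach_open X D S I \<phi> U" and V: "attach_open X D S I \<phi> V"
    have "{p \<in> D. characteristic_map S \<phi> i p \<in> U \<inter> V} =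
        {p \<in> D. characteristic_map S \<phi> i p \<in> U} \<inter> {p \<in> D. characteristic_map S \<phi> i p \<in> V}" for i
      by auto
    with U V show "attach_open X D S I \<phi> (U \<inter> V)"
      unfolding attach_open_def by (auto simp: vimage_Int)
  next
    fix \<U> assume \<U>: "\<forall>U\<in>\<U>. attach_open X D S I \<phi> U"
    have "{p \<in> D. characteristic_map S \<phi> i p \<in> \<Union>\<U>} =
        (\<Union>U\<in>\<U>. {p \<in> D. characteristic_map S \<phi> i p \<in> U})" for i
      by auto
    moreover have "Inl -` \<Union>\<U> = (\<Union>U\<in>\<U>. Inl -` U)"
      by auto
    moreover have "\<Union>\<U> \<subseteq> Inl ` topspace X \<union> Inr ` (I \<times> (D - S))"
      using \<U> unfolding attach_open_def by (intro Sup_least) blast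
    ultimately show "attach_open X D S I \<phi> (\<Union>\<U>)"
      using \<U> unfolding attach_open_def by (auto intro!: openin_clauses(3))
  qed
  then show ?thesis
    by (simp add: attach_cells_def topology_inverse')
qed

section \<open>The CW-complex of a Schurian category\<close>

text \<open>The pair \<open>(y, x)\<close> indexes the 1-cell of \<open>e y x\<close>, parametrised from \<open>x\<close> to \<open>y\<close>.\<close>

definition edges :: "('o, 'k, 'm) kcat \<Rightarrow> ('o \<times> 'o) set" where
  "edges C = {(y, x). x \<in> Obj C \<and> y \<in> Obj C \<and> x \<noteq> y \<and> nonzero_Mor C y x}"

definition edge_attach :: "'o \<times> 'o \<Rightarrow> real \<Rightarrow> 'o" where
  "edge_attach = (\<lambda>(y, x) t. if t = 0 then x else y)"

type_synonym 'o skeleton_point = "'o + ('o \<times> 'o) \<times> real"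

definition one_skeleton :: "('o, 'k, 'm) kcat \<Rightarrow> 'o skeleton_point topology" where
  "one_skeleton C =
     attach_cells (discrete_topology (Obj C)) {0..1} {0, 1} (edges C) edge_attach"

definition edge_path :: "'o \<Rightarrow> 'o \<Rightarrow> real \<Rightarrow> 'o skeleton_point" where
  "edge_path y x t =
     (if x = y then Inl x else characteristic_map {0, 1} edge_attach (y, x) t)"

fun virtual_path :: "('o, 'm) virtual \<Rightarrow> real \<Rightarrow> 'o skeleton_point" where
  "virtual_path (Pos y f x) t = edge_path y x t" |
  "virtual_path (Neg y f x) t = edge_path y x (1 - t)"

text \<open>
  The path of a walk of length \<open>n\<close> runs through its \<open>(i+1)\<close>-st virtual morphism, counted from the
  right, on the interval from \<open>i/n\<close> to \<open>(i+1)/n\<close>.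
\<close>

definition walk_path :: "('o, 'm) virtual list \<Rightarrow> real \<Rightarrow> 'o skeleton_point" where
  "walk_path w t =
     (let n = length w; i = min (n - 1) (nat \<lfloor>real n * t\<rfloor>)
      in virtual_path (w ! (n - 1 - i)) (real n * t - real i))"

text \<open>
  A digon is indexed by the unordered pair of its vertices, so that there is exactly one for each
  pair. Starting its boundary loop at the other vertex would amount to rotating the disc by a
  half-turn.
\<close>

datatype 'o face = Triangle 'o 'o 'o | Digon "'o set"

definition faces :: "('o, 'k, 'm) kcat \<Rightarrow> ('o \<Rightarrow> 'o \<Rightarrow> 'm) \<Rightarrow> 'o face set" where
  "faces C e =
     {Triangle x y z | x y z. x \<in> Obj C \<and> y \<in> Obj C \<and> z \<in> Obj C \<and>
        x \<noteq> y \<and> y \<noteq> z \<and> x \<noteq> z \<and>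
        nonzero_Mor C y x \<and> nonzero_Mor C z y \<and> nonzero_Mor C z x \<and>
        Comp C z y x (e z y) (e y x) \<noteq> \<zero>\<^bsub>Mor C z x\<^esub>} \<union>
     {Digon {x, y} | x y. x \<in> Obj C \<and> y \<in> Obj C \<and> x \<noteq> y \<and>
        nonzero_Mor C y x \<and> nonzero_Mor C x y \<and>
        Comp C x y x (e x y) (e y x) \<noteq> \<zero>\<^bsub>Mor C x x\<^esub>}"

fun face_boundary :: "('o \<Rightarrow> 'o \<Rightarrow> 'm) \<Rightarrow> 'o face \<Rightarrow> ('o, 'm) virtual list" where
  "face_boundary e (Triangle x y z) =
     [Neg z (e z x) x, Pos z (e z y) y, Pos y (e y x) x]" |
  "face_boundary e (Digon P) =
     (let (x, y) = (SOME (x, y). P = {x, y}) in [Pos x (e x y) y, Pos y (e y x) x])"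

definition face_attach ::
  "('o \<Rightarrow> 'o \<Rightarrow> 'm) \<Rightarrow> 'o face \<Rightarrow> complex \<Rightarrow> 'o skeleton_point" where
  "face_attach e F z = walk_path (face_boundary e F) (Arg2pi z / (2 * pi))"

type_synonym 'o cw_point = "'o skeleton_point + 'o face \<times> complex"

definition CW :: "('o, 'k, 'm) kcat \<Rightarrow> ('o \<Rightarrow> 'o \<Rightarrow> 'm) \<Rightarrow> 'o cw_point topology" where
  "CW C e = attach_cells (one_skeleton C) (cball 0 1) (sphere 0 1) (faces C e) (face_attach e)"

definition CW_vertex :: "'o \<Rightarrow> 'o cw_point" where
  "CW_vertex x = Inl (Inl x)"

section \<open>The fundamental group\<close>

definition loops_at :: "'p topology \<Rightarrow> 'p \<Rightarrow> (real \<Rightarrow> 'p) set" where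
  "loops_at X b = {p. pathin X p \<and> p 0 = b \<and> p 1 = b}"

definition path_homotopic :: "'p topology \<Rightarrow> (real \<Rightarrow> 'p) \<Rightarrow> (real \<Rightarrow> 'p) \<Rightarrow> bool" where
  "path_homotopic X p q \<longleftrightarrow>
     homotopic_with (\<lambda>r. r 0 = p 0 \<and> r 1 = p 1) (top_of_set {0..1}) X p q"

definition path_class :: "'p topology \<Rightarrow> (real \<Rightarrow> 'p) \<Rightarrow> (real \<Rightarrow> 'p) set" where
  "path_class X p = {q. path_homotopic X p q}"

text \<open>The library's \<open>joinpaths\<close> is restricted to types of class \<open>topological_space\<close>.\<close>

definition path_join :: "(real \<Rightarrow> 'p) \<Rightarrow> (real \<Rightarrow> 'p) \<Rightarrow> real \<Rightarrow> 'p" where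
  "path_join p q t = (if t \<le> 1/2 then p (2 * t) else q (2 * t - 1))"

text \<open>Products are read from right to left: the product of two classes first runs through the second.\<close>

definition fundamental_group :: "'p topology \<Rightarrow> 'p \<Rightarrow> (real \<Rightarrow> 'p) set monoid" where
  "fundamental_group X b =
     \<lparr>carrier = path_class X ` loops_at X b,
      mult = (\<lambda>A B. \<Union>p\<in>A. \<Union>q\<in>B. path_class X (path_join q p)),
      one = path_class X (\<lambda>_. b)\<rparr>"

abbreviation CW_pi1 ::
  "('o, 'k, 'm) kcat \<Rightarrow> ('o \<Rightarrow> 'o \<Rightarrow> 'm) \<Rightarrow> 'o \<Rightarrow> (real \<Rightarrow> 'o cw_point) set monoid" where
  "CW_pi1 C e c0 \<equiv> fundamental_group (CW C e) (CW_vertex c0)"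

definition walk_class ::
  "('o, 'k, 'm) kcat \<Rightarrow> ('o \<Rightarrow> 'o \<Rightarrow> 'm) \<Rightarrow> ('o, 'm) virtual list \<Rightarrow> (real \<Rightarrow> 'o cw_point) set" where
  "walk_class C e w = path_class (CW C e) (\<lambda>t. Inl (walk_path w t))"

section \<open>Gradings\<close>

text \<open>
  \<open>X s y x\<close> is the component of degree \<open>s\<close> of \<open>Mor C y x\<close>. In \<open>homogeneous_parts\<close>, \<open>c\<close> is the family
  of homogeneous parts of \<open>f\<close>, of which only finitely many are non-zero.
\<close>

definition part_support ::
  "('o, 'k, 'm) kcat \<Rightarrow> ('g, 'n) monoid_scheme \<Rightarrow> 'o \<Rightarrow> 'o \<Rightarrow> ('g \<Rightarrow> 'm) \<Rightarrow> 'g set" where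
  "part_support C G y x c = {s \<in> carrier G. c s \<noteq> \<zero>\<^bsub>Mor C y x\<^esub>}"

definition homogeneous_parts ::
  "('o, 'k, 'm) kcat \<Rightarrow> ('g, 'n) monoid_scheme \<Rightarrow> ('g \<Rightarrow> 'o \<Rightarrow> 'o \<Rightarrow> 'm set)
    \<Rightarrow> 'o \<Rightarrow> 'o \<Rightarrow> 'm \<Rightarrow> ('g \<Rightarrow> 'm) \<Rightarrow> bool" where
  "homogeneous_parts C G X y x f c \<longleftrightarrow>
     c \<in> (\<Pi>\<^sub>E s\<in>carrier G. X s y x) \<and> finite (part_support C G y x c) \<and>
     f = (\<Oplus>\<^bsub>Mor C y x\<^esub> s\<in>part_support C G y x c. c s)"

definition grading ::
  "('k, 'r) ring_scheme \<Rightarrow> ('o, 'k, 'm) kcat \<Rightarrow> ('g, 'n) monoid_scheme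
    \<Rightarrow> ('g \<Rightarrow> 'o \<Rightarrow> 'o \<Rightarrow> 'm set) \<Rightarrow> bool" where
  "grading K C G X \<longleftrightarrow> group G \<and>
     (\<forall>x\<in>Obj C. \<forall>y\<in>Obj C.
        (\<forall>s\<in>carrier G. submodule (X s y x) K (Mor C y x)) \<and>
        (\<forall>f\<in>carrier (Mor C y x). \<exists>!c. homogeneous_parts C G X y x f c)) \<and>
     (\<forall>x\<in>Obj C. \<forall>y\<in>Obj C. \<forall>z\<in>Obj C. \<forall>s\<in>carrier G. \<forall>t\<in>carrier G.
        \<forall>g\<in>X t z y. \<forall>f\<in>X s y x. Comp C z y x g f \<in> X (t \<otimes>\<^bsub>G\<^esub> s) z x)"

text \<open>
  In the universal grading every non-zero morphism space is concentrated in a single degree, that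
  of its basis element.
\<close>

definition universal_grading ::
  "('o, 'k, 'm) kcat \<Rightarrow> ('o \<Rightarrow> 'o \<Rightarrow> 'm) \<Rightarrow> ('o \<Rightarrow> ('o, 'm) virtual list)
    \<Rightarrow> (real \<Rightarrow> 'o cw_point) set \<Rightarrow> 'o \<Rightarrow> 'o \<Rightarrow> 'm set" where
  "universal_grading C e u s y x =
     (if s = walk_class C e (walk_inverse (u y) @ [Pos y (e y x) x] @ u x)
      then carrier (Mor C y x) else {\<zero>\<^bsub>Mor C y x\<^esub>})"

section \<open>Hochschild-Mitchell cohomology in degree one\<close>

text \<open>
  Derivations are extensional: they take the value \<open>undefined\<close> outside the objects and the morphism
  spaces, so that equal families of maps are equal functions.
\<close>

definition derivations ::
  "('k, 'r) ring_scheme \<Rightarrow> ('o, 'k, 'm) kcat \<Rightarrow> ('o \<Rightarrow> 'o \<Rightarrow> 'm \<Rightarrow> 'm) set" where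
  "derivations K C =
     {d \<in> (\<Pi>\<^sub>E y\<in>Obj C. \<Pi>\<^sub>E x\<in>Obj C. carrier (Mor C y x) \<rightarrow>\<^sub>E carrier (Mor C y x)).
        (\<forall>x\<in>Obj C. \<forall>y\<in>Obj C.
           (\<forall>f\<in>carrier (Mor C y x). \<forall>f'\<in>carrier (Mor C y x).
              d y x (f \<oplus>\<^bsub>Mor C y x\<^esub> f') = d y x f \<oplus>\<^bsub>Mor C y x\<^esub> d y x f') \<and>
           (\<forall>a\<in>carrier K. \<forall>f\<in>carrier (Mor C y x).
              d y x (a \<odot>\<^bsub>Mor C y x\<^esub> f) = a \<odot>\<^bsub>Mor C y x\<^esub> d y x f)) \<and>
        (\<forall>x\<in>Obj C. \<forall>y\<in>Obj C. \<forall>z\<in>Obj C.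
           \<forall>g\<in>carrier (Mor C z y). \<forall>f\<in>carrier (Mor C y x).
              d z x (Comp C z y x g f) =
                Comp C z y x (d z y g) f \<oplus>\<^bsub>Mor C z x\<^esub> Comp C z y x g (d y x f))}"

definition derivation_space ::
  "('k, 'r) ring_scheme \<Rightarrow> ('o, 'k, 'm) kcat \<Rightarrow> ('k, 'o \<Rightarrow> 'o \<Rightarrow> 'm \<Rightarrow> 'm) module" where
  "derivation_space K C =
     \<lparr>carrier = derivations K C,
      mult = undefined,
      one = undefined,
      zero = (\<lambda>y\<in>Obj C. \<lambda>x\<in>Obj C. \<lambda>f\<in>carrier (Mor C y x). \<zero>\<^bsub>Mor C y x\<^esub>),
      add = (\<lambda>d d'. \<lambda>y\<in>Obj C. \<lambda>x\<in>Obj C. \<lambda>f\<in>carrier (Mor C y x).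
               d y x f \<oplus>\<^bsub>Mor C y x\<^esub> d' y x f),
      smult = (\<lambda>a d. \<lambda>y\<in>Obj C. \<lambda>x\<in>Obj C. \<lambda>f\<in>carrier (Mor C y x).
               a \<odot>\<^bsub>Mor C y x\<^esub> d y x f)\<rparr>"

definition inner_derivation :: "('o, 'k, 'm) kcat \<Rightarrow> ('o \<Rightarrow> 'm) \<Rightarrow> 'o \<Rightarrow> 'o \<Rightarrow> 'm \<Rightarrow> 'm" where
  "inner_derivation C a =
     (\<lambda>y\<in>Obj C. \<lambda>x\<in>Obj C. \<lambda>f\<in>carrier (Mor C y x).
        Comp C y y x (a y) f \<ominus>\<^bsub>Mor C y x\<^esub> Comp C y x x f (a x))"

definition inner_derivations :: "('o, 'k, 'm) kcat \<Rightarrow> ('o \<Rightarrow> 'o \<Rightarrow> 'm \<Rightarrow> 'm) set" where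
  "inner_derivations C =
     {inner_derivation C a | a. \<forall>x\<in>Obj C. a x \<in> carrier (Mor C x x)}"

definition quotient_space :: "('k, 'v) module \<Rightarrow> 'v set \<Rightarrow> ('k, 'v set) module" where
  "quotient_space V W =
     \<lparr>carrier = a_rcosets\<^bsub>V\<^esub> W,
      mult = undefined,
      one = undefined,
      zero = W,
      add = set_add V,
      smult = (\<lambda>a A. \<Union>v\<in>A. W +>\<^bsub>V\<^esub> (a \<odot>\<^bsub>V\<^esub> v))\<rparr>"

definition HH1 ::
  "('k, 'r) ring_scheme \<Rightarrow> ('o, 'k, 'm) kcat \<Rightarrow> ('k, ('o \<Rightarrow> 'o \<Rightarrow> 'm \<Rightarrow> 'm) set) module" where
  "HH1 K C = quotient_space (derivation_space K C) (inner_derivations C)"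

section \<open>The Hurewicz morphism\<close>

text \<open>The additive group of \<open>K\<close> is \<open>add_monoid K\<close>; homomorphisms into it are taken extensional.\<close>

definition character_space ::
  "('k, 'r) ring_scheme \<Rightarrow> ('g, 'n) monoid_scheme \<Rightarrow> ('k, 'g \<Rightarrow> 'k) module" where
  "character_space K G =
     \<lparr>carrier = hom G (add_monoid K) \<inter> extensional (carrier G),
      mult = undefined,
      one = undefined,
      zero = (\<lambda>s\<in>carrier G. \<zero>\<^bsub>K\<^esub>),
      add = (\<lambda>\<xi> \<psi>. \<lambda>s\<in>carrier G. \<xi> s \<oplus>\<^bsub>K\<^esub> \<psi> s),
      smult = (\<lambda>a \<xi>. \<lambda>s\<in>carrier G. a \<otimes>\<^bsub>K\<^esub> \<xi> s)\<rparr>"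

definition hurewicz_derivation ::
  "('o, 'k, 'm) kcat \<Rightarrow> ('g, 'n) monoid_scheme \<Rightarrow> ('g \<Rightarrow> 'o \<Rightarrow> 'o \<Rightarrow> 'm set)
    \<Rightarrow> ('g \<Rightarrow> 'k) \<Rightarrow> 'o \<Rightarrow> 'o \<Rightarrow> 'm \<Rightarrow> 'm" where
  "hurewicz_derivation C G X \<xi> =
     (\<lambda>y\<in>Obj C. \<lambda>x\<in>Obj C. \<lambda>f\<in>carrier (Mor C y x).
        let c = (THE c. homogeneous_parts C G X y x f c)
        in \<Oplus>\<^bsub>Mor C y x\<^esub> s\<in>part_support C G y x c. \<xi> s \<odot>\<^bsub>Mor C y x\<^esub> c s)"

definition hurewicz ::
  "('k, 'r) ring_scheme \<Rightarrow> ('o, 'k, 'm) kcat \<Rightarrow> ('g, 'n) monoid_scheme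
    \<Rightarrow> ('g \<Rightarrow> 'o \<Rightarrow> 'o \<Rightarrow> 'm set) \<Rightarrow> ('g \<Rightarrow> 'k) \<Rightarrow> ('o \<Rightarrow> 'o \<Rightarrow> 'm \<Rightarrow> 'm) set" where
  "hurewicz K C G X \<xi> =
     inner_derivations C +>\<^bsub>derivation_space K C\<^esub> hurewicz_derivation C G X \<xi>"

definition vector_space_iso ::
  "('k, 'r) ring_scheme \<Rightarrow> ('k, 'v) module \<Rightarrow> ('k, 'w) module \<Rightarrow> ('v \<Rightarrow> 'w) \<Rightarrow> bool" where
  "vector_space_iso K V W h \<longleftrightarrow>
     Module.module K V \<and> Module.module K W \<and>
     h \<in> iso (add_monoid V) (add_monoid W) \<and>
     (\<forall>a\<in>carrier K. \<forall>v\<in>carrier V. h (a \<odot>\<^bsub>V\<^esub> v) = a \<odot>\<^bsub>W\<^esub> h v)"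

end

theory Submission
  imports Defs
begin

text \<open>
  In a Schurian category a derivation multiplies the basis element \<open>e y x\<close> by a scalar \<open>\<mu> y x\<close>, and the
  Leibniz rule says that \<open>\<mu>\<close> is additive on non-zero composites: it is a cellular cocycle of the
  CW-complex. Inner derivations are the coboundaries. So the theorem identifies the first cellular
  cohomology of the complex with the homomorphisms from its fundamental group to the additive group.

  Injectivity: by pushing paths off the centres of the faces, retracting them radially to the
  one-skeleton and contracting open stars of vertices, every path between vertices is homotopic to a
  composite of edges and inverse edges. Hence a homomorphism whose values on the degrees of the edges
  form a coboundary vanishes.

  Surjectivity: a cocycle \<open>\<mu>\<close> defines transition functions between the open stars of the vertices and
  the open faces, and these are locally constant. The corresponding integral along paths is invariant
  under homotopy, because lifts to the resulting covering exist over squares, and its value on the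
  edge \<open>e y x\<close> is \<open>\<mu> y x\<close>.
\<close>

section \<open>Path homotopy in abstract topological spaces\<close>

text \<open>The deformations off the face centres and into the open stars share an obstacle: on
  overlaps of the open sets the tracks of a point disagree, so they do not glue to one global
  retraction. \<open>deform_path\<close> therefore asks only that the ends of two tracks of the same
  point be joined by a path of the desired kind. For faces this join is an arc of the boundary
  circle, for stars an edge. Continuity of the tracks concerns products of an interval with an
  attaching space; since quotients need not commute with products, it rests on the compactness of
  small closed intervals.

  A degree is the class of a loop through connector walks. Hence the integral of a cocycle over the
  degree of an edge is the value of the cocycle only up to a coboundary, built from the integrals
  over the connectors. This error is an inner derivation and vanishes in \<open>HH1\<close>, so the
  homomorphism obtained from a cocycle still has the right image. Local constancy of the transition
  functions comes from a reference vertex chosen in each open cell: it turns the cocycle condition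
  into a potential along the boundary of each face.\<close>

lemma path_homotopic_imp_pathin:
  assumes "path_homotopic X p q"
  shows "pathin X p" "pathin X q"
  using homotopic_with_imp_continuous_maps[OF assms[unfolded path_homotopic_def]]
  by (auto simp: pathin_def)

lemma path_homotopic_imp_ends:
  assumes "path_homotopic X p q"
  shows "q 0 = p 0" "q 1 = p 1"
  using homotopic_with_imp_property[OF assms[unfolded path_homotopic_def]] by auto

lemma path_homotopic_iff:
  "path_homotopic X p q \<longleftrightarrow>
     (\<exists>h. continuous_map (top_of_set ({0..1::real} \<times> {0..1})) X h \<and>
        (\<forall>t\<in>{0..1}. h (0, t) = p t) \<and> (\<forall>t\<in>{0..1}. h (1, t) = q t) \<and>
        (\<forall>s\<in>{0..1}. h (s, 0) = p 0 \<and> h (s, 1) = p 1))"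
  unfolding path_homotopic_def
  by (subst homotopic_with) (auto simp: prod_topology_subtopology_eu)

lemma path_homotopicE:
  assumes "path_homotopic X p q"
  obtains h where "continuous_map (top_of_set ({0..1::real} \<times> {0..1})) X h"
    "\<And>t. t \<in> {0..1} \<Longrightarrow> h (0, t) = p t" "\<And>t. t \<in> {0..1} \<Longrightarrow> h (1, t) = q t"
    "\<And>s. s \<in> {0..1} \<Longrightarrow> h (s, 0) = p 0" "\<And>s. s \<in> {0..1} \<Longrightarrow> h (s, 1) = p 1"
  using assms unfolding path_homotopic_iff by blast

lemma path_homotopic_eqI:
  assumes "pathin X p" "\<And>t. t \<in> {0..1} \<Longrightarrow> q t = p t"
  shows "path_homotopic X p q"
  unfolding path_homotopic_def
  by (rule homotopic_with_equal) (use assms in \<open>auto simp: pathin_def\<close>)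

lemma path_homotopic_refl: "pathin X p \<Longrightarrow> path_homotopic X p p"
  by (simp add: path_homotopic_eqI)

lemma path_homotopic_sym:
  assumes "path_homotopic X p q"
  shows "path_homotopic X q p"
  using assms path_homotopic_imp_ends[OF assms]
  unfolding path_homotopic_def by (subst homotopic_with_sym) simp

lemma path_homotopic_trans [trans]:
  assumes "path_homotopic X p q" "path_homotopic X q r"
  shows "path_homotopic X p r"
  using assms path_homotopic_imp_ends[OF assms(1)]
  unfolding path_homotopic_def by (auto intro: homotopic_with_trans)

lemma path_homotopic_compose:
  assumes "path_homotopic X p q" "continuous_map X Y f"
  shows "path_homotopic Y (f \<circ> p) (f \<circ> q)"
  using assms(1) unfolding path_homotopic_def
  by (rule homotopic_with_compose_continuous_map_left[OF _ assms(2)]) auto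

text \<open>The straight-line homotopy in \<open>S\<close>, carried over by \<open>f\<close>.
  Reparametrisation is the case of the unit interval, \<open>path_homotopic_square\<close> that of
  the unit square, \<open>disc_paths_homotopic\<close> that of the disc of a face.\<close>

lemma path_homotopic_convex:
  fixes S :: "'a::real_normed_vector set"
  assumes f: "continuous_map (top_of_set S) X f" and "convex S"
    and g: "continuous_on {0..1} g" "g \<in> {0..1} \<rightarrow> S"
    and h: "continuous_on {0..1} h" "h \<in> {0..1} \<rightarrow> S"
    and ends: "h 0 = g 0" "h 1 = g 1"
  shows "path_homotopic X (f \<circ> g) (f \<circ> h)"
proof (rule path_homotopic_compose[OF _ f])
  let ?H = "\<lambda>z. (1 - fst z) *\<^sub>R g (snd z) + fst z *\<^sub>R h (snd z)"
  have "continuous_on ({0..1} \<times> {0..1}) ?H"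
    by (intro continuous_intros continuous_on_compose2[OF g(1)] continuous_on_compose2[OF h(1)]) auto
  moreover have "?H \<in> {0..1} \<times> {0..1} \<rightarrow> S"
    using g(2) h(2) \<open>convex S\<close> by (auto simp: convex_alt Pi_iff)
  ultimately show "path_homotopic (top_of_set S) g h"
    unfolding path_homotopic_iff
    by (intro exI[of _ ?H]) (auto simp: ends algebra_simps Pi_iff simp flip: scaleR_add_left)
qed

lemma path_homotopic_reparam:
  assumes "pathin X p"
    and "continuous_on {0..1} g" "g \<in> {0..1} \<rightarrow> {0..1}"
    and "continuous_on {0..1} h" "h \<in> {0..1} \<rightarrow> {0..1}"
    and "h 0 = g 0" "h 1 = g 1"
  shows "path_homotopic X (p \<circ> g) (p \<circ> h)"
  by (rule path_homotopic_convex[of "{0..1::real}"]) (use assms in \<open>auto simp: pathin_def\<close>)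

section \<open>Concatenation of paths and its laws up to homotopy\<close>

lemma path_join_0 [simp]: "path_join p q 0 = p 0"
  and path_join_1 [simp]: "path_join p q 1 = q 1"
  by (simp_all add: path_join_def)

lemma path_join_compose: "f \<circ> path_join p q = path_join (f \<circ> p) (f \<circ> q)"
  by (auto simp: path_join_def fun_eq_iff)

text \<open>The parameter set \<open>S\<close> lets one continuity proof serve twice: a singleton
  gives the join of two paths, the unit interval the join of two homotopies.\<close>

lemma continuous_map_path_join:
  assumes h: "continuous_map (top_of_set (S \<times> {0..1})) X h"
    and k: "continuous_map (top_of_set (S \<times> {0..1})) X k"
    and hk: "\<And>s. s \<in> S \<Longrightarrow> h (s, 1) = k (s, 0)"
  shows "continuous_map (top_of_set (S \<times> {0..1})) X (\<lambda>(s, t). path_join (\<lambda>t. h (s, t)) (\<lambda>t. k (s,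
      t)) t)"
proof -
  have "continuous_map (top_of_set (S \<times> {0..1})) X
      (\<lambda>z. if snd z \<le> 1/2 then h (fst z, 2 * snd z) else k (fst z, 2 * snd z - 1))"
  proof (rule continuous_map_cases_le)
    show "continuous_map (subtopology (top_of_set (S \<times> {0..1}))
        {x \<in> topspace (top_of_set (S \<times> {0..1})). snd x \<le> 1/2}) X (\<lambda>z. h (fst z, 2 * snd z))"
      by (rule continuous_map_compose[OF _ h, unfolded o_def])
        (auto simp: subtopology_subtopology image_subset_iff continuous_map_in_subtopology
          intro!: continuous_intros)
    show "continuous_map (subtopology (top_of_set (S \<times> {0..1}))
        {x \<in> topspace (top_of_set (S \<times> {0..1})). 1/2 \<le> snd x}) X (\<lambda>z. k (fst z, 2 * snd z - 1))"
      by (rule continuous_map_compose[OF _ k, unfolded o_def])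
        (auto simp: subtopology_subtopology image_subset_iff continuous_map_in_subtopology
          intro!: continuous_intros)
    show "h (fst z, 2 * snd z) = k (fst z, 2 * snd z - 1)"
      if "z \<in> topspace (top_of_set (S \<times> {0..1}))" "snd z = 1/2" for z
      using hk[of "fst z"] that by (cases z) (simp del: divide_eq_eq_numeral1 eq_divide_eq_numeral1)
  qed (auto intro!: continuous_intros simp: continuous_map_in_subtopology)
  then show ?thesis
    by (rule continuous_map_eq) (auto simp: path_join_def)
qed

lemma pathin_path_join:
  assumes "pathin X p" "pathin X q" "p 1 = q 0"
  shows "pathin X (path_join p q)"
proof -
  have 1: "continuous_map (top_of_set ({0::real} \<times> {0..1})) X
      (\<lambda>(s, t). path_join (\<lambda>t. (p \<circ> snd) (s, t)) (\<lambda>t. (q \<circ> snd) (s, t)) t)"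
    by (intro continuous_map_path_join continuous_map_compose[OF _ assms(1)[unfolded pathin_def]]
        continuous_map_compose[OF _ assms(2)[unfolded pathin_def]])
      (auto intro!: continuous_intros simp: assms(3))
  have 2: "continuous_map (top_of_set {0..1::real}) (top_of_set ({0::real} \<times> {0..1})) (\<lambda>t. (0, t))"
    by (auto intro!: continuous_intros)
  show ?thesis
    using continuous_map_compose[OF 2 1] by (simp add: pathin_def o_def)
qed

lemma path_homotopic_join:
  assumes "path_homotopic X p p'" "path_homotopic X q q'" "p 1 = q 0"
  shows "path_homotopic X (path_join p q) (path_join p' q')"
proof -
  obtain h where h: "continuous_map (top_of_set ({0..1::real} \<times> {0..1})) X h"
      "\<And>t. t \<in> {0..1} \<Longrightarrow> h (0, t) = p t" "\<And>t. t \<in> {0..1} \<Longrightarrow> h (1, t) = p' t"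
      "\<And>s. s \<in> {0..1} \<Longrightarrow> h (s, 0) = p 0" "\<And>s. s \<in> {0..1} \<Longrightarrow> h (s, 1) = p 1"
    using path_homotopicE[OF assms(1)] by blast
  obtain k where k: "continuous_map (top_of_set ({0..1::real} \<times> {0..1})) X k"
      "\<And>t. t \<in> {0..1} \<Longrightarrow> k (0, t) = q t" "\<And>t. t \<in> {0..1} \<Longrightarrow> k (1, t) = q' t"
      "\<And>s. s \<in> {0..1} \<Longrightarrow> k (s, 0) = q 0" "\<And>s. s \<in> {0..1} \<Longrightarrow> k (s, 1) = q 1"
    using path_homotopicE[OF assms(2)] by blast
  show ?thesis
    unfolding path_homotopic_iff
  proof (intro exI[of _ "\<lambda>(s, t). path_join (\<lambda>t. h (s, t)) (\<lambda>t. k (s, t)) t"] conjI ballI)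
    show "continuous_map (top_of_set ({0..1} \<times> {0..1})) X
        (\<lambda>(s, t). path_join (\<lambda>t. h (s, t)) (\<lambda>t. k (s, t)) t)"
      by (rule continuous_map_path_join[OF h(1) k(1)]) (simp add: h(5) k(4) assms(3))
  next
    fix t :: real assume "t \<in> {0..1}"
    then show "(case (0, t) of (s, t) \<Rightarrow> path_join (\<lambda>t. h (s, t)) (\<lambda>t. k (s, t)) t) = path_join p q t"
      "(case (1, t) of (s, t) \<Rightarrow> path_join (\<lambda>t. h (s, t)) (\<lambda>t. k (s, t)) t) = path_join p' q' t"
      by (simp_all add: path_join_def h(2,3) k(2,3))
  qed (simp_all add: h(4) k(5))
qed

definition reverse_path :: "(real \<Rightarrow> 'p) \<Rightarrow> real \<Rightarrow> 'p" where
  "reverse_path p = p \<circ> (\<lambda>t. 1 - t)"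

lemma reverse_path_ends [simp]:
  "reverse_path p 0 = p 1" "reverse_path p 1 = p 0"
  by (simp_all add: reverse_path_def)

lemma pathin_reparam:
  assumes "pathin X p" "continuous_on {0..1} g" "g \<in> {0..1} \<rightarrow> {0..1}"
  shows "pathin X (p \<circ> g)"
  using path_homotopic_imp_pathin(1)[OF path_homotopic_reparam[OF assms assms(2,3)]] by simp

lemma pathin_reverse: "pathin X p \<Longrightarrow> pathin X (reverse_path p)"
  unfolding reverse_path_def by (rule pathin_reparam) (auto intro!: continuous_intros)

lemma path_homotopic_reverse:
  assumes "path_homotopic X p q"
  shows "path_homotopic X (reverse_path p) (reverse_path q)"
proof -
  obtain h where h: "continuous_map (top_of_set ({0..1::real} \<times> {0..1})) X h"
      "\<And>t. t \<in> {0..1} \<Longrightarrow> h (0, t) = p t" "\<And>t. t \<in> {0..1} \<Longrightarrow> h (1, t) = q t"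
      "\<And>s. s \<in> {0..1} \<Longrightarrow> h (s, 0) = p 0" "\<And>s. s \<in> {0..1} \<Longrightarrow> h (s, 1) = p 1"
    using path_homotopicE[OF assms] by blast
  have "continuous_map (top_of_set ({0..1} \<times> {0..1})) X (h \<circ> (\<lambda>z. (fst z, 1 - snd z)))"
    by (rule continuous_map_compose[OF _ h(1)]) (auto intro!: continuous_intros)
  with h show ?thesis
    unfolding path_homotopic_iff reverse_path_def
    by (intro exI[of _ "h \<circ> (\<lambda>z. (fst z, 1 - snd z))"]) auto
qed

lemma continuous_on_path_join_real:
  fixes g h :: "real \<Rightarrow> 'a::topological_space"
  assumes "continuous_on {0..1} g" "continuous_on {0..1} h" "g 1 = h 0"
  shows "continuous_on {0..1} (path_join g h)"
  using pathin_path_join[of euclidean g h] assms by (simp add: pathin_def)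

lemma path_join_mem:
  assumes "g \<in> {0..1} \<rightarrow> S" "h \<in> {0..1} \<rightarrow> S"
  shows "path_join g h \<in> {0..1} \<rightarrow> S"
  using assms by (auto simp: path_join_def Pi_iff)

lemma path_homotopic_assoc:
  assumes "pathin X p" "pathin X q" "pathin X r" "p 1 = q 0" "q 1 = r 0"
  shows "path_homotopic X (path_join (path_join p q) r) (path_join p (path_join q r))"
proof -
  let ?f = "path_join (path_join p q) r"
  \<comment> \<open>Maps the intervals with ends 0, 1/2, 3/4, 1, on which the right-bracketed join
    runs through \<open>p\<close>, \<open>q\<close>, \<open>r\<close>, affinely onto those with ends
    0, 1/4, 1/2, 1 of the left-bracketed join.\<close>
  let ?g = "path_join (\<lambda>t. t / 4) (path_join (\<lambda>t. (1 + t) / 4) (\<lambda>t. (1 + t) / 2))"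
  have f: "pathin X ?f"
    using assms by (intro pathin_path_join) auto
  have g: "continuous_on {0..1} ?g" "?g \<in> {0..1} \<rightarrow> {0..1}"
    by ((intro continuous_on_path_join_real path_join_mem continuous_intros)?; auto)+
  have "path_homotopic X (?f \<circ> id) (?f \<circ> ?g)"
    by (rule path_homotopic_reparam[OF f _ _ g]) auto
  moreover have "?f (?g t) = path_join p (path_join q r) t" for t
    by (auto simp: path_join_def field_simps intro!: arg_cong[of _ _ q] arg_cong[of _ _ r])
  ultimately show ?thesis
    by (simp add: o_def)
qed

lemma path_homotopic_join_const:
  assumes "pathin X p"
  shows "path_homotopic X (path_join p (\<lambda>_. p 1)) p"
proof -
  have "path_homotopic X (p \<circ> path_join (\<lambda>t. t) (\<lambda>_. 1)) (p \<circ> id)"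
    by (rule path_homotopic_reparam[OF assms])
      ((intro continuous_on_path_join_real path_join_mem continuous_intros)?; auto)+
  then show ?thesis
    unfolding path_join_compose by (simp add: o_def)
qed

lemma path_homotopic_const_join:
  assumes "pathin X p"
  shows "path_homotopic X (path_join (\<lambda>_. p 0) p) p"
proof -
  have "path_homotopic X (p \<circ> path_join (\<lambda>_. 0) (\<lambda>t. t)) (p \<circ> id)"
    by (rule path_homotopic_reparam[OF assms])
      ((intro continuous_on_path_join_real path_join_mem continuous_intros)?; auto)+
  then show ?thesis
    unfolding path_join_compose by (simp add: o_def)
qed

lemma path_homotopic_join_reverse:
  assumes "pathin X p"
  shows "path_homotopic X (path_join p (reverse_path p)) (\<lambda>_. p 0)"
proof -
  have "path_homotopic X (p \<circ> path_join (\<lambda>t. t) (\<lambda>t. 1 - t)) (p \<circ> (\<lambda>_. 0))"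
    by (rule path_homotopic_reparam[OF assms])
      ((intro continuous_on_path_join_real path_join_mem continuous_intros)?; auto)+
  then show ?thesis
    unfolding path_join_compose by (simp add: o_def reverse_path_def)
qed

lemma reverse_reverse_path [simp]: "reverse_path (reverse_path p) = p"
  by (simp add: reverse_path_def fun_eq_iff)

lemma path_homotopic_reverse_join:
  assumes "pathin X p"
  shows "path_homotopic X (path_join (reverse_path p) p) (\<lambda>_. p 1)"
  using path_homotopic_join_reverse[OF pathin_reverse[OF assms]] by simp

lemma linepath_mem_unit:
  assumes "0 \<le> a" "a \<le> b" "b \<le> 1" "t \<in> {0..1}"
  shows "linepath a b t \<in> {a..b :: real}"
proof -
  have "linepath a b ` {0..1} = {a..b}"
    using assms path_image_linepath[of a b] by (simp add: path_image_def closed_segment_eq_real_ivl)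
  with assms(4) show ?thesis by blast
qed

lemma path_homotopic_subpaths:
  assumes "pathin X p" "0 \<le> a" "a \<le> b" "b \<le> c" "c \<le> 1"
  shows "path_homotopic X (p \<circ> linepath a c) (path_join (p \<circ> linepath a b) (p \<circ> linepath b c))"
proof -
  have mem: "linepath x y \<in> {0..1} \<rightarrow> {0..1}" if "0 \<le> x" "x \<le> y" "y \<le> 1" for x y :: real
    using that linepath_mem_unit[of x y] by force
  have cont: "continuous_on {0..1} (linepath x y)" for x y :: real
    by (intro continuous_on_linepath)
  have "path_homotopic X (p \<circ> linepath a c) (p \<circ> path_join (linepath a b) (linepath b c))"
    by (rule path_homotopic_reparam[OF assms(1)])
      ((intro cont mem continuous_on_path_join_real path_join_mem)?; use assms
          in \<open>simp add: linepath_0' linepath_1'\<close>)+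
  then show ?thesis
    by (simp add: path_join_compose)
qed

text \<open>Both routes lead from \<open>(0, 0)\<close> to \<open>(1, 1)\<close> in a convex set. In
  \<open>deform_path\<close> one route is a path followed by the track of its end, the other the
  track of its start followed by the displaced path.\<close>

lemma path_homotopic_square:
  assumes "continuous_map (top_of_set ({0..1} \<times> {0..1})) X H"
  shows "path_homotopic X (path_join (\<lambda>t. H (0, t)) (\<lambda>s. H (s, 1))) (path_join (\<lambda>s. H (s, 0)) (\<lambda>t. H
      (1, t)))"
proof -
  have "path_homotopic X (H \<circ> path_join (\<lambda>t. (0, t)) (\<lambda>s. (s, 1))) (H \<circ> path_join (\<lambda>s. (s, 0)) (\<lambda>t.
      (1, t)))"
    by (rule path_homotopic_convex[OF assms])
      ((intro convex_Times continuous_on_path_join_real path_join_mem continuous_intros)?; auto)+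
  then show ?thesis
    unfolding path_join_compose by (simp add: o_def)
qed

section \<open>The fundamental group\<close>

lemma path_class_eq:
  assumes "path_homotopic X p q"
  shows "path_class X p = path_class X q"
  unfolding path_class_def using assms path_homotopic_sym path_homotopic_trans by blast

lemma path_class_self: "pathin X p \<Longrightarrow> p \<in> path_class X p"
  by (simp add: path_class_def path_homotopic_refl)

lemma loops_at_join:
  "p \<in> loops_at X b \<Longrightarrow> q \<in> loops_at X b \<Longrightarrow> path_join p q \<in> loops_at X b"
  by (auto simp: loops_at_def pathin_path_join)

lemma loops_at_reverse: "p \<in> loops_at X b \<Longrightarrow> reverse_path p \<in> loops_at X b"
  by (auto simp: loops_at_def pathin_reverse)

text \<open>The product is a union over all pairs of representatives. Joins of homotopic paths are
  homotopic, so every member of the union is the same class, and both index sets are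
  inhabited.\<close>

lemma fundamental_group_mult:
  assumes "p \<in> loops_at X b" "q \<in> loops_at X b"
  shows "path_class X p \<otimes>\<^bsub>fundamental_group X b\<^esub> path_class X q = path_class X (path_join q p)"
proof -
  have pq: "pathin X p" "pathin X q" "q 1 = p 0"
    using assms by (auto simp: loops_at_def)
  have "path_class X (path_join q' p') = path_class X (path_join q p)"
    if "p' \<in> path_class X p" "q' \<in> path_class X q" for p' q'
  proof (rule path_class_eq[symmetric], rule path_homotopic_join)
    show "path_homotopic X q q'" "path_homotopic X p p'"
      using that by (simp_all add: path_class_def)
  qed (rule pq)
  then have "(\<Union>p'\<in>path_class X p. \<Union>q'\<in>path_class X q. path_class X (path_join q' p')) =
      (\<Union>p'\<in>path_class X p. \<Union>q'\<in>path_class X q. path_class X (path_join q p))"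
    by simp
  then show ?thesis
    using path_class_self[OF pq(1)] path_class_self[OF pq(2)]
    by (simp add: fundamental_group_def) blast
qed

lemma fundamental_group_carrier:
  "carrier (fundamental_group X b) = path_class X ` loops_at X b"
  by (simp add: fundamental_group_def)

lemma fundamental_group_one: "\<one>\<^bsub>fundamental_group X b\<^esub> = path_class X (\<lambda>_. b)"
  by (simp add: fundamental_group_def)

lemma fundamental_group_is_group:
  assumes "b \<in> topspace X"
  shows "Group.group (fundamental_group X b)"
proof (rule groupI)
  let ?G = "fundamental_group X b"
  have const: "(\<lambda>_. b) \<in> loops_at X b"
    using assms by (auto simp: loops_at_def)
  show "\<one>\<^bsub>?G\<^esub> \<in> carrier ?G"
    using const by (auto simp: fundamental_group_carrier fundamental_group_one)
  fix A assume "A \<in> carrier ?G"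
  then obtain p where p: "A = path_class X p" "p \<in> loops_at X b"
    by (auto simp: fundamental_group_carrier)
  have p': "pathin X p" "p 0 = b" "p 1 = b"
    using p by (auto simp: loops_at_def)
  show "\<one>\<^bsub>?G\<^esub> \<otimes>\<^bsub>?G\<^esub> A = A"
    using path_homotopic_join_const[OF p'(1)] p'
    by (simp add: fundamental_group_mult const p fundamental_group_one path_class_eq)
  show "\<exists>B\<in>carrier ?G. B \<otimes>\<^bsub>?G\<^esub> A = \<one>\<^bsub>?G\<^esub>"
  proof
    show "path_class X (reverse_path p) \<in> carrier ?G"
      using loops_at_reverse[OF p(2)] by (auto simp: fundamental_group_carrier)
    show "path_class X (reverse_path p) \<otimes>\<^bsub>?G\<^esub> A = \<one>\<^bsub>?G\<^esub>"
      using path_homotopic_join_reverse[OF p'(1)] p' p loops_at_reverse[OF p(2)]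
      by (simp add: fundamental_group_mult const fundamental_group_one path_class_eq)
  qed
  fix B assume "B \<in> carrier ?G"
  then obtain q where q: "B = path_class X q" "q \<in> loops_at X b"
    by (auto simp: fundamental_group_carrier)
  show "A \<otimes>\<^bsub>?G\<^esub> B \<in> carrier ?G"
    using p q loops_at_join[OF q(2) p(2)] by (auto simp: fundamental_group_mult
        fundamental_group_carrier)
  fix C assume "C \<in> carrier ?G"
  then obtain r where r: "C = path_class X r" "r \<in> loops_at X b"
    by (auto simp: fundamental_group_carrier)
  have "path_homotopic X (path_join (path_join r q) p) (path_join r (path_join q p))"
    using p q r by (intro path_homotopic_assoc) (auto simp: loops_at_def)
  then show "A \<otimes>\<^bsub>?G\<^esub> B \<otimes>\<^bsub>?G\<^esub> C = A \<otimes>\<^bsub>?G\<^esub> (B \<otimes>\<^bsub>?G\<^esub> C)"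
    using p q r
    by (simp add: loops_at_join fundamental_group_mult path_class_eq[OF path_homotopic_sym])
qed

section \<open>Continuity on attaching spaces\<close>

text \<open>By the tube lemma, a compact slice inside \<open>U\<close> has a product neighbourhood
  inside \<open>U\<close>. Applied with \<open>J\<close> a compact piece of the unit interval, this
  tests continuity of homotopies on attaching spaces.\<close>

lemma openin_tube:
  assumes "openin (prod_topology T Z) U" "compactin T J"
  shows "openin Z {z \<in> topspace Z. J \<times> {z} \<subseteq> U}"
proof (subst openin_subopen, intro ballI)
  fix z assume z: "z \<in> {z \<in> topspace Z. J \<times> {z} \<subseteq> U}"
  obtain A B where "openin T A" "openin Z B" "J \<subseteq> A" "z \<in> B" "A \<times> B \<subseteq> U"
    using tube_lemma_left[OF assms, of z] z by auto
  then show "\<exists>T. openin Z T \<and> z \<in> T \<and> T \<subseteq> {z \<in> topspace Z. J \<times> {z} \<subseteq> U}"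
    using openin_subset[of Z B] by (intro exI[of _ B]) auto
qed

locale cell_attachment =
  fixes X :: "'p topology" and D S :: "('d::topological_space) set" and I :: "'i set"
    and \<phi> :: "'i \<Rightarrow> 'd \<Rightarrow> 'p"
  assumes attach_in_topspace: "\<And>i p. \<lbrakk>i \<in> I; p \<in> S\<rbrakk> \<Longrightarrow> \<phi> i p \<in> topspace X"
    and boundary_subset: "S \<subseteq> D"
begin

abbreviation "Y \<equiv> attach_cells X D S I \<phi>"
abbreviation "chi \<equiv> characteristic_map S \<phi>"

lemma openin_attach_iff:
  "openin Y U \<longleftrightarrow>
     U \<subseteq> Inl ` topspace X \<union> Inr ` (I \<times> (D - S)) \<and> openin X (Inl -` U) \<and>
     (\<forall>i\<in>I. openin (top_of_set D) {p \<in> D. chi i p \<in> U})"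
  by (simp add: openin_attach_cells attach_open_def)

lemma topspace_attach: "topspace Y = Inl ` topspace X \<union> Inr ` (I \<times> (D - S))" (is "_ = ?A")
proof -
  have "{p \<in> D. chi i p \<in> ?A} = D" if "i \<in> I" for i
    using that attach_in_topspace by (auto simp: characteristic_map_def)
  moreover have "Inl -` ?A = topspace X"
    by auto
  ultimately have "openin Y ?A"
    unfolding openin_attach_iff by simp
  moreover have "topspace Y \<subseteq> ?A"
    using openin_topspace[of Y] unfolding openin_attach_iff by simp
  ultimately show ?thesis
    using openin_subset by blast
qed

lemma continuous_map_Inl: "continuous_map X Y Inl"
  unfolding continuous_map_def
proof (intro conjI allI impI)
  fix U assume "openin Y U"
  then have U: "openin X (Inl -` U)"
    unfolding openin_attach_iff by simp
  moreover have "{x \<in> topspace X. Inl x \<in> U} = Inl -` U"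
    using openin_subset[OF U] by auto
  ultimately show "openin X {x \<in> topspace X. Inl x \<in> U}"
    by simp
qed (auto simp: topspace_attach)

lemma chi_in_topspace: "i \<in> I \<Longrightarrow> p \<in> D \<Longrightarrow> chi i p \<in> topspace Y"
  using attach_in_topspace by (auto simp: characteristic_map_def topspace_attach)

lemma continuous_map_chi: "i \<in> I \<Longrightarrow> continuous_map (top_of_set D) Y (chi i)"
  unfolding continuous_map_def using chi_in_topspace by (auto simp: openin_attach_iff)

lemma topspace_attach_cases:
  assumes "x \<in> topspace Y"
  obtains q where "q \<in> topspace X" "x = Inl q"
  | i p where "i \<in> I" "p \<in> D" "p \<notin> S" "x = chi i p" "x = Inr (i, p)"
  using assms by (auto simp: topspace_attach characteristic_map_def)

lemma openin_chi_preimage: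
  assumes "openin Y W" "i \<in> I"
  shows "openin (top_of_set D) {p \<in> D. chi i p \<in> W}"
  using assms unfolding openin_attach_iff by simp

lemma openin_Inl_preimage: "openin Y W \<Longrightarrow> openin X (Inl -` W)"
  unfolding openin_attach_iff by simp

text \<open>Because \<open>W\<close> is open, openness in \<open>W\<close> is openness in the whole
  space, where the quotient criterion applies; the preimages of \<open>W\<close> are open too, so
  the criterion can be restricted to them.\<close>

lemma openin_subtopology_attach_iff:
  assumes W: "openin Y W" and "U \<subseteq> W"
  shows "openin (subtopology Y W) U \<longleftrightarrow>
     openin (subtopology X (Inl -` W)) (Inl -` U) \<and>
     (\<forall>i\<in>I. openin (top_of_set {p \<in> D. chi i p \<in> W}) {p \<in> D. chi i p \<in> U})"
proof -
  have "openin (top_of_set {p \<in> D. chi i p \<in> W}) {p \<in> D. chi i p \<in> U} \<longleftrightarrow>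
      openin (top_of_set D) {p \<in> D. chi i p \<in> U}" if "i \<in> I" for i
  proof -
    have "top_of_set {p \<in> D. chi i p \<in> W} = subtopology (top_of_set D) {p \<in> D. chi i p \<in> W}"
      by (simp add: subtopology_subtopology Int_def)
    then show ?thesis
      using assms openin_chi_preimage[OF W that] by (auto simp: openin_open_subtopology)
  qed
  moreover have "U \<subseteq> Inl ` topspace X \<union> Inr ` (I \<times> (D - S))"
    using openin_subset[OF W] \<open>U \<subseteq> W\<close> topspace_attach by simp
  moreover have "Inl -` U \<subseteq> Inl -` W"
    using \<open>U \<subseteq> W\<close> by auto
  ultimately show ?thesis
    using assms openin_Inl_preimage[OF W]
    by (simp add: openin_open_subtopology openin_attach_iff[of U])
qed

text \<open>The universal property of the quotient, localised to an open set, for maps such as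
  \<open>radial\<close> whose continuity is wanted only on part of the space.\<close>

lemma continuous_map_from_attach:
  assumes W: "openin Y W"
    and hX: "continuous_map (subtopology X (Inl -` W)) Z (h \<circ> Inl)"
    and hD: "\<And>i. i \<in> I \<Longrightarrow> continuous_map (top_of_set {p \<in> D. chi i p \<in> W}) Z (h \<circ> chi i)"
  shows "continuous_map (subtopology Y W) Z h"
  unfolding continuous_map_def
proof (intro conjI allI impI)
  have top: "topspace (subtopology Y W) = W"
    using openin_subset[OF W] by auto
  have "h x \<in> topspace Z" if "x \<in> W" for x
  proof -
    have "x \<in> topspace Y"
      using that openin_subset[OF W] by blast
    then show ?thesis
    proof (cases rule: topspace_attach_cases)
      case (1 q)
      with that show ?thesis
        using continuous_map_funspace[OF hX] by auto
    next
      case (2 i p)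
      with that show ?thesis
        using continuous_map_funspace[OF hD[OF 2(1)]] by auto
    qed
  qed
  with top show "h \<in> topspace (subtopology Y W) \<rightarrow> topspace Z"
    by simp
  fix V assume V: "openin Z V"
  have "openin (subtopology Y W) {x \<in> W. h x \<in> V}"
  proof (subst openin_subtopology_attach_iff[OF W], force, intro conjI ballI)
    have "Inl -` {x \<in> W. h x \<in> V} = {q \<in> topspace (subtopology X (Inl -` W)). (h \<circ> Inl) q \<in> V}"
      using openin_subset[OF openin_Inl_preimage[OF W]] by auto
    then show "openin (subtopology X (Inl -` W)) (Inl -` {x \<in> W. h x \<in> V})"
      using openin_continuous_map_preimage[OF hX V] by simp
    fix i assume i: "i \<in> I"
    have "{p \<in> D. chi i p \<in> {x \<in> W. h x \<in> V}} =
        {p \<in> topspace (top_of_set {p \<in> D. chi i p \<in> W}). (h \<circ> chi i) p \<in> V}"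
      by auto
    then show "openin (top_of_set {p \<in> D. chi i p \<in> W}) {p \<in> D. chi i p \<in> {x \<in> W. h x \<in> V}}"
      using openin_continuous_map_preimage[OF hD[OF i] V] by simp
  qed
  then show "openin (subtopology Y W) {x \<in> topspace (subtopology Y W). h x \<in> V}"
    using top by simp
qed

text \<open>The product of a quotient map with another space need not be a quotient map; here local
  compactness of the interval saves the criterion. Near \<open>(s, x)\<close> the points whose slice
  over a compact neighbourhood \<open>J\<close> of \<open>s\<close> is mapped into \<open>V\<close>
  form a set \<open>U\<close>, which is open because its preimage in each piece is open by
  \<open>openin_tube\<close>.\<close>

lemma continuous_map_unit_times_attach:
  assumes W: "openin Y W"
    and hX: "continuous_map (prod_topology (top_of_set {0..1::real}) (subtopology X (Inl -` W))) Z
        (\<lambda>(s, q). h (s, Inl q))"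
    and hD: "\<And>i. i \<in> I \<Longrightarrow>
        continuous_map (prod_topology (top_of_set {0..1}) (top_of_set {p \<in> D. chi i p \<in> W})) Z
          (\<lambda>(s, p). h (s, chi i p))"
  shows "continuous_map (prod_topology (top_of_set {0..1}) (subtopology Y W)) Z h"
  unfolding continuous_map_def
proof (intro conjI allI impI)
  let ?T = "top_of_set {0..1::real}"
  have top: "topspace (subtopology Y W) = W"
    using openin_subset[OF W] by auto
  have topX: "topspace (subtopology X (Inl -` W)) = Inl -` W"
    using openin_subset[OF openin_Inl_preimage[OF W]] by auto
  have cs: "continuous_map ?T Z (\<lambda>s. h (s, x))" if "x \<in> W" for x
  proof -
    have "x \<in> topspace Y"
      using that openin_subset[OF W] by blast
    then show ?thesis
    proof (cases rule: topspace_attach_cases)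
      case (1 q)
      have "continuous_map ?T (prod_topology ?T (subtopology X (Inl -` W))) (\<lambda>s. (s, q))"
        using 1 that topX by (simp add: continuous_map_pairwise o_def)
      from continuous_map_compose[OF this hX] show ?thesis
        by (simp add: o_def 1)
    next
      case (2 i p)
      have "continuous_map ?T (prod_topology ?T (top_of_set {p \<in> D. chi i p \<in> W})) (\<lambda>s. (s, p))"
        using 2 that by (auto simp: continuous_map_pairwise o_def intro!: continuous_intros)
      from continuous_map_compose[OF this hD[OF 2(1)]] show ?thesis
        by (simp add: o_def 2(4))
    qed
  qed
  then show "h \<in> topspace (prod_topology ?T (subtopology Y W)) \<rightarrow> topspace Z"
    using top by (fastforce simp: continuous_map_def)
  fix V assume V: "openin Z V"
  have "openin (prod_topology ?T (subtopology Y W)) {z \<in> {0..1} \<times> W. h z \<in> V}"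
    unfolding openin_prod_topology_alt
  proof (intro allI impI)
    fix s x assume "(s, x) \<in> {z \<in> {0..1} \<times> W. h z \<in> V}"
    then have sx: "s \<in> {0..1}" "x \<in> W" "h (s, x) \<in> V"
      by auto
    have "openin ?T {s \<in> {0..1}. h (s, x) \<in> V}"
      using openin_continuous_map_preimage[OF cs[OF sx(2)] V] by simp
    then obtain d where d: "d > 0" "cball s d \<inter> {0..1} \<subseteq> {s \<in> {0..1}. h (s, x) \<in> V}"
      using sx by (auto simp: openin_contains_cball)
    \<comment> \<open>The closed ball makes \<open>J\<close> compact; the open ball inside it later
      serves as the first factor of the product neighbourhood.\<close>
    define J where "J = cball s d \<inter> {0..1}"
    have J: "compactin ?T J"
      unfolding J_def by (simp add: compactin_subtopology compact_Int)
    define U where "U = {y \<in> W. \<forall>t\<in>J. h (t, y) \<in> V}"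
    have "openin (subtopology Y W) U"
    proof (subst openin_subtopology_attach_iff[OF W], force simp: U_def, intro conjI ballI)
      let ?X = "subtopology X (Inl -` W)"
      have "openin ?X {q \<in> topspace ?X. J \<times> {q} \<subseteq>
          {z \<in> topspace (prod_topology ?T ?X). (\<lambda>(s, q). h (s, Inl q)) z \<in> V}}"
        by (intro openin_tube[of ?T] J openin_continuous_map_preimage[OF hX V])
      also have "{q \<in> topspace ?X. J \<times> {q} \<subseteq>
          {z \<in> topspace (prod_topology ?T ?X). (\<lambda>(s, q). h (s, Inl q)) z \<in> V}} = Inl -` U"
        using topX by (auto simp: U_def J_def)
      finally show "openin ?X (Inl -` U)" .
      fix i assume i: "i \<in> I"
      let ?X = "top_of_set {p \<in> D. chi i p \<in> W}"
      have "openin ?X {q \<in> topspace ?X. J \<times> {q} \<subseteq>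
          {z \<in> topspace (prod_topology ?T ?X). (\<lambda>(s, p). h (s, chi i p)) z \<in> V}}"
        by (intro openin_tube[of ?T] J openin_continuous_map_preimage[OF hD[OF i] V])
      also have "{q \<in> topspace ?X. J \<times> {q} \<subseteq>
          {z \<in> topspace (prod_topology ?T ?X). (\<lambda>(s, p). h (s, chi i p)) z \<in> V}} = {p \<in> D. chi i p \<in> U}"
        by (auto simp: U_def J_def)
      finally show "openin ?X {p \<in> D. chi i p \<in> U}" .
    qed
    moreover have "openin ?T (ball s d \<inter> {0..1})"
      by (metis Int_commute open_ball openin_open_Int)
    moreover have "(ball s d \<inter> {0..1}) \<times> U \<subseteq> {z \<in> {0..1} \<times> W. h z \<in> V}"
      by (auto simp: U_def J_def)
    moreover have "x \<in> U"
      using d sx by (auto simp: U_def J_def)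
    ultimately show "\<exists>A B. openin ?T A \<and> openin (subtopology Y W) B \<and> s \<in> A \<and> x \<in> B \<and>
        A \<times> B \<subseteq> {z \<in> {0..1} \<times> W. h z \<in> V}"
      using d sx by (intro exI[of _ "ball s d \<inter> {0..1}"] exI[of _ U]) auto
  qed
  then show "openin (prod_topology ?T (subtopology Y W))
      {z \<in> topspace (prod_topology ?T (subtopology Y W)). h z \<in> V}"
    using top by (simp add: topspace_prod_topology)
qed

end

section \<open>Deforming paths into a class of paths\<close>

lemma pathin_subpath:
  assumes "pathin X p" "0 \<le> a" "a \<le> b" "b \<le> 1"
  shows "pathin X (p \<circ> linepath a b)"
  by (rule pathin_reparam[OF assms(1) continuous_on_linepath])
    (use assms linepath_mem_unit[of a b] in force)

text \<open>
  Each point \<open>x\<close> of \<open>U i\<close> is moved along its track \<open>\<lambda>s. c i (s, x)\<close>. A path inside \<open>U i\<close> followed by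
  the track of its end is homotopic to the track of its start followed by a path in \<open>\<G>\<close>; the
  general case follows by subdivision.
\<close>

proposition deform_path:
  assumes U: "\<And>i. i \<in> I \<Longrightarrow> openin X (U i)"
    and cover: "topspace X \<subseteq> (\<Union>i\<in>I. U i)"
    and c: "\<And>i. i \<in> I \<Longrightarrow>
      continuous_map (prod_topology (top_of_set {0..1::real}) (subtopology X (U i))) X (c i)"
    and c0: "\<And>i x. \<lbrakk>i \<in> I; x \<in> U i\<rbrakk> \<Longrightarrow> c i (0, x) = x"
    and push: "\<And>i p. \<lbrakk>i \<in> I; pathin X p; p \<in> {0..1} \<rightarrow> U i\<rbrakk> \<Longrightarrow> (\<lambda>t. c i (1, p t)) \<in> \<G>"
    and change: "\<And>i j x. \<lbrakk>i \<in> I; j \<in> I; x \<in> U i; x \<in> U j\<rbrakk> \<Longrightarrow>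
      \<exists>q\<in>\<G>. q 0 = c i (1, x) \<and>
        path_homotopic X (\<lambda>s. c j (s, x)) (path_join (\<lambda>s. c i (s, x)) q)"
    and join: "\<And>p q. \<lbrakk>p \<in> \<G>; q \<in> \<G>; p 1 = q 0\<rbrakk> \<Longrightarrow> path_join p q \<in> \<G>"
    and \<G>: "\<And>p. p \<in> \<G> \<Longrightarrow> pathin X p"
    and p: "pathin X p" and ij: "i \<in> I" "j \<in> I" "p 0 \<in> U i" "p 1 \<in> U j"
  shows "\<exists>q\<in>\<G>. q 0 = c i (1, p 0) \<and>
    path_homotopic X (path_join p (\<lambda>s. c j (s, p 1))) (path_join (\<lambda>s. c i (s, p 0)) q)"
proof -
  \<comment> \<open>The charts at both ends are quantified, so that two adjacent intervals can be
    given the same chart at their common point. The bounds on \<open>a\<close> and \<open>b\<close>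
    are premises because the bisection principle ranges over all reals.\<close>
  define deforms where "deforms a b \<longleftrightarrow> (\<forall>i\<in>I. \<forall>j\<in>I. 0 \<le> a \<longrightarrow> b \<le> 1 \<longrightarrow> a \<le> b \<longrightarrow> p a \<in> U i \<longrightarrow> p b \<in> U j \<longrightarrow>
      (\<exists>q\<in>\<G>. q 0 = c i (1, p a) \<and>
        path_homotopic X (path_join (p \<circ> linepath a b) (\<lambda>s. c j (s, p b)))
          (path_join (\<lambda>s. c i (s, p a)) q)))" for a b
  have track: "pathin X (\<lambda>s. c i (s, x))" if "i \<in> I" "x \<in> U i" for i x
  proof -
    have "continuous_map (top_of_set {0..1}) (prod_topology (top_of_set {0..1::real}) (subtopology X
        (U i)))
        (\<lambda>s. (s, x))"
      using that openin_subset[OF U] by (auto simp: continuous_map_pairwise o_def)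
    from continuous_map_compose[OF this c[OF that(1)]] show ?thesis
      by (simp add: pathin_def o_def)
  qed
  have in_top: "p t \<in> topspace X" if "t \<in> {0..1}" for t
    using path_image_subset_topspace[OF p] that by auto
  have "deforms 0 1"
  \<comment> \<open>Bisection in place of an explicit subdivision: the property passes to unions of
    adjacent intervals and holds on all sufficiently short intervals around each point.\<close>
  proof (rule Bolzano[of 0 1 deforms])
    show "(0::real) \<le> 1" by simp
  next
    fix a b d :: real
    assume ab: "deforms a b" and bd: "deforms b d" and le: "a \<le> b" "b \<le> d"
    show "deforms a d"
      unfolding deforms_def
    proof (intro ballI impI)
      fix i j assume i: "i \<in> I" "j \<in> I" "0 \<le> a" "d \<le> 1" "a \<le> d" "p a \<in> U i" "p d \<in> U j"
      obtain k where k: "k \<in> I" "p b \<in> U k"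
        using cover in_top[of b] le i by auto
      obtain q1 where q1: "q1 \<in> \<G>" "q1 0 = c i (1, p a)"
        "path_homotopic X (path_join (p \<circ> linepath a b) (\<lambda>s. c k (s, p b)))
          (path_join (\<lambda>s. c i (s, p a)) q1)"
        using ab i k le unfolding deforms_def by force
      obtain q2 where q2: "q2 \<in> \<G>" "q2 0 = c k (1, p b)"
        "path_homotopic X (path_join (p \<circ> linepath b d) (\<lambda>s. c j (s, p d)))
          (path_join (\<lambda>s. c k (s, p b)) q2)"
        using bd i k le unfolding deforms_def by force
      have q12: "q1 1 = q2 0"
        using path_homotopic_imp_ends(2)[OF q1(3)] q2(2) by simp
      let ?i = "\<lambda>s. c i (s, p a)" and ?k = "\<lambda>s. c k (s, p b)" and ?j = "\<lambda>s. c j (s, p d)"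
      let ?ab = "p \<circ> linepath a b" and ?bd = "p \<circ> linepath b d"
      note paths = track[OF i(1,6)] track[OF i(2,7)] track[OF k] \<G>[OF q1(1)] \<G>[OF q2(1)]
        pathin_subpath[OF p, of a b] pathin_subpath[OF p, of b d]
      note ends = c0[OF i(1,6)] c0[OF i(2,7)] c0[OF k] q1(2) q2(2) q12
      \<comment> \<open>The second half trades the track \<open>?j\<close> for the track
        \<open>?k\<close> at the common point, and the first half trades \<open>?k\<close> for
        \<open>?i\<close>, leaving \<open>q1\<close> followed by \<open>q2\<close> behind.\<close>
      have "path_homotopic X (path_join (p \<circ> linepath a d) ?j) (path_join (path_join ?ab ?bd) ?j)"
        using paths ends i le
        by (intro path_homotopic_join path_homotopic_subpaths p path_homotopic_refl)
            (auto simp: linepath_0' linepath_1')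
      also have "path_homotopic X \<dots> (path_join ?ab (path_join ?bd ?j))"
        using paths ends i le by (intro path_homotopic_assoc) (auto simp: linepath_0' linepath_1')
      also have "path_homotopic X \<dots> (path_join ?ab (path_join ?k q2))"
        using paths ends i le by (intro path_homotopic_join path_homotopic_refl q2)
            (auto simp: linepath_0' linepath_1')
      also have "path_homotopic X \<dots> (path_join (path_join ?ab ?k) q2)"
        using paths ends i le by (intro path_homotopic_sym[OF path_homotopic_assoc])
            (auto simp: linepath_0' linepath_1')
      also have "path_homotopic X \<dots> (path_join (path_join ?i q1) q2)"
        using paths ends i le by (intro path_homotopic_join path_homotopic_refl q1)
            (auto simp: linepath_0' linepath_1')
      also have "path_homotopic X \<dots> (path_join ?i (path_join q1 q2))"
        using paths ends i le by (intro path_homotopic_assoc) (auto simp: linepath_0' linepath_1')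
      finally show "\<exists>q\<in>\<G>. q 0 = c i (1, p a) \<and>
          path_homotopic X (path_join (p \<circ> linepath a d) ?j) (path_join ?i q)"
        using join[OF q1(1) q2(1) q12] q1(2) by (intro bexI[of _ "path_join q1 q2"])
            (auto simp: linepath_0' linepath_1')
    qed
  next
    fix x :: real assume x: "0 \<le> x" "x \<le> 1"
    obtain k where k: "k \<in> I" "p x \<in> U k"
      using cover in_top[of x] x by auto
    have "openin (top_of_set {0..1}) {t \<in> {0..1}. p t \<in> U k}"
      using openin_continuous_map_preimage[OF p[unfolded pathin_def] U[OF k(1)]] by simp
    then obtain \<delta> where \<delta>: "\<delta> > 0" "ball x \<delta> \<inter> {0..1} \<subseteq> {t \<in> {0..1}. p t \<in> U k}"
      using x k by (auto simp: openin_contains_ball)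
    have "deforms a b" if ab: "a \<le> x \<and> x \<le> b \<and> b - a < \<delta>" for a b
      unfolding deforms_def
    proof (intro ballI impI)
      fix i j assume i: "i \<in> I" "j \<in> I" "0 \<le> a" "b \<le> 1" "a \<le> b" "p a \<in> U i" "p b \<in> U j"
      have pU: "p t \<in> U k" if "t \<in> {a..b}" for t
        using that ab i \<delta>(2) by (auto simp: dist_real_def subset_iff)
      let ?g = "p \<circ> linepath a b"
      have g: "pathin X ?g" "?g \<in> {0..1} \<rightarrow> U k"
        using pathin_subpath[OF p] linepath_mem_unit[of a b] i pU by auto
      \<comment> \<open>Moving the short path along its tracks sweeps out a square. Its sides are
        the path, the tracks of both ends and the displaced path, which \<open>push\<close> puts
        into \<open>\<G>\<close>.\<close>
      have "continuous_map (top_of_set ({0..1} \<times> {0..1}))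
          (prod_topology (top_of_set {0..1::real}) (subtopology X (U k))) (\<lambda>z. (fst z, ?g (snd z)))"
        using g unfolding pathin_def
        by (auto simp: continuous_map_pairwise o_def continuous_map_in_subtopology
            intro!: continuous_intros continuous_map_compose[of _ _ snd X ?g, unfolded o_def])
      from continuous_map_compose[OF this c[OF k(1)]]
      have sq: "path_homotopic X (path_join (\<lambda>t. c k (0, ?g t)) (\<lambda>s. c k (s, p b)))
          (path_join (\<lambda>s. c k (s, p a)) (\<lambda>t. c k (1, ?g t)))"
        using path_homotopic_square[of X "c k \<circ> (\<lambda>z. (fst z, ?g (snd z)))"]
        by (simp add: o_def linepath_0' linepath_1')
      \<comment> \<open>The short path lies in the chart \<open>k\<close>, but the charts
        \<open>i\<close> and \<open>j\<close> at its ends are prescribed; \<open>change\<close>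
        supplies the correction at either end.\<close>
      obtain q1 where q1: "q1 \<in> \<G>" "q1 0 = c k (1, p b)"
        "path_homotopic X (\<lambda>s. c j (s, p b)) (path_join (\<lambda>s. c k (s, p b)) q1)"
        using change[OF k(1) i(2) _ i(7)] pU i by auto
      obtain q2 where q2: "q2 \<in> \<G>" "q2 0 = c i (1, p a)"
        "path_homotopic X (\<lambda>s. c k (s, p a)) (path_join (\<lambda>s. c i (s, p a)) q2)"
        using change[OF i(1) k(1) i(6)] pU i by auto
      let ?i = "\<lambda>s. c i (s, p a)" and ?j = "\<lambda>s. c j (s, p b)"
      let ?a = "\<lambda>s. c k (s, p a)" and ?b = "\<lambda>s. c k (s, p b)" and ?d = "\<lambda>t. c k (1, ?g t)"
      have ab: "p a \<in> U k" "p b \<in> U k"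
        using pU i by auto
      have d: "?d \<in> \<G>"
        using push[OF k(1) g] by simp
      have q2d: "q2 1 = ?d 0"
        using path_homotopic_imp_ends(2)[OF q2(3)] by (simp add: linepath_0')
      note paths = track[OF i(1,6)] track[OF i(2,7)] track[OF k(1) ab(1)] track[OF k(1) ab(2)] \<G>[OF
          q1(1)] \<G>[OF q2(1)]
        \<G>[OF d] g(1)
      note ends = c0[OF i(1,6)] c0[OF i(2,7)] c0[OF k(1) ab(1)] c0[OF k(1) ab(2)] q1(2) q2(2) q2d
      have "path_homotopic X (path_join ?g ?j) (path_join ?g (path_join ?b q1))"
        using paths ends i by (intro path_homotopic_join path_homotopic_refl q1)
            (auto simp: linepath_0' linepath_1')
      also have "path_homotopic X \<dots> (path_join (path_join ?g ?b) q1)"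
        using paths ends i by (intro path_homotopic_sym[OF path_homotopic_assoc])
            (auto simp: linepath_0' linepath_1')
      also have "path_homotopic X \<dots> (path_join (path_join (\<lambda>t. c k (0, ?g t)) ?b) q1)"
        using paths ends i g(2) c0[OF k(1)]
        by (intro path_homotopic_join path_homotopic_refl path_homotopic_eqI[of _ ?g])
            (auto simp: Pi_iff linepath_0' linepath_1')
      also have "path_homotopic X \<dots> (path_join (path_join ?a ?d) q1)"
        using paths ends i by (intro path_homotopic_join path_homotopic_refl sq)
            (auto simp: linepath_0' linepath_1')
      also have "path_homotopic X \<dots> (path_join (path_join (path_join ?i q2) ?d) q1)"
        using paths ends i by (intro path_homotopic_join path_homotopic_refl q2)
            (auto simp: linepath_0' linepath_1')
      also have "path_homotopic X \<dots> (path_join (path_join ?i (path_join q2 ?d)) q1)"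
        using paths ends i by (intro path_homotopic_join path_homotopic_refl path_homotopic_assoc)
            (auto simp: linepath_0' linepath_1')
      also have "path_homotopic X \<dots> (path_join ?i (path_join (path_join q2 ?d) q1))"
        using paths ends i by (intro path_homotopic_assoc pathin_path_join)
            (auto simp: linepath_0' linepath_1')
      finally have "path_homotopic X (path_join ?g ?j) (path_join ?i (path_join (path_join q2 ?d)
          q1))" .
      moreover have "path_join (path_join q2 ?d) q1 \<in> \<G>"
        using ends by (intro join q1 q2 d) (auto simp: linepath_0' linepath_1')
      ultimately show "\<exists>q\<in>\<G>. q 0 = c i (1, p a) \<and>
          path_homotopic X (path_join ?g (\<lambda>s. c j (s, p b))) (path_join (\<lambda>s. c i (s, p a)) q)"
        using q2(2) by (intro bexI[of _ "path_join (path_join q2 ?d) q1"])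
            (auto simp: linepath_0' linepath_1')
    qed
    with \<delta>(1) show "\<exists>d>0. \<forall>a b. a \<le> x \<and> x \<le> b \<and> b - a < d \<longrightarrow> deforms a b"
      by blast
  qed
  then have *: "\<exists>q\<in>\<G>. q 0 = c i (1, p 0) \<and>
        path_homotopic X (path_join (p \<circ> linepath 0 1) (\<lambda>s. c j (s, p 1)))
          (path_join (\<lambda>s. c i (s, p 0)) q)"
    unfolding deforms_def using ij by simp
  have "p \<circ> linepath 0 1 = p"
    by (simp add: linepath_def fun_eq_iff)
  with * show ?thesis by simp
qed

section \<open>Integrating locally constant transition functions along paths\<close>

text \<open>
  The functions \<open>\<phi> i\<close> are local trivialisations of a principal bundle with discrete structure
  group \<open>K\<close>, and lifts are the continuous sections over a map into the base.
\<close>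

locale additive_atlas = abelian_group K for K (structure) +
  fixes X :: "'p topology" and I :: "'i set" and U :: "'i \<Rightarrow> 'p set" and \<phi> :: "'i \<Rightarrow> 'p \<Rightarrow> 'a"
  assumes open_U: "i \<in> I \<Longrightarrow> openin X (U i)"
    and cover_U: "topspace X \<subseteq> (\<Union>i\<in>I. U i)"
    and \<phi>_closed [simp]: "\<lbrakk>i \<in> I; x \<in> U i\<rbrakk> \<Longrightarrow> \<phi> i x \<in> carrier K"
    and \<phi>_diff: "\<lbrakk>i \<in> I; j \<in> I; x \<in> U i; x \<in> U j\<rbrakk> \<Longrightarrow>
      \<exists>N. openin X N \<and> x \<in> N \<and> (\<forall>y\<in>N \<inter> U i \<inter> U j. \<phi> i y \<ominus> \<phi> j y = \<phi> i x \<ominus> \<phi> j x)"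
begin

text \<open>In the trivialisation over \<open>U i\<close> the section has the coordinate
  \<open>F z \<oplus> \<phi> i (H z)\<close>; continuity into the discrete fibre means that this
  coordinate is locally constant.\<close>

definition lift :: "'y::topological_space set \<Rightarrow> ('y \<Rightarrow> 'p) \<Rightarrow> ('y \<Rightarrow> 'a) \<Rightarrow> bool" where
  "lift Y H F \<longleftrightarrow> (\<forall>y\<in>Y. F y \<in> carrier K) \<and>
     (\<forall>i\<in>I. \<forall>y\<in>Y. H y \<in> U i \<longrightarrow>
        (\<exists>N. openin (top_of_set Y) N \<and> y \<in> N \<and>
          (\<forall>z\<in>N. H z \<in> U i \<longrightarrow> F z \<oplus> \<phi> i (H z) = F y \<oplus> \<phi> i (H y))))"

lemma minus_cancel_iff:
  assumes "a \<in> carrier K" "b \<in> carrier K" "c \<in> carrier K" "d \<in> carrier K"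
  shows "a \<oplus> b = c \<oplus> d \<longleftrightarrow> a \<ominus> c = d \<ominus> b"
proof -
  have "a \<ominus> c = d \<ominus> b \<longleftrightarrow> a \<ominus> c \<oplus> (c \<oplus> b) = d \<ominus> b \<oplus> (c \<oplus> b)"
    using assms by simp
  also have "a \<ominus> c \<oplus> (c \<oplus> b) = a \<oplus> b"
    using assms by (simp add: a_minus_def a_assoc r_neg1)
  also have "d \<ominus> b \<oplus> (c \<oplus> b) = d \<oplus> c"
    using assms by (simp add: a_minus_def a_assoc a_comm[of c b] r_neg1)
  also have "\<dots> = c \<oplus> d"
    using assms by (simp add: a_comm)
  finally show ?thesis by simp
qed

lemma minus_add_minus:
  assumes "a \<in> carrier K" "b \<in> carrier K" "c \<in> carrier K"
  shows "(a \<ominus> b) \<oplus> (b \<ominus> c) = a \<ominus> c"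
  using assms by (simp add: a_minus_def a_assoc r_neg1)

lemma minus_eq_iff_swap:
  assumes "a \<in> carrier K" "b \<in> carrier K" "c \<in> carrier K" "d \<in> carrier K"
  shows "a \<ominus> b = c \<ominus> d \<longleftrightarrow> a \<ominus> c = b \<ominus> d"
  using minus_cancel_iff[of a d c b] minus_cancel_iff[of a d b c] assms
  by (simp add: a_comm[of b c])

text \<open>One chart at each point is enough: near that point any other chart differs from it by a
  constant, by \<open>\<phi>_diff\<close> pulled back along the continuous map
  \<open>H\<close>.\<close>

lemma liftI:
  assumes H: "continuous_map (top_of_set Y) X H"
    and F: "\<And>y. y \<in> Y \<Longrightarrow> F y \<in> carrier K"
    and loc: "\<And>y. y \<in> Y \<Longrightarrow> \<exists>i\<in>I. H y \<in> U i \<and>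
        (\<exists>N. openin (top_of_set Y) N \<and> y \<in> N \<and>
          (\<forall>z\<in>N. H z \<in> U i \<longrightarrow> F z \<oplus> \<phi> i (H z) = F y \<oplus> \<phi> i (H y)))"
  shows "lift Y H F"
  unfolding lift_def
proof (intro conjI ballI impI F)
  fix j y assume j: "j \<in> I" "y \<in> Y" "H y \<in> U j"
  obtain i N where i: "i \<in> I" "H y \<in> U i" and N: "openin (top_of_set Y) N" "y \<in> N"
    "\<And>z. z \<in> N \<Longrightarrow> H z \<in> U i \<Longrightarrow> F z \<oplus> \<phi> i (H z) = F y \<oplus> \<phi> i (H y)"
    using loc[OF j(2)] by blast
  obtain M where M: "openin X M" "H y \<in> M"
    "\<And>x. x \<in> M \<Longrightarrow> x \<in> U i \<Longrightarrow> x \<in> U j \<Longrightarrow> \<phi> i x \<ominus> \<phi> j x = \<phi> i (H y) \<ominus> \<phi> j (H y)"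
    using \<phi>_diff[OF i(1) j(1) i(2) j(3)] by blast
  define N' where "N' = N \<inter> {z \<in> Y. H z \<in> M \<inter> U i}"
  have "openin (top_of_set Y) {z \<in> Y. H z \<in> M \<inter> U i}"
    using openin_continuous_map_preimage[OF H openin_Int[OF M(1) open_U[OF i(1)]]] by simp
  then have "openin (top_of_set Y) N'"
    unfolding N'_def by (rule openin_Int[OF N(1)])
  moreover have "y \<in> N'"
    using N M i j by (simp add: N'_def)
  moreover have "F z \<oplus> \<phi> j (H z) = F y \<oplus> \<phi> j (H y)" if "z \<in> N'" "H z \<in> U j" for z
  proof -
    have z: "z \<in> N" "z \<in> Y" "H z \<in> M" "H z \<in> U i"
      using that by (auto simp: N'_def)
    have "F z \<ominus> F y = \<phi> i (H y) \<ominus> \<phi> i (H z)"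
      using N(3)[OF z(1,4)] z i j F by (subst minus_cancel_iff[symmetric]) auto
    also have "\<dots> = \<phi> j (H y) \<ominus> \<phi> j (H z)"
      using M(3)[OF z(3,4) that(2)] z i j that minus_eq_iff_swap[of "\<phi> i (H y)" "\<phi> i (H z)"
          "\<phi> j (H y)" "\<phi> j (H z)"]
      by simp
    finally show ?thesis
      using z i j that F by (subst minus_cancel_iff) auto
  qed
  ultimately show "\<exists>N. openin (top_of_set Y) N \<and> y \<in> N \<and>
      (\<forall>z\<in>N. H z \<in> U j \<longrightarrow> F z \<oplus> \<phi> j (H z) = F y \<oplus> \<phi> j (H y))"
    by blast
qed

lemma lift_closed: "lift Y H F \<Longrightarrow> y \<in> Y \<Longrightarrow> F y \<in> carrier K"
  by (simp add: lift_def)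

lemma liftE:
  assumes "lift Y H F" "i \<in> I" "y \<in> Y" "H y \<in> U i"
  obtains N where "openin (top_of_set Y) N" "y \<in> N"
    "\<And>z. z \<in> N \<Longrightarrow> H z \<in> U i \<Longrightarrow> F z \<oplus> \<phi> i (H z) = F y \<oplus> \<phi> i (H y)"
  using assms unfolding lift_def by metis

text \<open>This is the section whose coordinate in the chart \<open>i\<close> is constantly
  zero.\<close>

lemma lift_local:
  assumes "continuous_map (top_of_set Y) X H" "i \<in> I" "H \<in> Y \<rightarrow> U i"
  shows "lift Y H (\<lambda>y. \<ominus> \<phi> i (H y))"
proof (rule liftI[OF assms(1)])
  fix y assume "y \<in> Y"
  have HU: "H z \<in> U i" if "z \<in> Y" for z
    using assms(3) that by blast
  then show "\<ominus> \<phi> i (H y) \<in> carrier K"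
    using assms(2) \<open>y \<in> Y\<close> by simp
  show "\<exists>i'\<in>I. H y \<in> U i' \<and> (\<exists>N. openin (top_of_set Y) N \<and> y \<in> N \<and>
      (\<forall>z\<in>N. H z \<in> U i' \<longrightarrow> \<ominus> \<phi> i (H z) \<oplus> \<phi> i' (H z) = \<ominus> \<phi> i (H y) \<oplus> \<phi> i' (H y)))"
    by (intro bexI[of _ i] conjI exI[of _ Y] ballI impI) (simp_all add: HU \<open>y \<in> Y\<close> assms(2) l_neg)
qed

lemma lift_translate:
  assumes "lift Y H F" "c \<in> carrier K"
  shows "lift Y H (\<lambda>y. F y \<oplus> c)"
  unfolding lift_def
proof (intro conjI ballI impI)
  fix i y assume i: "i \<in> I" "y \<in> Y" "H y \<in> U i"
  then obtain N where N: "openin (top_of_set Y) N" "y \<in> N"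
    "\<And>z. z \<in> N \<Longrightarrow> H z \<in> U i \<Longrightarrow> F z \<oplus> \<phi> i (H z) = F y \<oplus> \<phi> i (H y)"
    using liftE[OF assms(1)] by metis
  have "F z \<oplus> c \<oplus> \<phi> i (H z) = F y \<oplus> c \<oplus> \<phi> i (H y)" if "z \<in> N" "H z \<in> U i" for z
  proof -
    have "z \<in> Y"
      using that openin_subset[OF N(1)] by auto
    then have "F z \<oplus> c \<oplus> \<phi> i (H z) = F z \<oplus> \<phi> i (H z) \<oplus> c" "F y \<oplus> c \<oplus> \<phi> i (H y) = F y \<oplus> \<phi> i (H y) \<oplus> c"
      using that i assms by (simp_all add: lift_def a_ac)
    with N(3)[OF that] show ?thesis by simp
  qed
  with N show "\<exists>N. openin (top_of_set Y) N \<and> y \<in> N \<and>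
      (\<forall>z\<in>N. H z \<in> U i \<longrightarrow> F z \<oplus> c \<oplus> \<phi> i (H z) = F y \<oplus> c \<oplus> \<phi> i (H y))"
    by blast
next
  fix y assume "y \<in> Y"
  then show "F y \<oplus> c \<in> carrier K"
    using lift_closed[OF assms(1)] assms(2) by simp
qed

lemma lift_compose:
  assumes F: "lift Y H F" and g: "continuous_on Z g" "g \<in> Z \<rightarrow> Y"
  shows "lift Z (H \<circ> g) (F \<circ> g)"
  unfolding lift_def
proof (intro conjI ballI impI)
  fix i y assume i: "i \<in> I" "y \<in> Z" "(H \<circ> g) y \<in> U i"
  then obtain N where N: "openin (top_of_set Y) N" "g y \<in> N"
    "\<And>z. z \<in> N \<Longrightarrow> H z \<in> U i \<Longrightarrow> F z \<oplus> \<phi> i (H z) = F (g y) \<oplus> \<phi> i (H (g y))"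
    using liftE[OF F i(1), of "g y"] g(2) by auto
  have "continuous_map (top_of_set Z) (top_of_set Y) g"
    using g by simp
  from openin_continuous_map_preimage[OF this N(1)]
  have "openin (top_of_set Z) {z \<in> Z. g z \<in> N}"
    by simp
  moreover have "(F \<circ> g) z \<oplus> \<phi> i ((H \<circ> g) z) = (F \<circ> g) y \<oplus> \<phi> i ((H \<circ> g) y)"
    if "z \<in> {z \<in> Z. g z \<in> N}" "(H \<circ> g) z \<in> U i" for z
    using N(3)[of "g z"] that by simp
  ultimately show "\<exists>N. openin (top_of_set Z) N \<and> y \<in> N \<and>
      (\<forall>z\<in>N. (H \<circ> g) z \<in> U i \<longrightarrow> (F \<circ> g) z \<oplus> \<phi> i ((H \<circ> g) z) = (F \<circ> g) y \<oplus> \<phi> i ((H \<circ> g) y))"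
    using N(2) i(2) by (intro exI[of _ "{z \<in> Z. g z \<in> N}"]) blast
next
  fix y assume "y \<in> Z"
  then show "(F \<circ> g) y \<in> carrier K"
    using lift_closed[OF F, of "g y"] g(2) by auto
qed

lemma lift_cong:
  assumes "lift Y H F" "\<And>y. y \<in> Y \<Longrightarrow> H' y = H y" "\<And>y. y \<in> Y \<Longrightarrow> F' y = F y"
  shows "lift Y H' F'"
  unfolding lift_def
proof (intro conjI ballI impI)
  fix i y assume i: "i \<in> I" "y \<in> Y" "H' y \<in> U i"
  then obtain N where N: "openin (top_of_set Y) N" "y \<in> N"
    "\<And>z. z \<in> N \<Longrightarrow> H z \<in> U i \<Longrightarrow> F z \<oplus> \<phi> i (H z) = F y \<oplus> \<phi> i (H y)"
    using liftE[OF assms(1) i(1,2)] assms(2) by metis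
  have "F' z \<oplus> \<phi> i (H' z) = F' y \<oplus> \<phi> i (H' y)" if "z \<in> N" "H' z \<in> U i" for z
  proof -
    have "z \<in> Y"
      using openin_subset[OF N(1)] that by auto
    then show ?thesis
      using N(3)[of z] that i assms(2,3) by simp
  qed
  with N(1,2) show "\<exists>N. openin (top_of_set Y) N \<and> y \<in> N \<and>
      (\<forall>z\<in>N. H' z \<in> U i \<longrightarrow> F' z \<oplus> \<phi> i (H' z) = F' y \<oplus> \<phi> i (H' y))"
    by blast
next
  fix y assume "y \<in> Y"
  then show "F' y \<in> carrier K"
    using lift_closed[OF assms(1)] assms(3) by simp
qed

text \<open>Near a point both lifts change by the same amount, namely the change of a chart value
  with opposite sign. So their difference is locally constant, hence constant on a connected
  set.\<close>

lemma lift_unique: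
  assumes H: "continuous_map (top_of_set Y) X H" and "connected Y"
    and F: "lift Y H F" and G: "lift Y H G" and "y \<in> Y" "z \<in> Y"
  shows "F y \<ominus> G y = F z \<ominus> G z"
proof -
  have "(\<lambda>y. F y \<ominus> G y) constant_on Y"
  proof (rule locally_constant_imp_constant[OF \<open>connected Y\<close>])
    fix y assume y: "y \<in> Y"
    then obtain i where i: "i \<in> I" "H y \<in> U i"
      using cover_U continuous_map_funspace[OF H] by fastforce
    obtain N where N: "openin (top_of_set Y) N" "y \<in> N"
      "\<And>z. z \<in> N \<Longrightarrow> H z \<in> U i \<Longrightarrow> F z \<oplus> \<phi> i (H z) = F y \<oplus> \<phi> i (H y)"
      using liftE[OF F i(1) y i(2)] by metis
    obtain M where M: "openin (top_of_set Y) M" "y \<in> M"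
      "\<And>z. z \<in> M \<Longrightarrow> H z \<in> U i \<Longrightarrow> G z \<oplus> \<phi> i (H z) = G y \<oplus> \<phi> i (H y)"
      using liftE[OF G i(1) y i(2)] by metis
    define T where "T = N \<inter> M \<inter> {z \<in> Y. H z \<in> U i}"
    have "F z \<ominus> G z = F y \<ominus> G y" if "z \<in> T" for z
    proof -
      have z: "z \<in> N" "z \<in> M" "z \<in> Y" "H z \<in> U i"
        using that by (auto simp: T_def)
      have c: "F z \<in> carrier K" "F y \<in> carrier K" "G z \<in> carrier K" "G y \<in> carrier K"
          "\<phi> i (H z) \<in> carrier K" "\<phi> i (H y) \<in> carrier K"
        using F G i y z lift_closed by auto
      have "F z \<ominus> F y = G z \<ominus> G y"
        using N(3)[OF z(1,4)] M(3)[OF z(2,4)] c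
          minus_cancel_iff[of "F z" "\<phi> i (H z)" "F y" "\<phi> i (H y)"]
          minus_cancel_iff[of "G z" "\<phi> i (H z)" "G y" "\<phi> i (H y)"] by simp
      then show ?thesis
        using c minus_eq_iff_swap by simp
    qed
    moreover have "openin (top_of_set Y) T"
      unfolding T_def using openin_continuous_map_preimage[OF H open_U[OF i(1)]]
      by (intro openin_Int N(1) M(1)) simp
    moreover have "y \<in> T"
      using N M i y by (simp add: T_def)
    ultimately show "\<exists>T. openin (top_of_set Y) T \<and> y \<in> T \<and> (\<forall>x\<in>T. F x \<ominus> G x = F y \<ominus> G y)"
      by blast
  qed
  with assms(5,6) show ?thesis
    unfolding constant_on_def by metis
qed

text \<open>On the connected overlap the two lifts differ by a constant, and translating one of them
  by that constant makes them agree there.\<close>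

lemma lift_glue:
  assumes H: "continuous_map (top_of_set (Y1 \<union> Y2)) X H"
    and closed: "closed Y1" "closed Y2" and conn: "connected (Y1 \<inter> Y2)" "Y1 \<inter> Y2 \<noteq> {}"
    and F1: "lift Y1 H F1" and F2: "lift Y2 H F2"
  shows "\<exists>F. lift (Y1 \<union> Y2) H F"
proof -
  obtain y0 where y0: "y0 \<in> Y1" "y0 \<in> Y2"
    using conn by blast
  define c where "c = F1 y0 \<ominus> F2 y0"
  have c: "c \<in> carrier K"
    using y0 F1 F2 by (auto simp: c_def lift_def)
  define G where "G = (\<lambda>y. F2 y \<oplus> c)"
  have G: "lift Y2 H G"
    unfolding G_def by (rule lift_translate[OF F2 c])
  define F where "F = (\<lambda>y. if y \<in> Y1 then F1 y else G y)"
  have HY: "continuous_map (top_of_set Y) X H" if "Y \<subseteq> Y1 \<union> Y2" for Y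
    using H that by (rule continuous_map_from_subtopology_mono)
  have "F1 y = G y" if y: "y \<in> Y1" "y \<in> Y2" for y
  proof -
    have "lift (Y1 \<inter> Y2) (H \<circ> id) (F1 \<circ> id)" "lift (Y1 \<inter> Y2) (H \<circ> id) (F2 \<circ> id)"
      by (rule lift_compose[OF F1] lift_compose[OF F2]; auto)+
    then have "F1 y \<ominus> F2 y = c"
      unfolding c_def using y y0 by (intro lift_unique[OF HY conn(1)]) auto
    moreover have "F1 y \<in> carrier K" "F2 y \<in> carrier K"
      using y F1 F2 by (auto simp: lift_def)
    ultimately show ?thesis
      using c by (auto simp: G_def a_minus_def a_comm[of "F1 y"] r_neg1 r_neg2)
  qed
  then have FG': "F y = G y" if "y \<in> Y2" for y
    using that by (auto simp: F_def)
  have FG: "F y = F1 y" if "y \<in> Y1" for y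
    using that by (simp add: F_def)
  have "lift (Y1 \<union> Y2) H F"
    unfolding lift_def
  proof (intro conjI ballI impI)
    show "F y \<in> carrier K" if "y \<in> Y1 \<union> Y2" for y
      using that FG FG' F1 G by (auto simp: lift_def)
    fix i y assume i: "i \<in> I" "y \<in> Y1 \<union> Y2" "H y \<in> U i"
    \<comment> \<open>Each piece is treated separately: at a point outside a closed piece, the
      complement is a neighbourhood on which this piece imposes nothing. Intersecting the two
      neighbourhoods handles the union.\<close>
    have "\<exists>N. open N \<and> y \<in> N \<and> (\<forall>z\<in>N \<inter> Y. H z \<in> U i \<longrightarrow> F z \<oplus> \<phi> i (H z) = F y \<oplus> \<phi> i (H y))"
      if L: "lift Y H F'" and Y: "closed Y" and FF': "\<And>z. z \<in> Y \<Longrightarrow> F z = F' z" for Y F'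
    proof (cases "y \<in> Y")
      case False
      with Y show ?thesis
        by (intro exI[of _ "- Y"]) auto
    next
      case True
      then obtain N where N: "openin (top_of_set Y) N" "y \<in> N"
        "\<And>z. z \<in> N \<Longrightarrow> H z \<in> U i \<Longrightarrow> F' z \<oplus> \<phi> i (H z) = F' y \<oplus> \<phi> i (H y)"
        using liftE[OF L i(1) True i(3)] by metis
      obtain T where "open T" "N = Y \<inter> T"
        using N(1) openin_open by blast
      with N True FF' show ?thesis
        by (intro exI[of _ T]) auto
    qed
    from this[OF F1 closed(1) FG] this[OF G closed(2) FG']
    obtain N1 N2 where N: "open N1" "y \<in> N1" "open N2" "y \<in> N2"
      "\<And>z. z \<in> N1 \<inter> Y1 \<Longrightarrow> H z \<in> U i \<Longrightarrow> F z \<oplus> \<phi> i (H z) = F y \<oplus> \<phi> i (H y)"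
      "\<And>z. z \<in> N2 \<inter> Y2 \<Longrightarrow> H z \<in> U i \<Longrightarrow> F z \<oplus> \<phi> i (H z) = F y \<oplus> \<phi> i (H y)"
      by auto
    then show "\<exists>N. openin (top_of_set (Y1 \<union> Y2)) N \<and> y \<in> N \<and>
        (\<forall>z\<in>N. H z \<in> U i \<longrightarrow> F z \<oplus> \<phi> i (H z) = F y \<oplus> \<phi> i (H y))"
      using i by (intro exI[of _ "(Y1 \<union> Y2) \<inter> (N1 \<inter> N2)"] conjI openin_open_Int) auto
  qed
  then show ?thesis by blast
qed

text \<open>Bisection in the second coordinate over a thin strip around \<open>s\<close>. The width
  is part of the property because it shrinks to the smaller of two widths whenever two boxes are
  glued; the overlap is then a single segment, hence connected.\<close>

lemma lift_strip:
  assumes H: "continuous_map (top_of_set ({0..1::real} \<times> {0..1::real})) X H" and s: "s \<in> {0..1}"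
  shows "\<exists>d>0. \<exists>F. lift (({s - d..s + d} \<inter> {0..1}) \<times> {0..1}) H F"
proof -
  define liftable where "liftable a b \<longleftrightarrow> (0 \<le> a \<longrightarrow> b \<le> 1 \<longrightarrow> a \<le> b \<longrightarrow>
     (\<exists>d>0. \<exists>F. lift (({s - d..s + d} \<inter> {0..1}) \<times> {a..b}) H F))" for a b
  have "liftable 0 1"
  proof (rule Bolzano[of 0 1 liftable])
    fix a b c :: real assume ab: "liftable a b" and bc: "liftable b c" and le: "a \<le> b" "b \<le> c"
    show "liftable a c"
      unfolding liftable_def
    proof (intro impI)
      assume ac: "0 \<le> a" "c \<le> 1" "a \<le> c"
      obtain d1 F1 where 1: "d1 > 0" "lift (({s - d1..s + d1} \<inter> {0..1}) \<times> {a..b}) H F1"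
        using ab ac le by (auto simp: liftable_def)
      obtain d2 F2 where 2: "d2 > 0" "lift (({s - d2..s + d2} \<inter> {0..1}) \<times> {b..c}) H F2"
        using bc ac le by (auto simp: liftable_def)
      define S where "S = {s - min d1 d2..s + min d1 d2} \<inter> {0..1}"
      have S: "S = {max (s - min d1 d2) 0..min (s + min d1 d2) 1}"
        by (auto simp: S_def)
      have sub: "S \<subseteq> {s - d1..s + d1} \<inter> {0..1}" "S \<subseteq> {s - d2..s + d2} \<inter> {0..1}" "s \<in> S"
        using s 1(1) 2(1) by (auto simp: S_def)
      have "lift (S \<times> {a..b}) (H \<circ> id) (F1 \<circ> id)" "lift (S \<times> {b..c}) (H \<circ> id) (F2 \<circ> id)"
        by (rule lift_compose[OF 1(2)] lift_compose[OF 2(2)]; use sub in auto)+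
      then have "\<exists>F. lift (S \<times> {a..b} \<union> S \<times> {b..c}) H F"
      proof (intro lift_glue)
        show "continuous_map (top_of_set (S \<times> {a..b} \<union> S \<times> {b..c})) X H"
          using sub ac le by (intro continuous_map_from_subtopology_mono[OF H]) auto
        have "S \<times> {a..b} \<inter> S \<times> {b..c} = S \<times> {b..b}"
          using le by auto
        then show "connected (S \<times> {a..b} \<inter> S \<times> {b..c})"
          unfolding S by (simp add: connected_Times)
        have "(s, b) \<in> S \<times> {a..b} \<inter> S \<times> {b..c}"
          using sub(3) le by simp
        then show "S \<times> {a..b} \<inter> S \<times> {b..c} \<noteq> {}"
          by blast
      qed (auto simp: S intro!: closed_Times)
      moreover have "S \<times> {a..b} \<union> S \<times> {b..c} = S \<times> {a..c}"
        using le by auto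
      ultimately show "\<exists>d>0. \<exists>F. lift (({s - d..s + d} \<inter> {0..1}) \<times> {a..c}) H F"
        using 1(1) 2(1) unfolding S_def by (intro exI[of _ "min d1 d2"]) auto
    qed
  next
    fix x :: real assume x: "0 \<le> x" "x \<le> 1"
    have sx: "(s, x) \<in> {0..1} \<times> {0..1}"
      using s x by auto
    then obtain i where i: "i \<in> I" "H (s, x) \<in> U i"
      using continuous_map_funspace[OF H] cover_U by fastforce
    have "openin (top_of_set ({0..1} \<times> {0..1})) {z \<in> {0..1} \<times> {0..1}. H z \<in> U i}"
      using openin_continuous_map_preimage[OF H open_U[OF i(1)]] by simp
    then obtain T where T: "open T" "{z \<in> {0..1} \<times> {0..1}. H z \<in> U i} = ({0..1} \<times> {0..1}) \<inter> T"
      unfolding openin_open by blast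
    then have "(s, x) \<in> T"
      using sx i by blast
    then obtain A B where AB: "open A" "open B" "s \<in> A" "x \<in> B" "A \<times> B \<subseteq> T"
      using open_prod_elim[OF T(1)] by (metis mem_Sigma_iff)
    obtain d where d: "d > 0" "cball s d \<subseteq> A"
      using AB open_contains_cball by blast
    obtain d' where d': "d' > 0" "ball x d' \<subseteq> B"
      using AB open_contains_ball by blast
    have "liftable a b" if ab: "a \<le> x \<and> x \<le> b \<and> b - a < d'" for a b
      unfolding liftable_def
    proof (intro impI exI conjI)
      assume "0 \<le> a" "b \<le> 1" "a \<le> b"
      let ?Y = "({s - d..s + d} \<inter> {0..1}) \<times> {a..b}"
      have "?Y \<subseteq> {0..1} \<times> {0..1}"
        using \<open>0 \<le> a\<close> \<open>b \<le> 1\<close> by auto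
      moreover have "?Y \<subseteq> T"
      proof -
        have "{s - d..s + d} \<subseteq> cball s d" "{a..b} \<subseteq> ball x d'"
          using ab by (auto simp: dist_real_def)
        with AB d d' show ?thesis by blast
      qed
      ultimately have "H \<in> ?Y \<rightarrow> U i" "continuous_map (top_of_set ?Y) X H"
        using T(2) continuous_map_from_subtopology_mono[OF H, of ?Y] by auto
      then show "lift ?Y H (\<lambda>y. \<ominus> \<phi> i (H y))"
        by (intro lift_local i)
    qed (rule d)
    with d' show "\<exists>d>0. \<forall>a b. a \<le> x \<and> x \<le> b \<and> b - a < d \<longrightarrow> liftable a b"
      by blast
  qed simp
  then show ?thesis
    by (simp add: liftable_def)
qed

text \<open>A second bisection, now in the first coordinate, with the strips of full height from
  \<open>lift_strip\<close> as the short intervals. Adjacent strips meet in one vertical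
  segment.\<close>

lemma lift_square:
  assumes H: "continuous_map (top_of_set ({0..1::real} \<times> {0..1::real})) X H"
  shows "\<exists>F. lift ({0..1} \<times> {0..1}) H F"
proof -
  define liftable where "liftable a b \<longleftrightarrow> (0 \<le> a \<longrightarrow> b \<le> 1 \<longrightarrow> a \<le> b \<longrightarrow>
     (\<exists>F. lift ({a..b} \<times> {0..1}) H F))" for a b
  have "liftable 0 1"
  proof (rule Bolzano[of 0 1 liftable])
    fix a b c :: real assume ab: "liftable a b" and bc: "liftable b c" and le: "a \<le> b" "b \<le> c"
    show "liftable a c"
      unfolding liftable_def
    proof (intro impI)
      assume ac: "0 \<le> a" "c \<le> 1" "a \<le> c"
      obtain F1 F2 where F: "lift ({a..b} \<times> {0..1}) H F1" "lift ({b..c} \<times> {0..1}) H F2"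
        using ab bc ac le by (auto simp: liftable_def)
      have int: "{a..b} \<times> {0..1} \<inter> {b..c} \<times> {0..1} = {b..b} \<times> {0..1::real}"
        using le by auto
      have un: "{a..b} \<times> {0..1} \<union> {b..c} \<times> {0..1} = {a..c} \<times> {0..1::real}"
        using le by auto
      show "\<exists>F. lift ({a..c} \<times> {0..1}) H F"
        unfolding un[symmetric]
      proof (rule lift_glue[OF _ _ _ _ _ F])
        show "continuous_map (top_of_set ({a..b} \<times> {0..1} \<union> {b..c} \<times> {0..1})) X H"
          unfolding un using ac by (intro continuous_map_from_subtopology_mono[OF H]) auto
      qed (auto simp: int connected_Times intro!: closed_Times)
    qed
  next
    fix x :: real assume x: "0 \<le> x" "x \<le> 1"
    then obtain d F where d: "d > 0" "lift (({x - d..x + d} \<inter> {0..1}) \<times> {0..1}) H F"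
      using lift_strip[OF H, of x] by auto
    have "liftable a b" if ab: "a \<le> x \<and> x \<le> b \<and> b - a < d" for a b
      unfolding liftable_def
    proof (intro impI exI)
      assume "0 \<le> a" "b \<le> 1" "a \<le> b"
      then have "lift ({a..b} \<times> {0..1}) (H \<circ> id) (F \<circ> id)"
        using ab by (intro lift_compose[OF d(2)]) auto
      then show "lift ({a..b} \<times> {0..1}) H F"
        by simp
    qed
    with d show "\<exists>d>0. \<forall>a b. a \<le> x \<and> x \<le> b \<and> b - a < d \<longrightarrow> liftable a b"
      by blast
  qed simp
  then show ?thesis
    by (simp add: liftable_def)
qed

section \<open>Increments of lifts along paths and their invariance\<close>

lemma lift_path:
  assumes "pathin X p"
  shows "\<exists>F. lift {0..1} p F"
proof -
  \<comment> \<open>A path is a square that is constant in the first coordinate, so no separate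
    lifting argument is needed.\<close>
  have "continuous_map (top_of_set ({0..1::real} \<times> {0..1})) X (p \<circ> snd)"
    using assms unfolding pathin_def
    by (rule continuous_map_compose[rotated]) (auto intro!: continuous_intros)
  then obtain F where F: "lift ({0..1::real} \<times> {0..1}) (p \<circ> snd) F"
    using lift_square by blast
  have "lift {0..1} ((p \<circ> snd) \<circ> (\<lambda>t. (0::real, t))) (F \<circ> (\<lambda>t. (0, t)))"
    by (rule lift_compose[OF F]) (auto intro!: continuous_intros)
  then have "lift {0..1} p (F \<circ> (\<lambda>t. (0, t)))"
    by (simp add: o_def)
  then show ?thesis
    by blast
qed

text \<open>The holonomy of the covering along \<open>p\<close>. The choice of lift does not matter,
  since two lifts over the interval differ by a constant.\<close>

definition path_integral :: "(real \<Rightarrow> 'p) \<Rightarrow> 'a" where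
  "path_integral p = (let F = (SOME F. lift {0..1} p F) in F 1 \<ominus> F 0)"

lemma path_integral_eq:
  assumes "pathin X p" "lift {0..1} p F"
  shows "path_integral p = F 1 \<ominus> F 0"
proof -
  define G where "G = (SOME F. lift {0..1} p F)"
  have G: "lift {0..1} p G"
    unfolding G_def by (rule someI_ex[OF lift_path[OF assms(1)]])
  have "F 1 \<ominus> G 1 = F 0 \<ominus> G 0"
    using assms by (intro lift_unique[OF _ _ assms(2) G]) (auto simp: pathin_def)
  moreover have "F 1 \<in> carrier K" "G 1 \<in> carrier K" "F 0 \<in> carrier K" "G 0 \<in> carrier K"
    using lift_closed[OF assms(2)] lift_closed[OF G] by auto
  ultimately have "F 1 \<ominus> F 0 = G 1 \<ominus> G 0"
    using minus_eq_iff_swap by metis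
  then show ?thesis
    by (simp add: path_integral_def G_def Let_def)
qed

lemma path_integral_closed: "pathin X p \<Longrightarrow> path_integral p \<in> carrier K"
  using lift_path[of p] path_integral_eq[of p] lift_closed[of "{0..1}" p] by fastforce

lemma path_integral_const:
  assumes "pathin X p" "\<And>t. t \<in> {0..1} \<Longrightarrow> p t = p 0"
  shows "path_integral p = \<zero>"
proof -
  have "lift {0..1} p (\<lambda>_. \<zero>)"
    unfolding lift_def
  proof (intro conjI ballI impI exI[of _ "{0..1}"])
    fix i and y z :: real assume "y \<in> {0..1}" "z \<in> {0..1}"
    then show "\<zero> \<oplus> \<phi> i (p z) = \<zero> \<oplus> \<phi> i (p y)"
      using assms(2) by metis
  qed auto
  from path_integral_eq[OF assms(1) this] show ?thesis
    by (simp add: a_minus_def)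
qed

text \<open>Lift the whole homotopy. On the two sides where it stays at an end of the paths, the
  lift covers a constant path and so has equal values at both corners; hence the increments along
  the other two sides agree.\<close>

lemma path_integral_homotopic:
  assumes "path_homotopic X p q"
  shows "path_integral p = path_integral q"
proof -
  obtain h where h: "continuous_map (top_of_set ({0..1::real} \<times> {0..1})) X h"
    "\<And>t. t \<in> {0..1} \<Longrightarrow> h (0, t) = p t" "\<And>t. t \<in> {0..1} \<Longrightarrow> h (1, t) = q t"
    "\<And>s. s \<in> {0..1} \<Longrightarrow> h (s, 0) = p 0" "\<And>s. s \<in> {0..1} \<Longrightarrow> h (s, 1) = p 1"
    using path_homotopicE[OF assms] by blast
  obtain F where F: "lift ({0..1} \<times> {0..1}) h F"
    using lift_square[OF h(1)] by blast
  have lift': "lift {0..1} r (F \<circ> g)"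
    if "continuous_on {0..1} g" "g \<in> {0..1} \<rightarrow> {0..1} \<times> {0..1}" "\<And>t. t \<in> {0..1} \<Longrightarrow> r t = h (g t)"
    for r and g :: "real \<Rightarrow> real \<times> real"
    by (rule lift_cong[OF lift_compose[OF F that(1,2)]]) (simp_all add: that(3))
  have p: "pathin X p" and q: "pathin X q"
    using path_homotopic_imp_pathin[OF assms] by auto
  have const: "F (0, a) = F (1, a)" if "a \<in> {0, 1}" for a
  proof -
    have a: "pathin X (\<lambda>_. h (0, a))"
      using that path_start_in_topspace[OF p] path_finish_in_topspace[OF p] h(4,5)[of 0] by auto
    have "lift {0..1} (\<lambda>_. h (0, a)) (F \<circ> (\<lambda>s. (s, a)))"
      by (rule lift') (use that h(4,5) in \<open>auto intro!: continuous_intros\<close>)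
    from path_integral_eq[OF a this] have "F (1, a) \<ominus> F (0, a) = \<zero>"
      using path_integral_const[OF a] by simp
    moreover have "F (1, a) \<in> carrier K" "F (0, a) \<in> carrier K"
      using lift_closed[OF F] that by auto
    moreover have "\<zero> \<ominus> \<zero> = \<zero>"
      unfolding a_minus_def by (rule r_neg) simp
    ultimately show ?thesis
      using minus_cancel_iff[of "F (1, a)" \<zero> "F (0, a)" \<zero>] by simp
  qed
  have "path_integral p = (F \<circ> (\<lambda>t. (0, t))) 1 \<ominus> (F \<circ> (\<lambda>t. (0, t))) 0"
    by (rule path_integral_eq[OF p], rule lift') (use h in \<open>auto intro!: continuous_intros\<close>)
  moreover have "path_integral q = (F \<circ> (\<lambda>t. (1, t))) 1 \<ominus> (F \<circ> (\<lambda>t. (1, t))) 0"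
    by (rule path_integral_eq[OF q], rule lift') (use h in \<open>auto intro!: continuous_intros\<close>)
  ultimately show ?thesis
    using const by simp
qed

lemma path_integral_join:
  assumes "pathin X p" "pathin X q" "p 1 = q 0"
  shows "path_integral (path_join p q) = path_integral p \<oplus> path_integral q"
proof -
  have pq: "pathin X (path_join p q)"
    by (rule pathin_path_join[OF assms])
  obtain F where F: "lift {0..1} (path_join p q) F"
    using lift_path[OF pq] by blast
  have "lift {0..1} p (F \<circ> (\<lambda>t. t / 2))"
    by (rule lift_cong[OF lift_compose[OF F, of "{0..1}" "\<lambda>t. t / 2"]])
      (auto simp: path_join_def intro!: continuous_intros)
  then have "path_integral p = F (1/2) \<ominus> F 0"
    using path_integral_eq[OF assms(1)] by (simp add: o_def)
  moreover have "lift {0..1} q (F \<circ> (\<lambda>t. (1 + t) / 2))"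
    by (rule lift_cong[OF lift_compose[OF F, of "{0..1}" "\<lambda>t. (1 + t) / 2"]])
      (auto simp: path_join_def assms(3) field_simps intro!: continuous_intros arg_cong[of _ _ q])
  then have "path_integral q = F 1 \<ominus> F (1/2)"
    using path_integral_eq[OF assms(2)] by (simp add: o_def)
  moreover have "path_integral (path_join p q) = F 1 \<ominus> F 0"
    by (rule path_integral_eq[OF pq F])
  moreover have "F 0 \<in> carrier K" "F (1/2) \<in> carrier K" "F 1 \<in> carrier K"
    using lift_closed[OF F] by auto
  ultimately show ?thesis
    using minus_add_minus[of "F 1" "F (1/2)" "F 0"] by (simp add: a_comm)
qed

lemma path_integral_reverse:
  assumes "pathin X p"
  shows "path_integral (reverse_path p) = \<ominus> path_integral p"
proof -
  have "path_integral p \<oplus> path_integral (reverse_path p) = path_integral (\<lambda>_. p 0)"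
    using path_integral_homotopic[OF path_homotopic_join_reverse[OF assms]] assms
    by (simp add: path_integral_join pathin_reverse)
  also have "\<dots> = \<zero>"
    using assms path_start_in_topspace by (intro path_integral_const) auto
  finally show ?thesis
    using path_integral_closed assms pathin_reverse
    by (metis a_comm minus_equality)
qed

end

section \<open>The one-skeleton and walks\<close>

lemma edges_iff: "(y, x) \<in> edges C \<longleftrightarrow> x \<in> Obj C \<and> y \<in> Obj C \<and> x \<noteq> y \<and> nonzero_Mor C y x"
  by (simp add: edges_def)

lemma cell_attachment_one_skeleton:
  "cell_attachment (discrete_topology (Obj C)) {0..1::real} {0, 1} (edges C) edge_attach"
proof
  show "edge_attach i p \<in> topspace (discrete_topology (Obj C))" if "i \<in> edges C" for i and p :: real
    using that by (cases i) (auto simp: edge_attach_def edges_iff)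
qed auto

definition edge_point :: "'o \<times> 'o \<Rightarrow> real \<Rightarrow> 'o skeleton_point" where
  "edge_point = characteristic_map {0, 1} edge_attach"

lemma edge_point_simps:
  "edge_point (y, x) 0 = Inl x" "edge_point (y, x) 1 = Inl y"
  "0 < t \<Longrightarrow> t < 1 \<Longrightarrow> edge_point E t = Inr (E, t)"
  by (auto simp: edge_point_def characteristic_map_def edge_attach_def)

lemma edge_path_eq: "edge_path y x = (if x = y then (\<lambda>_. Inl x) else edge_point (y, x))"
  by (auto simp: edge_path_def edge_point_def fun_eq_iff)

context
  fixes C :: "('o, 'k, 'm) kcat"
begin

interpretation skel: cell_attachment "discrete_topology (Obj C)" "{0..1::real}" "{0, 1}"
    "edges C" edge_attach
  rewrites "attach_cells (discrete_topology (Obj C)) {0..1} {0, 1} (edges C) edge_attach \<equiv>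
      one_skeleton C"
    and "characteristic_map {0, 1} edge_attach \<equiv> edge_point"
  by (simp_all add: cell_attachment_one_skeleton one_skeleton_def edge_point_def)

lemma continuous_map_edge_point: "E \<in> edges C \<Longrightarrow> continuous_map (top_of_set {0..1}) (one_skeleton C)
    (edge_point E)"
  by (rule skel.continuous_map_chi)

lemma topspace_one_skeleton:
  "topspace (one_skeleton C) = Inl ` Obj C \<union> Inr ` (edges C \<times> {0<..<1})"
proof -
  have "{0..1} - {0, 1} = {0<..<1::real}" by auto
  then show ?thesis
    using skel.topspace_attach by simp
qed

lemma pathin_edge_path:
  assumes "x \<in> Obj C" "y \<in> Obj C" "nonzero_Mor C y x"
  shows "pathin (one_skeleton C) (edge_path y x)"
  using assms continuous_map_edge_point[of "(y, x)"]
  by (auto simp: edge_path_eq edges_iff pathin_def topspace_one_skeleton)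

section \<open>Open edges, open stars and their contraction\<close>

definition open_edge :: "'o \<times> 'o \<Rightarrow> 'o skeleton_point set" where
  "open_edge E = Inr ` ({E} \<times> {0<..<1})"

definition open_star :: "'o \<Rightarrow> 'o skeleton_point set" where
  "open_star v = insert (Inl v) (Inr ` ({(y, x) \<in> edges C. v = x \<or> v = y} \<times> {0<..<1}))"

lemma edge_point_cases:
  assumes "t \<in> {0..1}"
  obtains "t = 0" "edge_point (y, x) t = Inl x" | "t = 1" "edge_point (y, x) t = Inl y"
  | "0 < t" "t < 1" "edge_point (y, x) t = Inr ((y, x), t)"
proof -
  consider "t = 0" | "t = 1" | "0 < t" "t < 1"
    using assms by fastforce
  then show thesis
    by cases (use that in \<open>simp_all add: edge_point_simps\<close>)
qed

lemma edge_point_in_open_edge_iff: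
  assumes "t \<in> {0..1}"
  shows "edge_point E' t \<in> open_edge E \<longleftrightarrow> E' = E \<and> 0 < t \<and> t < 1"
proof (cases E')
  case (Pair y x)
  show ?thesis
    unfolding Pair by (rule edge_point_cases[OF assms, of y x]) (auto simp: open_edge_def)
qed

lemma openin_open_edge:
  assumes "E \<in> edges C"
  shows "openin (one_skeleton C) (open_edge E)"
  unfolding skel.openin_attach_iff
proof (intro conjI ballI)
  have "Inl -` open_edge E = {}"
    by (auto simp: open_edge_def)
  then show "openin (discrete_topology (Obj C)) (Inl -` open_edge E)"
    by simp
  fix E' assume "E' \<in> edges C"
  have "{t \<in> {0..1}. edge_point E' t \<in> open_edge E} = {0..1} \<inter> (if E' = E then {0<..<1} else {})"
    by (auto simp: edge_point_in_open_edge_iff)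
  also have "openin (top_of_set {0..1}) \<dots>"
    by (intro openin_open_Int) auto
  finally show "openin (top_of_set {0..1}) {t \<in> {0..1}. edge_point E' t \<in> open_edge E}" .
qed (use assms in \<open>auto simp: open_edge_def\<close>)

lemma edge_point_in_open_star_iff:
  assumes "(y, x) \<in> edges C" "t \<in> {0..1}"
  shows "edge_point (y, x) t \<in> open_star v \<longleftrightarrow> (v = x \<and> t < 1) \<or> (v = y \<and> t > 0)"
proof -
  have "x \<noteq> y" using assms by (simp add: edges_iff)
  with assms(1) show ?thesis
    by (cases rule: edge_point_cases[OF assms(2), of y x]) (auto simp: open_star_def)
qed

lemma openin_open_star:
  assumes "v \<in> Obj C"
  shows "openin (one_skeleton C) (open_star v)"
  unfolding skel.openin_attach_iff
proof (intro conjI ballI)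
  have "Inl -` open_star v = {v}"
    by (auto simp: open_star_def)
  then show "openin (discrete_topology (Obj C)) (Inl -` open_star v)"
    using assms by simp
  fix E assume E: "E \<in> edges C"
  obtain y x where [simp]: "E = (y, x)"
    by (cases E)
  have "{t \<in> {0..1}. edge_point E t \<in> open_star v} =
      {0..1} \<inter> (if v = x then {..<1} else if v = y then {0<..} else {})"
    using E by (auto simp: edge_point_in_open_star_iff edges_iff)
  also have "openin (top_of_set {0..1}) \<dots>"
    by (intro openin_open_Int) auto
  finally show "openin (top_of_set {0..1}) {t \<in> {0..1}. edge_point E t \<in> open_star v}" .
qed (use assms in \<open>auto simp: open_star_def\<close>)

text \<open>The parameter on an edge moves linearly to the end at \<open>v\<close>, which is 0 if
  \<open>v\<close> is the source and otherwise taken to be 1. On the open star of \<open>v\<close>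
  this end is unique, because the edges have distinct ends, and the only vertex to be fixed is
  \<open>v\<close>.\<close>

definition star_contraction :: "'o \<Rightarrow> real \<times> 'o skeleton_point \<Rightarrow> 'o skeleton_point" where
  "star_contraction v = (\<lambda>(s, q). case q of Inl w \<Rightarrow> Inl w
     | Inr ((y, x), t) \<Rightarrow> edge_point (y, x) ((1 - s) * t + s * (if v = x then 0 else 1)))"

lemma star_contraction_edge_point:
  assumes "(y, x) \<in> edges C" "t \<in> {0..1}" "edge_point (y, x) t \<in> open_star v"
  shows "star_contraction v (s, edge_point (y, x) t) =
    edge_point (y, x) ((1 - s) * t + s * (if v = x then 0 else 1))"
  using assms(3) unfolding edge_point_in_open_star_iff[OF assms(1,2)]
  by (cases rule: edge_point_cases[OF assms(2), of y x])
    (use assms(1) in \<open>auto simp: star_contraction_def edge_point_simps edges_iff\<close>)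

lemma continuous_map_star_contraction:
  assumes "v \<in> Obj C"
  shows "continuous_map (prod_topology (top_of_set {0..1}) (subtopology (one_skeleton C) (open_star v)))
    (one_skeleton C) (star_contraction v)"
proof (rule skel.continuous_map_unit_times_attach[OF openin_open_star[OF assms]])
  have "continuous_map (prod_topology (top_of_set {0..1}) (subtopology (discrete_topology (Obj C))
      (Inl -` open_star v)))
      (one_skeleton C) (Inl \<circ> snd)"
    by (rule continuous_map_compose[OF _ skel.continuous_map_Inl])
      (rule continuous_map_compose[OF continuous_map_snd
        continuous_map_from_subtopology[OF continuous_map_id], unfolded id_o])
  then show "continuous_map (prod_topology (top_of_set {0..1}) (subtopology (discrete_topology (Obj
      C)) (Inl -` open_star v)))
      (one_skeleton C) (\<lambda>(s, q). star_contraction v (s, Inl q))"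
    by (simp add: star_contraction_def o_def split_def)
  fix E assume E: "E \<in> edges C"
  obtain y x where [simp]: "E = (y, x)"
    by (cases E)
  let ?D = "{t \<in> {0..1}. edge_point E t \<in> open_star v}"
  have "continuous_map (top_of_set ({0..1} \<times> ?D)) (one_skeleton C)
      (edge_point E \<circ> (\<lambda>z. (1 - fst z) * snd z + fst z * (if v = x then 0 else 1)))"
  proof (rule continuous_map_compose[OF _ continuous_map_edge_point[OF E]])
    have "(1 - s) * t + s * a \<in> {0..1}" if "s \<in> {0..1}" "t \<in> {0..1}" "a \<in> {0, 1}" for s t a :: real
      using that convex_bound_le[of t 1 a "1 - s" s] by auto
    then show "continuous_map (top_of_set ({0..1} \<times> ?D)) (top_of_set {0..1})
        (\<lambda>z. (1 - fst z) * snd z + fst z * (if v = x then 0 else 1))"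
      by (simp add: Pi_iff) (intro conjI impI continuous_intros)
  qed
  then have "continuous_map (top_of_set ({0..1} \<times> ?D)) (one_skeleton C)
      (\<lambda>(s, t). star_contraction v (s, edge_point E t))"
    by (rule continuous_map_eq) (use E in \<open>auto simp: star_contraction_edge_point\<close>)
  then show "continuous_map (prod_topology (top_of_set {0..1}) (top_of_set ?D)) (one_skeleton C)
      (\<lambda>(s, t). star_contraction v (s, edge_point E t))"
    by (simp add: prod_topology_subtopology_eu)
qed

text \<open>
  An induction principle: up to homotopy, every path between vertices is a composite of edges and
  inverse edges.
\<close>

lemma one_skeleton_path_in_class:
  assumes const: "\<And>v. v \<in> Obj C \<Longrightarrow> (\<lambda>_. Inl v) \<in> \<G>"
    and edge: "\<And>x y. (y, x) \<in> edges C \<Longrightarrow> edge_path y x \<in> \<G>"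
    and reverse: "\<And>x y. (y, x) \<in> edges C \<Longrightarrow> reverse_path (edge_path y x) \<in> \<G>"
    and join: "\<And>p q. \<lbrakk>p \<in> \<G>; q \<in> \<G>; p 1 = q 0\<rbrakk> \<Longrightarrow> path_join p q \<in> \<G>"
    and homotopic: "\<And>p q. \<lbrakk>p \<in> \<G>; path_homotopic (one_skeleton C) p q\<rbrakk> \<Longrightarrow> q \<in> \<G>"
    and \<G>: "\<And>p. p \<in> \<G> \<Longrightarrow> pathin (one_skeleton C) p"
    and p: "pathin (one_skeleton C) p" "p 0 = Inl a" "p 1 = Inl b"
  shows "p \<in> \<G>"
proof -
  let ?X = "one_skeleton C"
  have ab: "a \<in> Obj C" "b \<in> Obj C"
    using path_start_in_topspace[OF p(1)] path_finish_in_topspace[OF p(1)] p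
    by (auto simp: topspace_one_skeleton)
  have end_at: "star_contraction v (1, q) = Inl v" if "q \<in> open_star v" for v q
    using that by (auto simp: open_star_def star_contraction_def edge_point_simps)
  have "\<exists>q\<in>\<G>. q 0 = star_contraction a (1, p 0) \<and>
      path_homotopic ?X (path_join p (\<lambda>s. star_contraction b (s, p 1)))
        (path_join (\<lambda>s. star_contraction a (s, p 0)) q)"
  proof (rule deform_path[where U = open_star and I = "Obj C"])
    show "topspace ?X \<subseteq> (\<Union>v\<in>Obj C. open_star v)"
      by (auto simp: topspace_one_skeleton open_star_def edges_iff)
  next
    fix v q assume v: "v \<in> Obj C" and q: "q \<in> open_star v"
    show "star_contraction v (0, q) = q"
      using q by (auto simp: open_star_def star_contraction_def edge_point_simps)
  next
    fix v p assume v: "v \<in> Obj C" "pathin ?X p" "p \<in> {0..1} \<rightarrow> open_star v"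
    have "path_homotopic ?X (\<lambda>_. Inl v) (\<lambda>t. star_contraction v (1, p t))"
      using v end_at by (intro path_homotopic_eqI) (auto simp: topspace_one_skeleton Pi_iff)
    with const[OF v(1)] show "(\<lambda>t. star_contraction v (1, p t)) \<in> \<G>"
      by (rule homotopic)
  next
    fix v w q assume vw: "v \<in> Obj C" "w \<in> Obj C" and q: "q \<in> open_star v" "q \<in> open_star w"
    show "\<exists>g\<in>\<G>. g 0 = star_contraction v (1, q) \<and>
        path_homotopic ?X (\<lambda>s. star_contraction w (s, q)) (path_join (\<lambda>s. star_contraction v (s, q)) g)"
    proof (cases "v = w")
      case True
      have "continuous_map (top_of_set {0..1}) (prod_topology (top_of_set {0..1::real}) (subtopology
          ?X (open_star v)))
          (\<lambda>s. (s, q))"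
        using q openin_subset[OF openin_open_star[OF vw(1)]] by
            (auto simp: continuous_map_pairwise o_def)
      from continuous_map_compose[OF this continuous_map_star_contraction[OF vw(1)]]
      have "pathin ?X (\<lambda>s. star_contraction v (s, q))"
        by (simp add: pathin_def o_def)
      from path_homotopic_sym[OF path_homotopic_join_const[OF this]] True const[OF vw(1)] show ?thesis
        by (intro bexI[of _ "\<lambda>_. Inl v"]) (simp_all add: end_at[OF q(2)])
    next
      case False
      \<comment> \<open>The open stars of distinct vertices meet only inside edges that join them.
        Such an edge, traversed in the appropriate direction, is the required path between the ends
        of the two tracks.\<close>
      then obtain y x t where yx: "(y, x) \<in> edges C" "v = x \<and> w = y \<or> v = y \<and> w = x"
        and t: "q = Inr ((y, x), t)" "0 < t" "t < 1"
        using q by (auto simp: open_star_def)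
      have xy: "x \<noteq> y"
        using yx by (simp add: edges_iff)
      have t': "t \<in> {0..1}" using t by auto
      have mem: "(1 - s) * t + s * a \<in> {0..1}" if "s \<in> {0..1}" "a \<in> {0, 1}" for s a :: real
        using that t convex_bound_le[of t 1 a "1 - s" s] by auto
      \<comment> \<open>With \<open>a\<close> and \<open>b\<close> the parameters of
        \<open>v\<close> and \<open>w\<close>: going from \<open>t\<close> straight to
        \<open>b\<close>, or first to \<open>a\<close> and then along \<open>g\<close> to
        \<open>b\<close>, are two paths with the same ends in the convex parameter interval.\<close>
      have *: "path_homotopic ?X (edge_point (y, x) \<circ> (\<lambda>s. (1 - s) * t + s * b))
          (edge_point (y, x) \<circ> path_join (\<lambda>s. (1 - s) * t + s * a) g)"
        if "a \<in> {0, 1}" "b \<in> {0, 1}" "continuous_on {0..1} g" "g \<in> {0..1} \<rightarrow> {0..1}" "g 0 = a" "g 1 = b"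
        for a b :: real and g
        using that
        by (intro path_homotopic_convex[OF continuous_map_edge_point[OF yx(1)]]
            continuous_on_path_join_real
            path_join_mem continuous_intros) (auto simp: mem simp del: atLeastAtMost_iff)
      show ?thesis
        using yx(2)
      proof
        assume vw': "v = x \<and> w = y"
        then show ?thesis
          using *[of 0 1 id, unfolded path_join_compose] edge[OF yx(1)] xy
          by (intro bexI[of _ "edge_path y x"])
            (auto simp: t star_contraction_def edge_path_eq edge_point_simps o_def)
      next
        assume vw': "v = y \<and> w = x"
        have "continuous_on {0..1} (\<lambda>t::real. 1 - t)"
          by (intro continuous_intros)
        with vw' show ?thesis
          using *[of 1 0 "\<lambda>t. 1 - t", unfolded path_join_compose] reverse[OF yx(1)] xy
          by (intro bexI[of _ "reverse_path (edge_path y x)"])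
            (auto simp: t star_contraction_def edge_path_eq edge_point_simps o_def
              reverse_path_def)
      qed
    qed
  qed (use p ab join \<G> openin_open_star continuous_map_star_contraction in \<open>auto simp: open_star_def\<close>)
  \<comment> \<open>The ends of \<open>p\<close> are vertices, which the contractions fix, so both
    tracks are constant paths.\<close>
  then obtain q where q: "q \<in> \<G>" "q 0 = p 0" "path_homotopic ?X (path_join p (\<lambda>s. p 1)) (path_join
      (\<lambda>s. p 0) q)"
    by (auto simp: p star_contraction_def)
  have "path_homotopic ?X q (path_join (\<lambda>s. p 0) q)"
    using path_homotopic_sym[OF path_homotopic_const_join[OF \<G>[OF q(1)]]] q(2) by simp
  also note path_homotopic_sym[OF q(3)]
  also have "path_homotopic ?X (path_join p (\<lambda>s. p 1)) p"
    by (rule path_homotopic_join_const[OF p(1)])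
  finally show ?thesis
    using q(1) homotopic by blast
qed

end

section \<open>Paths of walks and boundaries of faces\<close>

lemma walk_path_single: "walk_path [v] = virtual_path v"
  by (simp add: walk_path_def fun_eq_iff)

text \<open>The rightmost entry is traversed first, so \<open>v\<close> occupies the last of
  \<open>n + 1\<close> equal intervals. At the junction the floor already selects \<open>v\<close>,
  at parameter 0, whereas the right-hand side still evaluates \<open>w\<close> at 1; hence the
  hypothesis on matching ends.\<close>

lemma walk_path_Cons:
  assumes w: "w \<noteq> []" "n = length w" and t: "t \<in> {0..1}" and "virtual_path v 0 = walk_path w 1"
  shows "walk_path (v # w) t =
    (if t \<le> n / (n + 1) then walk_path w ((n + 1) * t / n) else virtual_path v ((n + 1) * t - n))"
proof -
  define k where "k = nat \<lfloor>real (Suc n) * t\<rfloor>"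
  have n: "n > 0"
    using w by simp
  have k: "real k \<le> real (Suc n) * t" "real (Suc n) * t < real k + 1"
    using t by (auto simp: k_def)
  have Cons: "walk_path (v # w) t = virtual_path ((v # w) ! (n - min n k)) (real (Suc n) * t - real
      (min n k))"
    using w by (simp add: walk_path_def Let_def k_def)
  have le_iff: "t \<le> n / (n + 1) \<longleftrightarrow> real (Suc n) * t \<le> n"
    by (simp add: field_simps)
  consider "real (Suc n) * t < n" | "real (Suc n) * t = n" | "real (Suc n) * t > n"
    by linarith
  then show ?thesis
  proof cases
    case 1
    then have "k < n"
      using k by linarith
    then have "(v # w) ! (n - min n k) = w ! (n - 1 - k)"
      by (simp add: nth_Cons' )
    moreover have eq: "real n * ((real n + 1) * t / real n) = real (Suc n) * t"
      using n by (simp add: add.commute)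
    have "walk_path w ((real n + 1) * t / n) = virtual_path (w ! (n - 1 - k)) (real (Suc n) * t -
        real k)"
      unfolding walk_path_def Let_def w(2)[symmetric] eq k_def[symmetric] using \<open>k < n\<close> by simp
    ultimately show ?thesis
      using Cons 1 le_iff \<open>k < n\<close> by simp
  next
    case 2
    then have "k = n"
      by (simp add: k_def)
    then have "walk_path (v # w) t = virtual_path v 0"
      using Cons 2 by simp
    moreover have eq: "(real n + 1) * t / real n = 1"
      using 2 n by (simp add: add.commute)
    moreover have "t \<le> n / (n + 1)"
      using 2 le_iff by simp
    ultimately show ?thesis
      by (simp only: if_True eq assms(4))
  next
    case 3
    then have "k \<ge> n"
      using k by linarith
    then show ?thesis
      using Cons 3 le_iff by (simp add: min_def add.commute)
  qed
qed

context
  fixes C :: "('o, 'k, 'm) kcat"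
begin

lemma is_walk_single: "is_walk C y [v] x \<longleftrightarrow> virtual_in C v \<and> vsource v = x \<and> vtarget v = y"
  by (auto simp: is_walk_def)

lemma is_walk_Cons:
  "w \<noteq> [] \<Longrightarrow> is_walk C y (v # w) x \<longleftrightarrow> virtual_in C v \<and> vtarget v = y \<and> is_walk C (vsource v) w x"
  by (auto simp: is_walk_def successively_Cons)

lemma is_walk_append:
  "is_walk C z w' y \<Longrightarrow> is_walk C y w x \<Longrightarrow> is_walk C z (w' @ w) x"
  by (auto simp: is_walk_def successively_append_iff)

lemma virtual_path_ends [simp]:
  "virtual_path v 0 = Inl (vsource v)" "virtual_path v 1 = Inl (vtarget v)"
  by (cases v; simp add: edge_path_eq edge_point_simps)+

lemma virtual_path_simps:
  "virtual_path (Pos y f x) = edge_path y x" "virtual_path (Neg y f x) = reverse_path (edge_path y x)"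
  by (simp_all add: fun_eq_iff reverse_path_def)

lemma pathin_virtual_path:
  assumes "virtual_in C v"
  shows "pathin (one_skeleton C) (virtual_path v)"
  using assms by (cases v)
    (auto simp: virtual_path_simps nonzero_Mor_def intro!: pathin_reverse pathin_edge_path)

lemma virtual_path_vinverse: "virtual_path (vinverse v) = reverse_path (virtual_path v)"
  by (cases v) (simp_all add: virtual_path_simps)

lemma walk_path_Cons_homotopic:
  assumes "w \<noteq> []" "pathin (one_skeleton C) (walk_path w)" "virtual_in C v" "walk_path w 1
      = Inl (vsource v)"
  shows "path_homotopic (one_skeleton C) (path_join (walk_path w) (virtual_path v)) (walk_path (v # w))"
proof -
  let ?X = "one_skeleton C" and ?p = "path_join (walk_path w) (virtual_path v)"
  define n where "n = real (length w)"
  have n: "n > 0"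
    using assms(1) by (simp add: n_def)
  \<comment> \<open>Carries the uniform subdivision, where \<open>v\<close> has the last interval of
    length \<open>1 / (n + 1)\<close>, to the two halves of a join. The first summand climbs to 1/2
    and stays there, the second waits at 0 until \<open>t = n / (n + 1)\<close>.\<close>
  define g where "g t = min ((n + 1) * t / (2 * n)) (1/2) + max 0 (((n + 1) * t - n) / 2)" for t
  have p: "pathin ?X ?p"
    using assms by (intro pathin_path_join pathin_virtual_path) auto
  have "continuous_on {0..1} g"
    unfolding g_def by (intro continuous_intros) (use n in auto)
  moreover have "g t \<in> {0..1}" if "t \<in> {0..1}" for t
  proof -
    have "(n + 1) * t / (2 * n) \<ge> 0" "(n + 1) * t \<le> n + 1"
      using that n by (auto simp: mult_left_le)
    moreover have "min a (1/2) + max 0 b \<in> {0..1}" if "0 \<le> a" "b \<le> 1/2" for a b :: real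
      using that by (auto simp: min_def max_def)
    ultimately show ?thesis
      unfolding g_def by simp
  qed
  ultimately have g: "continuous_on {0..1} g" "g \<in> {0..1} \<rightarrow> {0..1}"
    by auto
  have gends: "g 0 = 0" "g 1 = 1"
    using n by (auto simp: g_def min_def max_def field_simps)
  have "path_homotopic ?X (?p \<circ> id) (?p \<circ> g)"
    using g gends by (intro path_homotopic_reparam[OF p]) auto
  moreover have "path_homotopic ?X (?p \<circ> g) (walk_path (v # w))"
  proof (rule path_homotopic_eqI)
    show "pathin ?X (?p \<circ> g)"
      by (rule pathin_reparam[OF p g])
    fix t :: real assume t: "t \<in> {0..1}"
    have Cons: "walk_path (v # w) t =
        (if t \<le> n / (n + 1) then walk_path w ((n + 1) * t / n) else virtual_path v ((n + 1) * t - n))"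
      using walk_path_Cons[of w "length w" t v] assms t by (simp add: n_def add.commute)
    show "walk_path (v # w) t = (?p \<circ> g) t"
    proof (cases "t \<le> n / (n + 1)")
      case True
      then have "g t = (n + 1) * t / (2 * n)"
        using n by (simp add: g_def min_def max_def field_simps)
      moreover have "(n + 1) * t / (2 * n) \<le> 1/2"
        using True n by (simp add: field_simps)
      ultimately show ?thesis
        using Cons True by (simp add: path_join_def)
    next
      case False
      then have "g t = 1/2 + ((n + 1) * t - n) / 2"
        using n by (simp add: g_def min_def max_def field_simps)
      moreover have "(n + 1) * t - n > 0"
        using False n by (simp add: field_simps)
      ultimately have "2 * g t - 1 = (n + 1) * t - n" "\<not> g t \<le> 1/2"
        by auto
      then show ?thesis
        using Cons False by (simp only: path_join_def if_False o_apply)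
    qed
  qed
  ultimately show ?thesis
    by (auto intro: path_homotopic_trans)
qed

lemma pathin_walk_path:
  assumes "is_walk C y w x"
  shows "pathin (one_skeleton C) (walk_path w)" "walk_path w 0 = Inl x" "walk_path w 1 = Inl y"
proof -
  have "pathin (one_skeleton C) (walk_path w) \<and> walk_path w 0 = Inl x \<and> walk_path w 1 = Inl y"
    using assms
  proof (induction w arbitrary: y)
    case Nil
    then show ?case by (simp add: is_walk_def)
  next
    case (Cons v w)
    show ?case
    proof (cases "w = []")
      case True
      with Cons.prems show ?thesis
        by (auto simp: walk_path_single is_walk_single pathin_virtual_path)
    next
      case False
      with Cons.prems have v: "virtual_in C v" "vtarget v = y" and w: "is_walk C (vsource v) w x"
        by (auto simp: is_walk_Cons)
      have *: "path_homotopic (one_skeleton C) (path_join (walk_path w) (virtual_path v)) (walk_path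
          (v # w))"
        using Cons.IH[OF w] v False by (intro walk_path_Cons_homotopic) auto
      then show ?thesis
        using path_homotopic_imp_pathin[OF *] path_homotopic_imp_ends[OF *] Cons.IH[OF w] v by simp
    qed
  qed
  then show "pathin (one_skeleton C) (walk_path w)" "walk_path w 0 = Inl x" "walk_path w 1 = Inl y"
    by auto
qed

lemma walk_path_append:
  assumes "is_walk C z w' y" "is_walk C y w x"
  shows "path_homotopic (one_skeleton C) (path_join (walk_path w) (walk_path w')) (walk_path (w' @ w))"
  using assms(1)
proof (induction w' arbitrary: z)
  case Nil
  then show ?case by (simp add: is_walk_def)
next
  let ?X = "one_skeleton C"
  case (Cons v w')
  have w: "w \<noteq> []"
    using assms(2) by (simp add: is_walk_def)
  note pw = pathin_walk_path[OF assms(2)]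
  show ?case
  proof (cases "w' = []")
    case True
    with Cons.prems pw w show ?thesis
      using walk_path_Cons_homotopic[of w v] by (simp add: walk_path_single is_walk_single)
  next
    case False
    with Cons.prems have v: "virtual_in C v" "vtarget v = z" and w': "is_walk C (vsource v) w' y"
      by (auto simp: is_walk_Cons)
    note pw' = pathin_walk_path[OF w'] and pv = pathin_virtual_path[OF v(1)]
    note pww = pathin_walk_path[OF is_walk_append[OF w' assms(2)]]
    have "path_homotopic ?X (path_join (walk_path w) (walk_path (v # w')))
        (path_join (walk_path w) (path_join (walk_path w') (virtual_path v)))"
      using pw pw' v pathin_walk_path[OF Cons.prems] False
      by (intro path_homotopic_join path_homotopic_refl
          path_homotopic_sym[OF walk_path_Cons_homotopic]) auto
    also have "path_homotopic ?X \<dots> (path_join (path_join (walk_path w) (walk_path w')) (virtual_path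
        v))"
      using pw pw' pv by (intro path_homotopic_sym[OF path_homotopic_assoc]) auto
    also have "path_homotopic ?X \<dots> (path_join (walk_path (w' @ w)) (virtual_path v))"
      using pw' pv by (intro path_homotopic_join path_homotopic_refl Cons.IH[OF w']) auto
    also have "path_homotopic ?X \<dots> (walk_path (v # (w' @ w)))"
      using pww v w by (intro walk_path_Cons_homotopic) auto
    finally show ?thesis by simp
  qed
qed

lemma path_homotopic_reverse_of_join:
  assumes "pathin X p" "pathin X q" "p 1 = q 0"
  shows "path_homotopic X (reverse_path (path_join p q)) (path_join (reverse_path q) (reverse_path p))"
proof (rule path_homotopic_eqI)
  show "pathin X (reverse_path (path_join p q))"
    using assms by (intro pathin_reverse pathin_path_join)
  fix t :: real assume "t \<in> {0..1}"
  show "path_join (reverse_path q) (reverse_path p) t = reverse_path (path_join p q) t"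
  \<comment> \<open>At the midpoint the left side takes the value \<open>q 0\<close> and the right
    side \<open>p 1\<close>, so this is the point where \<open>p 1 = q 0\<close> is needed.\<close>
  proof (cases "t = 1/2")
    case True
    show ?thesis
      unfolding True using assms(3) by (simp add: path_join_def reverse_path_def)
  next
    case False
    have "1 - 2 * t = 2 * (1 - t) - 1" "1 - (2 * t - 1) = 2 * (1 - t)"
      by simp_all
    with False show ?thesis
      by (simp add: path_join_def reverse_path_def)
  qed
qed

lemma walk_inverse:
  assumes "is_walk C y w x"
  shows "is_walk C x (walk_inverse w) y"
    and "path_homotopic (one_skeleton C) (reverse_path (walk_path w)) (walk_path (walk_inverse w))"
proof -
  let ?X = "one_skeleton C"
  have "is_walk C x (walk_inverse w) y \<and>
    path_homotopic ?X (reverse_path (walk_path w)) (walk_path (walk_inverse w))"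
    using assms
  proof (induction w arbitrary: y)
    case Nil
    then show ?case by (simp add: is_walk_def)
  next
    case (Cons v w)
    have v: "virtual_in C v" "vtarget v = y"
      using Cons.prems by (auto simp: is_walk_def)
    then have v': "is_walk C (vsource v) [vinverse v] y"
      by (cases v) (auto simp: is_walk_single)
    show ?case
    proof (cases "w = []")
      case True
      with Cons.prems have "vsource v = x"
        by (simp add: is_walk_single)
      with v v' True show ?thesis
        by (simp add: walk_inverse_def walk_path_single virtual_path_vinverse pathin_virtual_path
            pathin_reverse path_homotopic_refl)
    next
      case False
      with Cons.prems have w: "is_walk C (vsource v) w x"
        by (auto simp: is_walk_Cons)
      note IH = Cons.IH[OF w]
      have inv: "walk_inverse (v # w) = walk_inverse w @ [vinverse v]"
        by (simp add: walk_inverse_def)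
      have "path_homotopic ?X (reverse_path (walk_path (v # w)))
          (reverse_path (path_join (walk_path w) (virtual_path v)))"
        using v pathin_walk_path[OF w] False
        by (intro path_homotopic_reverse path_homotopic_sym[OF walk_path_Cons_homotopic]) auto
      also have "path_homotopic ?X \<dots> (path_join (reverse_path (virtual_path v)) (reverse_path
          (walk_path w)))"
        using v pathin_walk_path[OF w] by (intro path_homotopic_reverse_of_join pathin_virtual_path)
            auto
      also have "path_homotopic ?X \<dots> (path_join (walk_path [vinverse v]) (walk_path (walk_inverse w)))"
        using v pathin_walk_path[OF w] IH
        by (intro path_homotopic_join)
          (auto simp: walk_path_single virtual_path_vinverse pathin_virtual_path pathin_reverse
              path_homotopic_refl)
      also have "path_homotopic ?X \<dots> (walk_path (walk_inverse (v # w)))"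
        unfolding inv using IH v' by (intro walk_path_append) auto
      finally show ?thesis
        using IH v' inv is_walk_append by metis
    qed
  qed
  then show "is_walk C x (walk_inverse w) y"
    and "path_homotopic ?X (reverse_path (walk_path w)) (walk_path (walk_inverse w))"
    by auto
qed

text \<open>Locates the points of the boundary of a face: each lies on one of the edges listed in
  its boundary walk.\<close>

lemma walk_path_in_virtual_paths:
  assumes "w \<noteq> []" "t \<in> {0..1}"
  shows "\<exists>v\<in>set w. \<exists>s\<in>{0..1}. walk_path w t = virtual_path v s"
proof -
  define n where "n = length w"
  define i where "i = min (n - 1) (nat \<lfloor>real n * t\<rfloor>)"
  have n: "n > 0"
    using assms(1) by (simp add: n_def)
  have "real n * t \<ge> 0" "real n * t \<le> n"
    using assms(2) by (auto simp: mult_left_le)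
  then have "real n * t - real i \<in> {0..1}"
    using n unfolding i_def min_def by (auto simp: of_nat_diff le_nat_floor) linarith+
  moreover have "walk_path w t = virtual_path (w ! (n - 1 - i)) (real n * t - real i)"
    by (simp add: walk_path_def Let_def n_def i_def)
  moreover have "w ! (n - 1 - i) \<in> set w"
    using n by (simp add: n_def)
  ultimately show ?thesis by blast
qed

end

section \<open>Loops as maps of the unit circle\<close>

lemma Arg2pi_cis_circle:
  assumes "t \<in> {0..1}"
  shows "Arg2pi (cis (2 * pi * t)) / (2 * pi) = (if t = 1 then 0 else t)"
proof (cases "t = 1")
  case False
  then have "Arg2pi (cis (2 * pi * t)) = 2 * pi * t"
    using assms by (intro Arg2pi_unique[of 1]) (auto simp: cis_conv_exp mult.commute)
  with False show ?thesis by simp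
next
  case True
  then show ?thesis
    using Arg2pi_of_real[of 1] by simp
qed

text \<open>\<open>Arg2pi\<close> jumps at 1, so the map is not a composite of continuous ones. But
  winding a compact interval around the Hausdorff circle is a quotient map, and pulled back along it
  the map becomes \<open>p\<close>, where \<open>p 0 = p 1\<close> absorbs the jump.\<close>

lemma continuous_map_circle:
  assumes p: "pathin X p" "p 0 = p 1"
  shows "continuous_map (top_of_set (sphere 0 1)) X (\<lambda>z. p (Arg2pi z / (2 * pi)))"
proof -
  have "quotient_map (top_of_set {0..1}) (top_of_set (sphere 0 1)) (\<lambda>t. cis (2 * pi * t))"
  proof (rule T1_Spaces.continuous_imp_quotient_map)
    show "continuous_map (top_of_set {0..1}) (top_of_set (sphere 0 1)) (\<lambda>t. cis (2 * pi * t))"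
      by (auto intro!: continuous_intros)
    show "(\<lambda>t. cis (2 * pi * t)) ` topspace (top_of_set {0..1}) = topspace (top_of_set (sphere 0 1))"
    proof (intro equalityI subsetI)
      fix z :: complex assume "z \<in> topspace (top_of_set (sphere 0 1))"
      then have "z = cis (2 * pi * (Arg2pi z / (2 * pi)))"
        using Arg2pi_eq[of z] by (simp add: cis_conv_exp)
      moreover have "Arg2pi z / (2 * pi) \<in> {0..1}"
        using Arg2pi[of z] by auto
      ultimately have "z \<in> (\<lambda>t. cis (2 * pi * t)) ` {0..1}"
        by (rule image_eqI)
      then show "z \<in> (\<lambda>t. cis (2 * pi * t)) ` topspace (top_of_set {0..1})"
        by simp
    qed auto
  qed (auto simp: Hausdorff_space_subtopology compact_space_subtopology)
  then show ?thesis
  proof (rule continuous_compose_quotient_map)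
    show "continuous_map (top_of_set {0..1}) X ((\<lambda>z. p (Arg2pi z / (2 * pi))) \<circ> (\<lambda>t. cis (2 * pi * t)))"
      using p(1) unfolding pathin_def
      by (rule continuous_map_eq) (use p(2) in \<open>auto simp: Arg2pi_cis_circle\<close>)
  qed
qed

lemma sphere_path:
  fixes a b :: complex
  assumes "a \<in> sphere 0 1" "b \<in> sphere 0 1"
  obtains g where "continuous_on {0..1::real} g" "g \<in> {0..1} \<rightarrow> sphere 0 1" "g 0 = a" "g 1 = b"
proof -
  have "path_connected (sphere 0 1 :: complex set)"
    by (rule path_connected_sphere) simp
  then obtain g where "path g" "path_image g \<subseteq> sphere 0 1" "pathstart g = a" "pathfinish g = b"
    using assms unfolding path_connected_def by blast
  then show thesis
    by (intro that[of g]) (auto simp: path_def path_image_def pathstart_def pathfinish_def)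
qed

section \<open>The topology of the CW-complex\<close>

text \<open>For a digon the choice expression is the one in \<open>face_boundary\<close>, so that
  the base is exactly the vertex at which the boundary walk starts and ends.\<close>

fun face_base :: "'o face \<Rightarrow> 'o" where
  "face_base (Triangle x y z) = x" |
  "face_base (Digon P) = fst (SOME (x, y). P = {x, y})"

lemma Digon_choice:
  assumes "P = {a, b}"
  obtains x y where "(SOME (x, y). P = {x, y}) = (x, y)" "P = {x, y}"
proof -
  have "\<exists>z. case z of (x, y) \<Rightarrow> P = {x, y}"
    using assms by auto
  from someI_ex[OF this] show thesis
    using that by (auto split: prod.splits)
qed

locale cw_complex =
  fixes C :: "('o, 'k, 'm) kcat" and e :: "'o \<Rightarrow> 'o \<Rightarrow> 'm"
  assumes basis: "basis_choice C e"
begin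

abbreviation "X1 \<equiv> one_skeleton C"
abbreviation "X2 \<equiv> CW C e"

lemma basis_in:
  assumes "x \<in> Obj C" "y \<in> Obj C" "nonzero_Mor C y x"
  shows "e y x \<in> carrier (Mor C y x)" "e y x \<noteq> \<zero>\<^bsub>Mor C y x\<^esub>"
  using assms basis unfolding basis_choice_def by auto

text \<open>The vertices of a digon may be chosen in the order opposite to the one that witnessed
  membership in \<open>faces\<close>. Hence its last clause is a disjunction: which of the two round
  trips is known to be non-zero depends on the choice.\<close>

lemma faceE:
  assumes "F \<in> faces C e"
  obtains (triangle) x y z where "F = Triangle x y z" "(y, x) \<in> edges C" "(z, y) \<in> edges C"
      "(z, x) \<in> edges C"
      "face_boundary e F = [Neg z (e z x) x, Pos z (e z y) y, Pos y (e y x) x]" "face_base F = x"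
      "Comp C z y x (e z y) (e y x) \<noteq> \<zero>\<^bsub>Mor C z x\<^esub>"
    | (digon) x y where "F = Digon {x, y}" "(y, x) \<in> edges C" "(x, y) \<in> edges C"
      "face_boundary e F = [Pos x (e x y) y, Pos y (e y x) x]" "face_base F = x"
      "Comp C x y x (e x y) (e y x) \<noteq> \<zero>\<^bsub>Mor C x x\<^esub> \<or> Comp C y x y (e y x) (e x y) \<noteq> \<zero>\<^bsub>Mor C y y\<^esub>"
proof -
  consider x y z where "F = Triangle x y z" "x \<in> Obj C" "y \<in> Obj C" "z \<in> Obj C" "x \<noteq> y" "y \<noteq> z" "x \<noteq> z"
      "nonzero_Mor C y x" "nonzero_Mor C z y" "nonzero_Mor C z x"
          "Comp C z y x (e z y) (e y x) \<noteq> \<zero>\<^bsub>Mor C z x\<^esub>"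
    | x y where "F = Digon {x, y}" "x \<in> Obj C" "y \<in> Obj C" "x \<noteq> y" "nonzero_Mor C y x"
        "nonzero_Mor C x y"
      "Comp C x y x (e x y) (e y x) \<noteq> \<zero>\<^bsub>Mor C x x\<^esub>"
    using assms unfolding faces_def by blast
  then show thesis
  proof cases
    case 1
    then show thesis
      using triangle[of x y z] by (simp add: edges_iff)
  next
    case (2 a b)
    obtain x y where xy: "(SOME (x, y). {a, b} = {x, y}) = (x, y)" "{a, b} = {x, y}"
      using Digon_choice[of "{a, b}" a b] by blast
    then have "x = a \<and> y = b \<or> x = b \<and> y = a"
      by (auto simp: doubleton_eq_iff)
    then show thesis
      using digon[of x y] 2 xy by (auto simp: edges_iff Let_def)
  qed
qed

lemma boundary_walk:
  assumes "F \<in> faces C e"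
  shows "is_walk C (face_base F) (face_boundary e F) (face_base F)"
  using assms by (cases rule: faceE) (auto simp: is_walk_def edges_iff basis_in)

lemma continuous_map_face_attach:
  assumes "F \<in> faces C e"
  shows "continuous_map (top_of_set (sphere 0 1)) X1 (face_attach e F)"
  using continuous_map_circle[of X1 "walk_path (face_boundary e F)"] pathin_walk_path[OF
      boundary_walk[OF assms]]
  by (simp add: face_attach_def[abs_def])

lemma cell_attachment_CW: "cell_attachment X1 (cball 0 1) (sphere 0 1) (faces C e) (face_attach e)"
proof
  show "face_attach e F p \<in> topspace X1" if "F \<in> faces C e" "p \<in> sphere 0 1" for F p
    using continuous_map_funspace[OF continuous_map_face_attach[OF that(1)]] that(2) by auto
qed auto

sublocale cw: cell_attachment X1 "cball 0 1" "sphere 0 1" "faces C e" "face_attach e"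
  rewrites "attach_cells X1 (cball 0 1) (sphere 0 1) (faces C e) (face_attach e) \<equiv> X2"
  by (simp_all add: cell_attachment_CW CW_def)

lemma disc_minus_sphere: "cball 0 1 - sphere 0 1 = (ball 0 1 :: complex set)"
  by auto

abbreviation "disc_point \<equiv> characteristic_map (sphere 0 1) (face_attach e)"

lemma topspace_CW: "topspace X2 = Inl ` topspace X1 \<union> Inr ` (faces C e \<times> ball 0 1)"
  using cw.topspace_attach by (simp add: disc_minus_sphere)

lemma disc_point_simps:
  "norm z = 1 \<Longrightarrow> disc_point F z = Inl (face_attach e F z)"
  "norm z < 1 \<Longrightarrow> disc_point F z = Inr (F, z)"
  by (simp_all add: characteristic_map_def)

section \<open>Deformations of the punctured complex and of the open faces\<close>

definition punctured :: "'o cw_point set" where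
  "punctured = Inl ` topspace X1 \<union> Inr ` (faces C e \<times> (ball 0 1 - {0}))"

definition open_face :: "'o face \<Rightarrow> 'o cw_point set" where
  "open_face F = Inr ` ({F} \<times> ball 0 1)"

lemma disc_point_in_punctured:
  assumes "F \<in> faces C e" "z \<in> cball 0 1"
  shows "disc_point F z \<in> punctured \<longleftrightarrow> z \<noteq> 0"
  using assms cw.attach_in_topspace[OF assms(1), of z]
  by (cases "norm z = 1") (auto simp: disc_point_simps punctured_def)

lemma disc_point_in_open_face:
  assumes "z \<in> cball 0 1"
  shows "disc_point F' z \<in> open_face F \<longleftrightarrow> F' = F \<and> norm z < 1"
  using assms by (cases "norm z = 1") (auto simp: disc_point_simps open_face_def)

lemma openin_punctured: "openin X2 punctured"
  unfolding cw.openin_attach_iff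
proof (intro conjI ballI)
  have "Inl -` punctured = topspace X1"
    by (auto simp: punctured_def)
  then show "openin X1 (Inl -` punctured)"
    by simp
  fix F assume "F \<in> faces C e"
  then have "{z \<in> cball 0 1. disc_point F z \<in> punctured} = cball 0 1 \<inter> - {0}"
    using disc_point_in_punctured by auto
  also have "openin (top_of_set (cball 0 1)) \<dots>"
    by (intro openin_open_Int) auto
  finally show "openin (top_of_set (cball 0 1)) {z \<in> cball 0 1. disc_point F z \<in> punctured}" .
qed (auto simp: punctured_def disc_minus_sphere)

lemma openin_open_face:
  assumes "F \<in> faces C e"
  shows "openin X2 (open_face F)"
  unfolding cw.openin_attach_iff
proof (intro conjI ballI)
  have "Inl -` open_face F = {}"
    by (auto simp: open_face_def)
  then show "openin X1 (Inl -` open_face F)"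
    by simp
  fix F' assume "F' \<in> faces C e"
  have "{z \<in> cball 0 1. disc_point F' z \<in> open_face F} = cball 0 1 \<inter> (if F' = F then ball 0 1 else {})"
    using disc_point_in_open_face[of _ F' F] by (auto simp del: mem_cball mem_ball simp: dist_norm
        mem_ball)
  also have "openin (top_of_set (cball 0 1)) \<dots>"
    by (intro openin_open_Int) auto
  finally show "openin (top_of_set (cball 0 1)) {z \<in> cball 0 1. disc_point F' z \<in> open_face F}" .
qed (use assms in \<open>auto simp: open_face_def disc_minus_sphere\<close>)

lemma disc_point_sgn: "z \<noteq> 0 \<Longrightarrow> disc_point F (sgn z) = Inl (face_attach e F (sgn z))"
  by (simp add: disc_point_simps norm_sgn)

text \<open>At the centre of a face \<open>sgn\<close> is 0 and the value is an arbitrary default,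
  so continuity is claimed on \<open>punctured\<close> only.\<close>

fun radial :: "'o cw_point \<Rightarrow> 'o skeleton_point" where
  "radial (Inl q) = q" |
  "radial (Inr (F, z)) = face_attach e F (sgn z)"

lemma sgn_on_sphere: "norm (z::complex) = 1 \<Longrightarrow> sgn z = z"
  by (simp add: sgn_div_norm)

lemma radial_disc_point:
  assumes "z \<in> cball 0 1"
  shows "radial (disc_point F z) = face_attach e F (sgn z)"
  using assms by (cases "norm z = 1") (auto simp: disc_point_simps sgn_on_sphere)

lemma disc_preimage_punctured:
  "F \<in> faces C e \<Longrightarrow> {z \<in> cball 0 1. disc_point F z \<in> punctured} = cball 0 1 - {0}"
  using disc_point_in_punctured by auto

lemma continuous_on_sgn_punctured: "continuous_on (cball 0 1 - {0}) (sgn :: complex \<Rightarrow> complex)"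
  unfolding sgn_div_norm[abs_def] by (intro continuous_intros) auto

lemma continuous_map_radial: "continuous_map (subtopology X2 punctured) X1 radial"
proof (rule cw.continuous_map_from_attach[OF openin_punctured])
  have "radial \<circ> Inl = id"
    by auto
  then show "continuous_map (subtopology X1 (Inl -` punctured)) X1 (radial \<circ> Inl)"
    by (simp add: continuous_map_from_subtopology)
  fix F assume F: "F \<in> faces C e"
  have "continuous_map (top_of_set (cball 0 1 - {0})) X1 (face_attach e F \<circ> sgn)"
    by (rule continuous_map_compose[OF _ continuous_map_face_attach[OF F]])
      (auto simp: continuous_on_sgn_punctured norm_sgn)
  then have "continuous_map (top_of_set (cball 0 1 - {0})) X1 (radial \<circ> disc_point F)"
    by (rule continuous_map_eq) (auto simp: radial_disc_point)
  then show "continuous_map (top_of_set {z \<in> cball 0 1. disc_point F z \<in> punctured}) X1 (radial \<circ>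
      disc_point F)"
    by (simp only: disc_preimage_punctured[OF F])
qed

definition radial_homotopy :: "real \<times> 'o cw_point \<Rightarrow> 'o cw_point" where
  "radial_homotopy = (\<lambda>(s, p). case p of Inl q \<Rightarrow> Inl q
     | Inr (F, z) \<Rightarrow> disc_point F ((1 - s) *\<^sub>R z + s *\<^sub>R sgn z))"

lemma radial_homotopy_disc_point:
  assumes "z \<in> cball 0 1"
  shows "radial_homotopy (s, disc_point F z) = disc_point F ((1 - s) *\<^sub>R z + s *\<^sub>R sgn z)"
  using assms
  by (cases "norm z = 1") (auto simp: radial_homotopy_def disc_point_simps sgn_on_sphere simp flip:
      scaleR_add_left)

lemma convex_combination_cball:
  assumes "s \<in> {0..1}" "z \<in> cball 0 1" "w \<in> cball (0::complex) 1"
  shows "(1 - s) *\<^sub>R z + s *\<^sub>R w \<in> cball 0 1"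
  using assms convex_cball[of "0::complex" 1] unfolding convex_alt by (auto simp del: mem_cball)

lemma sgn_in_cball: "sgn (z::complex) \<in> cball 0 1"
  by (simp add: norm_sgn)

lemma continuous_map_radial_homotopy:
  "continuous_map (prod_topology (top_of_set {0..1}) (subtopology X2 punctured)) X2 radial_homotopy"
proof (rule cw.continuous_map_unit_times_attach[OF openin_punctured])
  have "continuous_map (prod_topology (top_of_set {0..1}) (subtopology X1 (Inl -` punctured))) X2
      (Inl \<circ> snd)"
    by (rule continuous_map_compose[OF continuous_map_compose[OF continuous_map_snd
          continuous_map_from_subtopology[OF continuous_map_id], unfolded id_o] cw.continuous_map_Inl])
  then show "continuous_map (prod_topology (top_of_set {0..1}) (subtopology X1 (Inl -` punctured))) X2
      (\<lambda>(s, q). radial_homotopy (s, Inl q))"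
    by (simp add: radial_homotopy_def o_def split_def)
  fix F assume F: "F \<in> faces C e"
  let ?D = "{0..1::real} \<times> (cball (0::complex) 1 - {0})"
  have "continuous_map (top_of_set ?D) X2
      (disc_point F \<circ> (\<lambda>p. (1 - fst p) *\<^sub>R snd p + fst p *\<^sub>R sgn (snd p)))"
  proof (rule continuous_map_compose[OF _ cw.continuous_map_chi[OF F]])
    have "continuous_on ?D (\<lambda>p. (1 - fst p) *\<^sub>R snd p + fst p *\<^sub>R sgn (snd p))"
      by (intro continuous_intros continuous_on_compose2[OF continuous_on_sgn_punctured]) auto
    moreover have "(1 - s) *\<^sub>R z + s *\<^sub>R sgn z \<in> cball 0 1" if "s \<in> {0..1}" "z \<in> cball 0 1" for s
        and z :: complex
      using that sgn_in_cball by (intro convex_combination_cball)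
    ultimately show "continuous_map (top_of_set ?D) (top_of_set (cball 0 1))
        (\<lambda>p. (1 - fst p) *\<^sub>R snd p + fst p *\<^sub>R sgn (snd p))"
      by (auto simp del: mem_cball)
  qed
  then have "continuous_map (top_of_set ?D) X2 (\<lambda>(s, z). radial_homotopy (s, disc_point F z))"
    by (rule continuous_map_eq) (auto simp: radial_homotopy_disc_point simp del: mem_cball)
  then show "continuous_map (prod_topology (top_of_set {0..1}) (top_of_set {z \<in> cball 0 1.
      disc_point F z \<in> punctured})) X2
      (\<lambda>(s, z). radial_homotopy (s, disc_point F z))"
    by (simp only: disc_preimage_punctured[OF F] prod_topology_subtopology_eu)
qed

text \<open>Tracks run straight to the boundary point 1 of the disc and thus leave the open face at
  the end. This is intended: only their ends have to lie in the one-skeleton.\<close>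

definition face_contraction :: "real \<times> 'o cw_point \<Rightarrow> 'o cw_point" where
  "face_contraction = (\<lambda>(s, p). case p of Inl q \<Rightarrow> Inl q
     | Inr (F, z) \<Rightarrow> disc_point F ((1 - s) *\<^sub>R z + s *\<^sub>R 1))"

lemma continuous_map_face_contraction:
  assumes F: "F \<in> faces C e"
  shows "continuous_map (prod_topology (top_of_set {0..1}) (subtopology X2 (open_face F))) X2
      face_contraction"
proof (rule cw.continuous_map_unit_times_attach[OF openin_open_face[OF F]])
  have "Inl -` open_face F = {}"
    by (auto simp: open_face_def)
  then show "continuous_map (prod_topology (top_of_set {0..1}) (subtopology X1 (Inl -` open_face F))) X2
      (\<lambda>(s, q). face_contraction (s, Inl q))"
    by (auto simp: continuous_map_def openin_subset)
  fix F' assume F': "F' \<in> faces C e"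
  let ?D' = "{z \<in> cball 0 1. disc_point F' z \<in> open_face F}"
  let ?D = "{0..1::real} \<times> ?D'"
  have "continuous_map (top_of_set ?D) X2
      (disc_point F' \<circ> (\<lambda>p. (1 - fst p) *\<^sub>R snd p + fst p *\<^sub>R 1))"
  proof (rule continuous_map_compose[OF _ cw.continuous_map_chi[OF F']])
    have "continuous_on ?D (\<lambda>p. (1 - fst p) *\<^sub>R snd p + fst p *\<^sub>R 1)"
      by (intro continuous_intros)
    moreover have "(1 - s) *\<^sub>R z + s *\<^sub>R 1 \<in> cball 0 1" if "s \<in> {0..1}" "z \<in> cball 0 1" for s
        and z :: complex
      using that by (intro convex_combination_cball) auto
    ultimately show "continuous_map (top_of_set ?D) (top_of_set (cball 0 1))
        (\<lambda>p. (1 - fst p) *\<^sub>R snd p + fst p *\<^sub>R 1)"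
      by (auto simp del: mem_cball)
  qed
  then have "continuous_map (top_of_set ?D) X2 (\<lambda>(s, z). face_contraction (s, disc_point F' z))"
    by (rule continuous_map_eq)
      (auto simp: disc_point_in_open_face face_contraction_def disc_point_simps simp del: mem_cball)
  then show "continuous_map (prod_topology (top_of_set {0..1}) (top_of_set ?D')) X2
      (\<lambda>(s, z). face_contraction (s, disc_point F' z))"
    by (simp only: prod_topology_subtopology_eu)
qed

lemma disc_paths_homotopic:
  assumes "F \<in> faces C e"
    and "continuous_on {0..1} g" "g \<in> {0..1} \<rightarrow> cball 0 1"
    and "continuous_on {0..1} h" "h \<in> {0..1} \<rightarrow> cball 0 1"
    and "h 0 = g 0" "h 1 = g 1"
  shows "path_homotopic X2 (disc_point F \<circ> g) (disc_point F \<circ> h)"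
  by (rule path_homotopic_convex[OF cw.continuous_map_chi[OF assms(1)] convex_cball assms(2-7)])

section \<open>Pushing paths into the one-skeleton, and boundaries of faces\<close>

lemma pathin_Inl: "pathin X1 p \<Longrightarrow> pathin X2 (Inl \<circ> p)"
  using pathin_compose[OF _ cw.continuous_map_Inl] .

lemma path_homotopic_Inl: "path_homotopic X1 p q \<Longrightarrow> path_homotopic X2 (Inl \<circ> p) (Inl \<circ> q)"
  by (rule path_homotopic_compose[OF _ cw.continuous_map_Inl])

text \<open>\<open>deform_path\<close> with the punctured complex, retracted radially, and the open
  faces, each contracted to a boundary point. The first chart misses only the centres of the faces,
  which the others cover.\<close>

lemma path_homotopic_to_skeleton:
  assumes p: "pathin X2 p" "p 0 = Inl a" "p 1 = Inl b"
  obtains q where "pathin X1 q" "path_homotopic X2 p (Inl \<circ> q)"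
proof -
  \<comment> \<open>Closing the class under homotopy also frees it from the values of paths outside
    the unit interval, where a displaced path need not lie in the skeleton.\<close>
  define \<G> where "\<G> = {q. \<exists>q'. pathin X1 q' \<and> path_homotopic X2 q (Inl \<circ> q')}"
  define U where "U i = (case i of None \<Rightarrow> punctured | Some F \<Rightarrow> open_face F)" for i
  define c where "c i = (case i of None \<Rightarrow> radial_homotopy | Some F \<Rightarrow> face_contraction)" for i ::
      "'o face option"
  have Inl_G: "Inl \<circ> q \<in> \<G>" if "pathin X1 q" for q
    using that path_homotopic_refl[OF pathin_Inl[OF that]] by (auto simp: \<G>_def)
  have ab: "a \<in> topspace X1" "b \<in> topspace X1"
    using path_start_in_topspace[OF p(1)] path_finish_in_topspace[OF p(1)] p by (auto simp: topspace_CW)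
  have cont: "continuous_map (prod_topology (top_of_set {0..1}) (subtopology X2 (U i))) X2 (c i)"
    if "i \<in> insert None (Some ` faces C e)" for i
    using that by (auto simp: U_def c_def continuous_map_radial_homotopy
        continuous_map_face_contraction)
  have open_U: "openin X2 (U i)" if "i \<in> insert None (Some ` faces C e)" for i
    using that by (auto simp: U_def openin_punctured openin_open_face)
  \<comment> \<open>Two straight tracks from \<open>z\<close> in one disc end at boundary points
    \<open>v\<close> and \<open>w\<close>. A path on the circle from \<open>v\<close> to
    \<open>w\<close> joins them, and convexity of the disc provides the homotopy.\<close>
  have arc: "\<exists>q\<in>\<G>. q 0 = disc_point F v \<and>
      path_homotopic X2 (disc_point F \<circ> (\<lambda>s. (1 - s) *\<^sub>R z + s *\<^sub>R w))
        (path_join (disc_point F \<circ> (\<lambda>s. (1 - s) *\<^sub>R z + s *\<^sub>R v)) q)"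
    if F: "F \<in> faces C e" and z: "z \<in> cball 0 1" and vw: "v \<in> sphere 0 1" "w \<in> sphere 0 1" for F z v w
  proof -
    obtain g where g: "continuous_on {0..1::real} g" "g \<in> {0..1} \<rightarrow> sphere 0 1" "g 0 = v" "g 1 = w"
      using sphere_path[OF vw] by blast
    have g': "g \<in> {0..1} \<rightarrow> cball 0 1"
      using g(2) sphere_cball by blast
    have "pathin X1 (face_attach e F \<circ> g)"
      using g(1,2) continuous_map_face_attach[OF F] unfolding pathin_def
      by (intro continuous_map_compose[of _ "top_of_set (sphere 0 1)"]) auto
    moreover have "path_homotopic X2 (disc_point F \<circ> g) (Inl \<circ> (face_attach e F \<circ> g))"
    proof (rule path_homotopic_eqI)
      show "pathin X2 (disc_point F \<circ> g)"
        using g(1) g' cw.continuous_map_chi[OF F] unfolding pathin_def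
        by (intro continuous_map_compose[of _ "top_of_set (cball 0 1)"]) auto
    qed (use g(2) in \<open>auto simp: disc_point_simps Pi_iff\<close>)
    ultimately have "disc_point F \<circ> g \<in> \<G>"
      by (auto simp: \<G>_def)
    moreover have "path_homotopic X2 (disc_point F \<circ> (\<lambda>s. (1 - s) *\<^sub>R z + s *\<^sub>R w))
        (disc_point F \<circ> path_join (\<lambda>s. (1 - s) *\<^sub>R z + s *\<^sub>R v) g)"
      using vw sphere_cball[of 0 "1::real"] z g g'
      by (intro disc_paths_homotopic F path_join_mem continuous_on_path_join_real continuous_intros)
        (auto intro!: convex_combination_cball simp del: mem_cball)
    ultimately show ?thesis
      using g(3) by (intro bexI[of _ "disc_point F \<circ> g"]) (auto simp: path_join_compose)
  qed
  have "\<exists>q\<in>\<G>. q 0 = c None (1, p 0) \<and>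
      path_homotopic X2 (path_join p (\<lambda>s. c None (s, p 1))) (path_join (\<lambda>s. c None (s, p 0)) q)"
  proof (rule deform_path[where U = U and I = "insert None (Some ` faces C e)"])
    show "topspace X2 \<subseteq> (\<Union>i\<in>insert None (Some ` faces C e). U i)"
      by (auto simp: topspace_CW U_def punctured_def open_face_def)
  next
    fix i x assume "i \<in> insert None (Some ` faces C e)" "x \<in> U i"
    then show "c i (0, x) = x"
      by (auto simp: U_def c_def punctured_def open_face_def radial_homotopy_def
          face_contraction_def disc_point_simps)
  next
    fix i q assume i: "i \<in> insert None (Some ` faces C e)" and q: "pathin X2 q" "q \<in> {0..1} \<rightarrow> U i"
    show "(\<lambda>t. c i (1, q t)) \<in> \<G>"
    proof (cases i)
      case None
      have "pathin X1 (radial \<circ> q)"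
        using q None continuous_map_radial unfolding pathin_def
        by (intro continuous_map_compose[of _ "subtopology X2 punctured"])
          (auto simp: continuous_map_in_subtopology U_def)
      then have "path_homotopic X2 (Inl \<circ> (radial \<circ> q)) (\<lambda>t. c i (1, q t))"
      proof (rule path_homotopic_eqI[OF pathin_Inl])
        fix t :: real assume "t \<in> {0..1}"
        then have "q t \<in> punctured"
          using q None by (auto simp: U_def)
        then show "c i (1, q t) = (Inl \<circ> (radial \<circ> q)) t"
          using None by (auto simp: c_def punctured_def radial_homotopy_def intro!: disc_point_sgn)
      qed
      with \<open>pathin X1 (radial \<circ> q)\<close> show ?thesis
        unfolding \<G>_def mem_Collect_eq using path_homotopic_sym by blast
    next
      case (Some F)
      then have F: "F \<in> faces C e"
        using i by auto
      have const: "pathin X1 (\<lambda>_. face_attach e F 1)"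
        using cw.attach_in_topspace[OF F, of 1] by simp
      have "path_homotopic X2 (Inl \<circ> (\<lambda>_. face_attach e F 1)) (\<lambda>t. c i (1, q t))"
      proof (rule path_homotopic_eqI[OF pathin_Inl[OF const]])
        fix t :: real assume "t \<in> {0..1}"
        then have "q t \<in> open_face F"
          using q Some by (auto simp: U_def)
        then show "c i (1, q t) = (Inl \<circ> (\<lambda>_. face_attach e F 1)) t"
          using Some by (auto simp: c_def open_face_def face_contraction_def disc_point_simps)
      qed
      with const show ?thesis
        unfolding \<G>_def mem_Collect_eq using path_homotopic_sym by blast
    qed
  next
    fix i j x assume i: "i \<in> insert None (Some ` faces C e)" and j: "j \<in> insert None (Some ` faces C e)"
      and x: "x \<in> U i" "x \<in> U j"
    show "\<exists>q\<in>\<G>. q 0 = c i (1, x) \<and>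
        path_homotopic X2 (\<lambda>s. c j (s, x)) (path_join (\<lambda>s. c i (s, x)) q)"
    proof (cases x)
      case (Inl q)
      then have "i = None" "j = None" and q: "q \<in> topspace X1"
        using x by (auto simp: U_def punctured_def open_face_def split: option.splits)
      moreover have "Inl \<circ> (\<lambda>_. q) \<in> \<G>"
        using q by (intro Inl_G) auto
      moreover have "path_homotopic X2 (\<lambda>_. Inl q) (path_join (\<lambda>_. Inl q) (\<lambda>_. Inl q))"
        using q by (intro path_homotopic_eqI) (auto simp: topspace_CW path_join_def)
      ultimately show ?thesis
        using Inl by (intro bexI[of _ "Inl \<circ> (\<lambda>_. q)"]) (auto simp: c_def radial_homotopy_def)
    next
      case (Inr r)
      then obtain F z where Fz: "x = Inr (F, z)"
        by (cases r) auto
      \<comment> \<open>The boundary point at which the track of the point \<open>z\<close> ends: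
        its radial projection in the punctured chart, the point 1 in a face chart.\<close>
      define v where "v k = (if k = None then sgn z else 1)" for k :: "'o face option"
      have F: "F \<in> faces C e" and z: "z \<in> cball 0 1"
        using x(1) Fz i by (auto simp: U_def punctured_def open_face_def)
      have *: "(\<lambda>s. c k (s, x)) = disc_point F \<circ> (\<lambda>s. (1 - s) *\<^sub>R z + s *\<^sub>R v k)" "v k \<in> sphere 0 1"
        if "x \<in> U k" for k
        using that Fz by (auto simp: U_def punctured_def open_face_def c_def v_def radial_homotopy_def
            face_contraction_def fun_eq_iff norm_sgn split: option.splits)
      have "c i (1, x) = disc_point F (v i)"
        using fun_cong[OF *(1)[OF x(1)], of 1] by simp
      then show ?thesis
        unfolding *(1)[OF x(1)] *(1)[OF x(2)] using arc[OF F z *(2)[OF x(1)] *(2)[OF x(2)]] by simp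
    qed
  next
    fix q r assume q: "q \<in> \<G>" and r: "r \<in> \<G>" and qr: "q 1 = r 0"
    obtain q' where q': "pathin X1 q'" "path_homotopic X2 q (Inl \<circ> q')"
      using q by (auto simp: \<G>_def)
    obtain r' where r': "pathin X1 r'" "path_homotopic X2 r (Inl \<circ> r')"
      using r by (auto simp: \<G>_def)
    have "(Inl (q' 1) :: 'o cw_point) = Inl (r' 0)"
      using path_homotopic_imp_ends(2)[OF q'(2)] path_homotopic_imp_ends(1)[OF r'(2)] qr
      by (metis comp_apply)
    then have "q' 1 = r' 0"
      by (rule Inl_inject)
    then have "pathin X1 (path_join q' r')"
      using q' r' by (intro pathin_path_join)
    moreover have "path_homotopic X2 (path_join q r) (Inl \<circ> path_join q' r')"
      unfolding path_join_compose by (rule path_homotopic_join[OF q'(2) r'(2) qr])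
    ultimately show "path_join q r \<in> \<G>"
      by (auto simp: \<G>_def)
  next
    show "p 0 \<in> U None" "p 1 \<in> U None"
      using p ab by (auto simp: U_def punctured_def)
  qed (use cont open_U p in \<open>auto simp: \<G>_def path_homotopic_imp_pathin\<close>)
  then obtain q q' where q: "q 0 = Inl a" "path_homotopic X2 (path_join p (\<lambda>_. p 1)) (path_join (\<lambda>_.
      Inl a) q)"
    and q': "pathin X1 q'" "path_homotopic X2 q (Inl \<circ> q')"
    by (auto simp: \<G>_def c_def radial_homotopy_def p)
  have "path_homotopic X2 p (path_join p (\<lambda>_. p 1))"
    by (rule path_homotopic_sym[OF path_homotopic_join_const[OF p(1)]])
  also note q(2)
  also have "path_homotopic X2 (path_join (\<lambda>_. Inl a) q) q"
    using path_homotopic_const_join[OF path_homotopic_imp_pathin(1)[OF q'(2)]] q(1) by simp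
  also note q'(2)
  finally show thesis
    using q'(1) that by blast
qed

text \<open>The boundary loop is the image of the once-traversed circle under the characteristic
  map, and in the convex disc that circle is homotopic to the constant path at 1.\<close>

lemma boundary_null_homotopic:
  assumes F: "F \<in> faces C e"
  shows "path_homotopic X2 (Inl \<circ> walk_path (face_boundary e F)) (\<lambda>_. Inl (Inl (face_base F)))"
proof -
  let ?w = "walk_path (face_boundary e F)"
  note w = pathin_walk_path[OF boundary_walk[OF F]]
  have circ: "continuous_on {0..1} (\<lambda>t. cis (2 * pi * t))" "(\<lambda>t. cis (2 * pi * t)) \<in> {0..1} \<rightarrow> cball 0 1"
    by (auto intro!: continuous_intros)
  have eq: "(disc_point F \<circ> (\<lambda>t. cis (2 * pi * t))) t = (Inl \<circ> ?w) t" if "t \<in> {0..1}" for t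
    using Arg2pi_cis_circle[OF that] w by (simp add: disc_point_simps face_attach_def)
  have "path_homotopic X2 (Inl \<circ> ?w) (disc_point F \<circ> (\<lambda>t. cis (2 * pi * t)))"
    using eq by (intro path_homotopic_eqI pathin_Inl w)
  also have "path_homotopic X2 (disc_point F \<circ> (\<lambda>t. cis (2 * pi * t))) (disc_point F \<circ> (\<lambda>_. 1))"
    by (intro disc_paths_homotopic F circ) auto
  also have "disc_point F \<circ> (\<lambda>_. 1) = (\<lambda>_. Inl (Inl (face_base F)))"
    using eq[of 0] w by (simp add: fun_eq_iff)
  finally show ?thesis .
qed

end

section \<open>Degrees of walks\<close>

lemma reverse_path_compose: "f \<circ> reverse_path p = reverse_path (f \<circ> p)"
  by (simp add: reverse_path_def fun_eq_iff)

lemma path_homotopic_cancel: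
  assumes p: "pathin X p" and q: "pathin X q" and ends: "p 1 = q 1"
    and null: "path_homotopic X (path_join p (reverse_path q)) (\<lambda>_. p 0)"
  shows "path_homotopic X p q"
proof -
  note paths = p q pathin_reverse[OF q]
  have q0: "q 0 = p 0"
    using path_homotopic_imp_ends(2)[OF null] by simp
  have "path_homotopic X p (path_join p (\<lambda>_. p 1))"
    by (rule path_homotopic_sym[OF path_homotopic_join_const[OF p]])
  also have "path_homotopic X \<dots> (path_join p (path_join (reverse_path q) q))"
    using ends path_homotopic_sym[OF path_homotopic_reverse_join[OF q]]
    by (intro path_homotopic_join path_homotopic_refl p) simp_all
  also have "path_homotopic X \<dots> (path_join (path_join p (reverse_path q)) q)"
    using paths ends by (intro path_homotopic_sym[OF path_homotopic_assoc]) auto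
  also have "path_homotopic X \<dots> (path_join (\<lambda>_. q 0) q)"
    using null q0 by (intro path_homotopic_join path_homotopic_refl q) simp_all
  also have "path_homotopic X \<dots> q"
    by (rule path_homotopic_const_join[OF q])
  finally show ?thesis .
qed

locale based_cw_complex = cw_complex +
  fixes c0 :: 'a and u :: "'a \<Rightarrow> ('a, 'c) virtual list"
  assumes base: "c0 \<in> Obj C" and connectors: "connectors C c0 u"
begin

abbreviation "G \<equiv> CW_pi1 C e c0"

abbreviation connector :: "'a \<Rightarrow> real \<Rightarrow> 'a cw_point" where
  "connector x \<equiv> Inl \<circ> walk_path (u x)"

text \<open>Closes a path between vertices up to a loop at \<open>c0\<close> by means of the
  connectors; it extends degrees from edges to all paths between vertices.\<close>

definition loop_class :: "(real \<Rightarrow> 'a cw_point) \<Rightarrow> 'a \<Rightarrow> 'a \<Rightarrow> (real \<Rightarrow> 'a cw_point) set" where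
  "loop_class p a b = path_class X2 (path_join (path_join (connector a) p) (reverse_path (connector
      b)))"

definition vertex_path :: "(real \<Rightarrow> 'a cw_point) \<Rightarrow> 'a \<Rightarrow> 'a \<Rightarrow> bool" where
  "vertex_path p a b \<longleftrightarrow> a \<in> Obj C \<and> b \<in> Obj C \<and> pathin X2 p \<and> p 0 = CW_vertex a \<and> p 1 = CW_vertex b"

section \<open>Loops obtained from paths between vertices\<close>

lemma connector_walk: "x \<in> Obj C \<Longrightarrow> is_walk C x (u x) c0"
  using connectors by (simp add: connectors_def)

lemma connector:
  assumes "x \<in> Obj C"
  shows "pathin X2 (connector x)" "connector x 0 = CW_vertex c0" "connector x 1 = CW_vertex x"
  using pathin_walk_path[OF connector_walk[OF assms]] pathin_Inl by (simp_all add: CW_vertex_def)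

lemma connector_base: "connector c0 = (\<lambda>_. CW_vertex c0)"
  using connectors by (simp add: connectors_def walk_path_single virtual_path_simps edge_path_eq
      CW_vertex_def fun_eq_iff)

lemma vertex_in_topspace: "x \<in> Obj C \<Longrightarrow> CW_vertex x \<in> topspace X2"
  by (simp add: CW_vertex_def topspace_CW topspace_one_skeleton)

lemma group_G: "Group.group G"
  by (rule fundamental_group_is_group[OF vertex_in_topspace[OF base]])

lemma vertex_path_loop:
  assumes "vertex_path p a b"
  shows "path_join (path_join (connector a) p) (reverse_path (connector b)) \<in> loops_at X2 (CW_vertex
      c0)"
  using assms connector[of a] connector[of b]
  by (auto simp: vertex_path_def loops_at_def intro!: pathin_path_join pathin_reverse)

lemma loop_class_closed: "vertex_path p a b \<Longrightarrow> loop_class p a b \<in> carrier G"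
  using vertex_path_loop by (simp add: loop_class_def fundamental_group_carrier)

lemma loop_class_homotopic:
  assumes "vertex_path p a b" "path_homotopic X2 p q"
  shows "loop_class p a b = loop_class q a b"
  unfolding loop_class_def using assms connector[of a] connector[of b]
  by (intro path_class_eq path_homotopic_join path_homotopic_refl pathin_reverse)
      (auto simp: vertex_path_def)

lemma vertex_path_join: "vertex_path p a b \<Longrightarrow> vertex_path q b c \<Longrightarrow> vertex_path (path_join p q) a c"
  by (auto simp: vertex_path_def pathin_path_join)

lemma vertex_path_reverse: "vertex_path p a b \<Longrightarrow> vertex_path (reverse_path p) b a"
  by (auto simp: vertex_path_def pathin_reverse)

lemma vertex_path_const: "a \<in> Obj C \<Longrightarrow> vertex_path (\<lambda>_. CW_vertex a) a a"
  by (simp add: vertex_path_def vertex_in_topspace)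

text \<open>The connector of the middle vertex is traversed back and forth and cancels. The factors
  change order because products of classes are read from right to left.\<close>

lemma loop_class_join:
  assumes p: "vertex_path p a b" and q: "vertex_path q b c"
  shows "loop_class (path_join p q) a c = loop_class q b c \<otimes>\<^bsub>G\<^esub> loop_class p a b"
proof -
  let ?a = "connector a" and ?b = "connector b" and ?b' = "reverse_path (connector b)"
    and ?c' = "reverse_path (connector c)"
  have abc: "a \<in> Obj C" "b \<in> Obj C" "c \<in> Obj C"
    using p q by (auto simp: vertex_path_def)
  note con = connector[OF abc(1)] connector[OF abc(2)] connector[OF abc(3)]
  note pq = p[unfolded vertex_path_def] q[unfolded vertex_path_def]
  note paths = con pq pathin_reverse[OF con(4)] pathin_reverse[OF con(7)]
  have "path_homotopic X2 (path_join ?b' (path_join (path_join ?b q) ?c')) (path_join ?b' (path_join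
      ?b (path_join q ?c')))"
    using paths by (intro path_homotopic_join path_homotopic_refl path_homotopic_assoc) auto
  also have "path_homotopic X2 \<dots> (path_join (path_join ?b' ?b) (path_join q ?c'))"
    using paths by (intro path_homotopic_sym[OF path_homotopic_assoc] pathin_path_join) auto
  also have "path_homotopic X2 \<dots> (path_join (\<lambda>_. ?b 1) (path_join q ?c'))"
    using paths by (intro path_homotopic_join path_homotopic_reverse_join
        path_homotopic_refl pathin_path_join) auto
  also have "path_homotopic X2 \<dots> (path_join q ?c')"
    using paths path_homotopic_const_join[of X2 "path_join q ?c'"] by (simp add: pathin_path_join)
  finally have *: "path_homotopic X2 (path_join ?b' (path_join (path_join ?b q) ?c')) (path_join q
      ?c')" .
  have "path_homotopic X2 (path_join (path_join (path_join ?a p) ?b') (path_join (path_join ?b q) ?c'))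
      (path_join (path_join ?a p) (path_join ?b' (path_join (path_join ?b q) ?c')))"
    using paths by (intro path_homotopic_assoc pathin_path_join) auto
  also have "path_homotopic X2 \<dots> (path_join (path_join ?a p) (path_join q ?c'))"
    using paths by (intro path_homotopic_join path_homotopic_refl * pathin_path_join) auto
  also have "path_homotopic X2 \<dots> (path_join (path_join (path_join ?a p) q) ?c')"
    using paths by (intro path_homotopic_sym[OF path_homotopic_assoc] pathin_path_join) auto
  also have "path_homotopic X2 \<dots> (path_join (path_join ?a (path_join p q)) ?c')"
    using paths by (intro path_homotopic_join path_homotopic_assoc path_homotopic_refl) auto
  finally have **: "path_homotopic X2 (path_join (path_join (path_join ?a p) ?b') (path_join
      (path_join ?b q) ?c'))
      (path_join (path_join ?a (path_join p q)) ?c')" .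
  show ?thesis
    using path_class_eq[OF **] fundamental_group_mult[OF vertex_path_loop[OF q] vertex_path_loop[OF p]]
    by (simp add: loop_class_def)
qed

lemma loop_class_const:
  assumes "a \<in> Obj C"
  shows "loop_class (\<lambda>_. CW_vertex a) a a = \<one>\<^bsub>G\<^esub>"
proof -
  note con = connector[OF assms]
  have "path_homotopic X2 (path_join (path_join (connector a) (\<lambda>_. CW_vertex a)) (reverse_path
      (connector a)))
      (path_join (connector a) (reverse_path (connector a)))"
    using con path_homotopic_join_const[OF con(1)]
    by (intro path_homotopic_join path_homotopic_refl pathin_reverse) simp_all
  also have "path_homotopic X2 \<dots> (\<lambda>_. connector a 0)"
    by (rule path_homotopic_join_reverse[OF con(1)])
  finally show ?thesis
    unfolding loop_class_def fundamental_group_one using con by (simp add: path_class_eq)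
qed

lemma loop_class_reverse:
  assumes p: "vertex_path p a b"
  shows "loop_class (reverse_path p) b a \<otimes>\<^bsub>G\<^esub> loop_class p a b = \<one>\<^bsub>G\<^esub>"
proof -
  have "path_homotopic X2 (path_join p (reverse_path p)) (\<lambda>_. CW_vertex a)"
    using p path_homotopic_join_reverse[of X2 p] by (simp add: vertex_path_def)
  from loop_class_homotopic[OF vertex_path_join[OF p vertex_path_reverse[OF p]] this] show ?thesis
    using p by (simp add: loop_class_join[OF p vertex_path_reverse[OF p]] loop_class_const
        vertex_path_def)
qed

lemma loop_class_base:
  assumes "p \<in> loops_at X2 (CW_vertex c0)"
  shows "loop_class p c0 c0 = path_class X2 p"
proof -
  have p: "pathin X2 p" "p 0 = CW_vertex c0" "p 1 = CW_vertex c0"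
    using assms by (auto simp: loops_at_def)
  have rev: "reverse_path (\<lambda>_. CW_vertex c0) = (\<lambda>_. CW_vertex c0)"
    by (simp add: reverse_path_def fun_eq_iff)
  have "path_homotopic X2 (path_join (path_join (\<lambda>_. CW_vertex c0) p) (\<lambda>_. CW_vertex c0)) (path_join
      p (\<lambda>_. CW_vertex c0))"
    using p path_homotopic_const_join[OF p(1)] vertex_in_topspace[OF base]
    by (intro path_homotopic_join path_homotopic_refl) simp_all
  also have "path_homotopic X2 \<dots> p"
    using p path_homotopic_join_const[OF p(1)] by simp
  finally show ?thesis
    unfolding loop_class_def connector_base rev by (rule path_class_eq)
qed

section \<open>Degrees of edges and their relations\<close>

abbreviation edge :: "'a \<Rightarrow> 'a \<Rightarrow> real \<Rightarrow> 'a cw_point" where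
  "edge y x \<equiv> Inl \<circ> edge_path y x"

definition degree :: "'a \<Rightarrow> 'a \<Rightarrow> (real \<Rightarrow> 'a cw_point) set" where
  "degree y x = walk_class C e (walk_inverse (u y) @ [Pos y (e y x) x] @ u x)"

lemma edge_path_same: "edge_path x x = (\<lambda>_. Inl x)"
  by (simp add: edge_path_eq)

lemma edge_path_ends [simp]: "edge_path y x 0 = Inl x" "edge_path y x 1 = Inl y"
  by (simp_all add: edge_path_eq edge_point_simps)

lemma vertex_path_edge:
  "x \<in> Obj C \<Longrightarrow> y \<in> Obj C \<Longrightarrow> nonzero_Mor C y x \<Longrightarrow> vertex_path (edge y x) x y"
  by (simp add: vertex_path_def pathin_Inl pathin_edge_path CW_vertex_def)

text \<open>Replaces the path of a concatenated walk, with its uniform subdivision, by a join of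
  paths. The homotopy already exists in the one-skeleton.\<close>

lemma degree_eq:
  assumes "x \<in> Obj C" "y \<in> Obj C" "nonzero_Mor C y x"
  shows "degree y x = loop_class (edge y x) x y"
proof -
  let ?ux = "walk_path (u x)" and ?uy = "walk_path (u y)"
  have e: "is_walk C y [Pos y (e y x) x] x"
    using assms by (auto simp: is_walk_single basis_in)
  note ux = connector_walk[OF assms(1)] and uy = walk_inverse[OF connector_walk[OF assms(2)]]
  note paths = pathin_walk_path[OF ux] pathin_walk_path[OF connector_walk[OF assms(2)]]
      pathin_edge_path[OF assms]
  have "path_homotopic X1 (path_join (path_join ?ux (edge_path y x)) (reverse_path ?uy))
      (path_join (walk_path ([Pos y (e y x) x] @ u x)) (walk_path (walk_inverse (u y))))"
    using walk_path_append[OF e ux] uy paths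
    by (intro path_homotopic_join) (auto simp: walk_path_single virtual_path_simps)
  also have "path_homotopic X1 \<dots> (walk_path (walk_inverse (u y) @ ([Pos y (e y x) x] @ u x)))"
    by (rule walk_path_append[OF uy(1) is_walk_append[OF e ux]])
  finally have "path_homotopic X2 (Inl \<circ> path_join (path_join ?ux (edge_path y x)) (reverse_path ?uy))
      (Inl \<circ> walk_path (walk_inverse (u y) @ ([Pos y (e y x) x] @ u x)))"
    by (rule path_homotopic_Inl)
  from path_class_eq[OF this] show ?thesis
    unfolding degree_def walk_class_def loop_class_def path_join_compose reverse_path_compose
    by (simp add: o_def)
qed

text \<open>If \<open>x = y\<close> or \<open>y = z\<close>, one of the two edges is a constant
  path. Otherwise the non-zero composite supplies a 2-cell, a digon if \<open>z = x\<close> and a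
  triangle if the three objects are distinct.\<close>

lemma edge_relation:
  assumes obj: "x \<in> Obj C" "y \<in> Obj C" "z \<in> Obj C"
    and nz: "nonzero_Mor C y x" "nonzero_Mor C z y" "nonzero_Mor C z x"
    and comp: "Comp C z y x (e z y) (e y x) \<noteq> \<zero>\<^bsub>Mor C z x\<^esub>"
  shows "path_homotopic X2 (path_join (edge y x) (edge z y)) (edge z x)"
proof -
  note edges = pathin_edge_path[OF obj(1,2) nz(1)] pathin_edge_path[OF obj(2,3) nz(2)]
    pathin_edge_path[OF obj(1,3) nz(3)]
  note edges' = edges[THEN pathin_Inl]
  consider "x = y" | "y = z" | "x \<noteq> y" "y \<noteq> z" "x = z" | "x \<noteq> y" "y \<noteq> z" "x \<noteq> z"
    by blast
  then show ?thesis
  proof cases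
    case 1
    then show ?thesis
      using path_homotopic_const_join[OF edges'(2)] by (simp add: edge_path_same o_def)
  next
    case 2
    then show ?thesis
      using path_homotopic_join_const[OF edges'(1)] by (simp add: edge_path_same o_def)
  next
    case 3
    then have "Digon {x, y} \<in> faces C e"
      using obj nz comp unfolding faces_def by blast
    \<comment> \<open>The boundary of the digon may start at either of its vertices, so
      \<open>a\<close> can be \<open>x\<close> or \<open>y\<close>.\<close>
    moreover from this obtain a b where ab: "{x, y} = {a, b}" "(b, a) \<in> edges C" "(a, b) \<in> edges C"
      "face_boundary e (Digon {x, y}) = [Pos a (e a b) b, Pos b (e b a) a]"
          "face_base (Digon {x, y}) = a"
    proof (cases rule: faceE)
      case (triangle a b c)
      then show thesis by simp
    next
      case (digon a b)
      then show thesis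
        using that[of a b] by simp
    qed
    ultimately have null: "path_homotopic X2 (Inl \<circ> walk_path [Pos a (e a b) b, Pos b (e b a) a])
        (\<lambda>_. Inl (Inl a))"
      using boundary_null_homotopic by metis
    have obj_ab: "a \<in> Obj C" "b \<in> Obj C" "nonzero_Mor C b a" "nonzero_Mor C a b"
      using ab by (auto simp: edges_iff)
    have walks: "is_walk C a [Pos a (e a b) b] b" "is_walk C b [Pos b (e b a) a] a"
      using obj_ab by (auto simp: is_walk_single basis_in)
    have "path_homotopic X2 (path_join (edge b a) (edge a b)) (Inl \<circ> walk_path [Pos a (e a b) b, Pos
        b (e b a) a])"
      using path_homotopic_Inl[OF walk_path_append[OF walks]]
      by (simp add: walk_path_single virtual_path_simps path_join_compose)
    from path_homotopic_trans[OF this null]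
    have ba: "path_homotopic X2 (path_join (edge b a) (edge a b)) (\<lambda>_. Inl (Inl a))" .
    have e_ab: "pathin X2 (edge a b)" "pathin X2 (edge b a)"
      using obj_ab by (auto intro!: pathin_Inl pathin_edge_path)
    \<comment> \<open>The single 2-cell contracts the round trip based at \<open>a\<close>. Reading
      this as an equality between one edge and the reverse of the other contracts the round trip
      based at \<open>b\<close> as well.\<close>
    have "path_homotopic X2 (edge b a) (reverse_path (edge a b))"
    proof (rule path_homotopic_cancel[OF e_ab(2) pathin_reverse[OF e_ab(1)]])
      show "path_homotopic X2 (path_join (edge b a) (reverse_path (reverse_path (edge a b)))) (\<lambda>_.
          edge b a 0)"
        using ba by simp
    qed simp
    then have "path_homotopic X2 (path_join (edge a b) (edge b a)) (path_join (edge a b)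
        (reverse_path (edge a b)))"
      using e_ab by (intro path_homotopic_join path_homotopic_refl) auto
    also have "path_homotopic X2 \<dots> (\<lambda>_. edge a b 0)"
      by (rule path_homotopic_join_reverse[OF e_ab(1)])
    finally have ab': "path_homotopic X2 (path_join (edge a b) (edge b a)) (\<lambda>_. Inl (Inl b))"
      by simp
    have "edge z x = (\<lambda>_. Inl (Inl x))"
      using 3 by (simp add: edge_path_eq o_def)
    moreover have "x = a \<and> y = b \<or> x = b \<and> y = a"
      using ab(1) by (auto simp: doubleton_eq_iff)
    ultimately show ?thesis
      using ba ab' 3 by auto
  next
    case 4
    then have F: "Triangle x y z \<in> faces C e"
      using obj nz comp unfolding faces_def by blast
    have walks: "is_walk C x [Neg z (e z x) x] z" "is_walk C z [Pos z (e z y) y] y"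
        "is_walk C y [Pos y (e y x) x] x"
      using obj nz by (auto simp: is_walk_single basis_in)
    have "path_homotopic X1 (path_join (path_join (edge_path y x) (edge_path z y)) (reverse_path
        (edge_path z x)))
        (path_join (walk_path ([Pos z (e z y) y] @ [Pos y (e y x) x])) (walk_path [Neg z (e z x) x]))"
      using walk_path_append[OF walks(2,3)] edges
      by (intro path_homotopic_join) (auto simp: walk_path_single virtual_path_simps intro:
          path_homotopic_refl pathin_reverse)
    also have "path_homotopic X1 \<dots> (walk_path (face_boundary e (Triangle x y z)))"
      using walk_path_append[OF walks(1) is_walk_append[OF walks(2,3)]] by simp
    finally have "path_homotopic X2 (Inl \<circ> (path_join (path_join (edge_path y x) (edge_path z y))
        (reverse_path (edge_path z x))))
        (Inl \<circ> walk_path (face_boundary e (Triangle x y z)))"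
      by (rule path_homotopic_Inl)
    also have "path_homotopic X2 \<dots> (\<lambda>_. Inl (Inl x))"
      using boundary_null_homotopic[OF F] by simp
    finally have "path_homotopic X2 (path_join (path_join (edge y x) (edge z y)) (reverse_path (edge
        z x))) (\<lambda>_. Inl (Inl x))"
      by (simp only: path_join_compose reverse_path_compose)
    then show ?thesis
      by (intro path_homotopic_cancel[OF pathin_path_join[OF edges'(1,2)] edges'(3)]) simp_all
  qed
qed

lemma degree_closed: "x \<in> Obj C \<Longrightarrow> y \<in> Obj C \<Longrightarrow> nonzero_Mor C y x \<Longrightarrow> degree y x \<in> carrier G"
  by (simp add: degree_eq loop_class_closed vertex_path_edge)

lemma degree_mult:
  assumes "x \<in> Obj C" "y \<in> Obj C" "z \<in> Obj C"
    and "nonzero_Mor C y x" "nonzero_Mor C z y" "nonzero_Mor C z x"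
    and "Comp C z y x (e z y) (e y x) \<noteq> \<zero>\<^bsub>Mor C z x\<^esub>"
  shows "degree z y \<otimes>\<^bsub>G\<^esub> degree y x = degree z x"
  using assms loop_class_homotopic[OF vertex_path_join edge_relation[OF assms], of x y z]
  by (simp add: degree_eq vertex_path_edge loop_class_join[symmetric])

text \<open>The values of \<open>\<xi>\<close> telescope: on a path from \<open>a\<close> to
  \<open>b\<close> the value is \<open>\<alpha> b \<ominus> \<alpha> a\<close>, a property stable
  under joins, reversed edges and homotopy. Every class is that of a loop in the one-skeleton, where
  both ends are \<open>c0\<close>, so the value is zero.\<close>

lemma hom_trivial:
  assumes K: "abelian_group K" and \<xi>: "\<xi> \<in> hom G (add_monoid K)"
    and \<alpha>: "\<And>x. x \<in> Obj C \<Longrightarrow> \<alpha> x \<in> carrier K"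
    and edge_value: "\<And>x y. (y, x) \<in> edges C \<Longrightarrow> \<xi> (degree y x) = \<alpha> y \<ominus>\<^bsub>K\<^esub> \<alpha> x"
    and A: "A \<in> carrier G"
  shows "\<xi> A = \<zero>\<^bsub>K\<^esub>"
proof -
  interpret K: abelian_group K by (rule K)
  interpret G: group G by (rule group_G)
  have \<xi>_closed: "\<xi> B \<in> carrier K" if "B \<in> carrier G" for B
    using \<xi> that by (auto simp: hom_def)
  have \<xi>_mult: "\<xi> (B \<otimes>\<^bsub>G\<^esub> B') = \<xi> B \<oplus>\<^bsub>K\<^esub> \<xi> B'" if "B \<in> carrier G" "B' \<in> carrier G" for B B'
    using \<xi> that by (auto simp: hom_def)
  have \<xi>_one: "\<xi> \<one>\<^bsub>G\<^esub> = \<zero>\<^bsub>K\<^esub>"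
    using \<xi>_mult[of "\<one>\<^bsub>G\<^esub>" "\<one>\<^bsub>G\<^esub>"] \<xi>_closed[of "\<one>\<^bsub>G\<^esub>"] K.add.l_cancel_one by fastforce
  define \<G> where "\<G> = {q. pathin X1 q \<and> (\<exists>a b. vertex_path (Inl \<circ> q) a b \<and>
      \<xi> (loop_class (Inl \<circ> q) a b) = \<alpha> b \<ominus>\<^bsub>K\<^esub> \<alpha> a)}"
  obtain p where p: "A = path_class X2 p" "p \<in> loops_at X2 (CW_vertex c0)"
    using A by (auto simp: fundamental_group_carrier)
  then obtain q where q: "pathin X1 q" "path_homotopic X2 p (Inl \<circ> q)"
    using path_homotopic_to_skeleton[of p "Inl c0" "Inl c0"] by (auto simp: loops_at_def CW_vertex_def)
  have q': "q 0 = Inl c0" "q 1 = Inl c0"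
    using path_homotopic_imp_ends[OF q(2)] p(2) by (simp_all add: loops_at_def CW_vertex_def)
  have "q \<in> \<G>"
  proof (rule one_skeleton_path_in_class[OF _ _ _ _ _ _ q(1) q'])
    fix v assume v: "v \<in> Obj C"
    have eq: "Inl \<circ> (\<lambda>_. Inl v) = (\<lambda>_. CW_vertex v)"
      by (simp add: CW_vertex_def fun_eq_iff)
    have "\<xi> (loop_class (\<lambda>_. CW_vertex v) v v) = \<alpha> v \<ominus>\<^bsub>K\<^esub> \<alpha> v"
      using v \<alpha>[OF v] by (simp add: loop_class_const \<xi>_one a_minus_def K.r_neg)
    moreover have "pathin X1 (\<lambda>_. Inl v)"
      using v by (simp add: topspace_one_skeleton)
    ultimately show "(\<lambda>_. Inl v) \<in> \<G>"
      unfolding \<G>_def mem_Collect_eq eq using vertex_path_const[OF v] by blast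
  next
    fix x y assume yx: "(y, x) \<in> edges C"
    then have xy: "x \<in> Obj C" "y \<in> Obj C" "nonzero_Mor C y x"
      by (auto simp: edges_iff)
    have val: "\<xi> (loop_class (edge y x) x y) = \<alpha> y \<ominus>\<^bsub>K\<^esub> \<alpha> x"
      using edge_value[OF yx] degree_eq[OF xy] by simp
    then show "edge_path y x \<in> \<G>"
      using vertex_path_edge[OF xy] pathin_edge_path[OF xy] by (auto simp: \<G>_def)
    have rev: "Inl \<circ> reverse_path (edge_path y x) = reverse_path (edge y x)"
      by (rule reverse_path_compose)
    note ve = vertex_path_edge[OF xy]
    have closed: "\<xi> (loop_class (reverse_path (edge y x)) y x) \<in> carrier K"
      by (intro \<xi>_closed loop_class_closed vertex_path_reverse ve)
    have "\<xi> (loop_class (reverse_path (edge y x)) y x) \<oplus>\<^bsub>K\<^esub> (\<alpha> y \<ominus>\<^bsub>K\<^esub> \<alpha> x) = \<zero>\<^bsub>K\<^esub>"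
      using \<xi>_mult[OF loop_class_closed[OF vertex_path_reverse[OF ve]] loop_class_closed[OF ve]]
        loop_class_reverse[OF ve] val \<xi>_one by simp
    then have "\<xi> (loop_class (reverse_path (edge y x)) y x) = \<ominus>\<^bsub>K\<^esub> (\<alpha> y \<ominus>\<^bsub>K\<^esub> \<alpha> x)"
      using K.minus_equality closed \<alpha> xy by simp
    also have "\<dots> = \<alpha> x \<ominus>\<^bsub>K\<^esub> \<alpha> y"
      using \<alpha> xy by (simp add: a_minus_def K.minus_add K.a_comm)
    finally show "reverse_path (edge_path y x) \<in> \<G>"
      using vertex_path_reverse[OF ve] pathin_reverse[OF pathin_edge_path[OF xy]]
      unfolding \<G>_def mem_Collect_eq rev by blast
  next
    fix q r assume "q \<in> \<G>" "r \<in> \<G>" and qr: "q 1 = r 0"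
    then obtain a b b' c where q: "pathin X1 q" "vertex_path (Inl \<circ> q) a b"
        "\<xi> (loop_class (Inl \<circ> q) a b) = \<alpha> b \<ominus>\<^bsub>K\<^esub> \<alpha> a"
      and r: "pathin X1 r" "vertex_path (Inl \<circ> r) b' c" "\<xi> (loop_class (Inl \<circ> r) b' c) = \<alpha> c \<ominus>\<^bsub>K\<^esub> \<alpha> b'"
      by (auto simp: \<G>_def)
    have [simp]: "b' = b"
      using q(2) r(2) qr by (simp add: vertex_path_def CW_vertex_def)
    have obj: "a \<in> Obj C" "b \<in> Obj C" "c \<in> Obj C"
      using q(2) r(2) by (auto simp: vertex_path_def)
    have "\<xi> (loop_class (Inl \<circ> path_join q r) a c) = (\<alpha> c \<ominus>\<^bsub>K\<^esub> \<alpha> b) \<oplus>\<^bsub>K\<^esub> (\<alpha> b \<ominus>\<^bsub>K\<^esub> \<alpha> a)"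
      using q r loop_class_join[of "Inl \<circ> q" a b "Inl \<circ> r" c]
      by (simp add: path_join_compose \<xi>_mult loop_class_closed)
    also have "\<dots> = \<alpha> c \<ominus>\<^bsub>K\<^esub> \<alpha> a"
      using \<alpha>[OF obj(1)] \<alpha>[OF obj(2)] \<alpha>[OF obj(3)] by (simp add: a_minus_def K.a_assoc K.r_neg1)
    finally show "path_join q r \<in> \<G>"
      using vertex_path_join[OF q(2), of "Inl \<circ> r" c] r(2) pathin_path_join[OF q(1) r(1) qr]
      by (auto simp: \<G>_def path_join_compose)
  next
    fix q r assume q: "q \<in> \<G>" and qr: "path_homotopic X1 q r"
    then obtain a b where ab: "vertex_path (Inl \<circ> q) a b" "\<xi> (loop_class (Inl \<circ> q) a b) = \<alpha> b \<ominus>\<^bsub>K\<^esub> \<alpha> a"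
      by (auto simp: \<G>_def)
    have "vertex_path (Inl \<circ> r) a b"
      using ab(1) path_homotopic_imp_ends[OF qr] path_homotopic_imp_pathin[OF path_homotopic_Inl[OF qr]]
      by (simp add: vertex_path_def)
    with ab loop_class_homotopic[OF ab(1) path_homotopic_Inl[OF qr]] path_homotopic_imp_pathin[OF qr]
    show "r \<in> \<G>"
      unfolding \<G>_def by auto
  qed (simp add: \<G>_def)
  then obtain a b where ab: "vertex_path (Inl \<circ> q) a b" "\<xi> (loop_class (Inl \<circ> q) a b) = \<alpha> b \<ominus>\<^bsub>K\<^esub> \<alpha> a"
    by (auto simp: \<G>_def)
  have "a = c0" "b = c0"
    using ab(1) q' by (auto simp: vertex_path_def CW_vertex_def)
  moreover have "\<alpha> c0 \<ominus>\<^bsub>K\<^esub> \<alpha> c0 = \<zero>\<^bsub>K\<^esub>"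
    using \<alpha>[OF base] by (simp add: a_minus_def K.r_neg)
  moreover have "A = loop_class (Inl \<circ> q) c0 c0"
    using p q loop_class_base[OF p(2)] loop_class_homotopic[OF _ q(2), of c0 c0] base
    by (simp add: vertex_path_def loops_at_def)
  ultimately show ?thesis
    using ab by simp
qed

end

section \<open>Homomorphisms from cocycles on the edges\<close>

fun skeleton_base :: "'o skeleton_point \<Rightarrow> 'o" where
  "skeleton_base (Inl v) = v" |
  "skeleton_base (Inr ((y, x), t)) = x"

text \<open>One reference vertex for each open cell: the vertex itself, the source of an edge, the
  start of the boundary walk of a face. It is constant on open cells and jumps only between
  them.\<close>

fun cell_base :: "'o cw_point \<Rightarrow> 'o" where
  "cell_base (Inl q) = skeleton_base q" |
  "cell_base (Inr (F, z)) = face_base F"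

lemma skeleton_base_edge_point: "t \<in> {0..<1} \<Longrightarrow> skeleton_base (edge_point (y, x) t) = x"
  by (cases "t = 0") (auto simp: edge_point_simps)

text \<open>Radial projection sends the points of a face into its boundary walk, so only the two or
  three edges occurring there can be met.\<close>

lemma (in cw_complex) radial_in_open_edge:
  assumes F: "F \<in> faces C e" and "face_attach e F z \<in> open_edge (y, x)"
  shows "\<exists>f. Pos y f x \<in> set (face_boundary e F) \<or> Neg y f x \<in> set (face_boundary e F)"
proof -
  have "face_boundary e F \<noteq> []"
    using boundary_walk[OF F] by (simp add: is_walk_def)
  moreover have "Arg2pi z / (2 * pi) \<in> {0..1}"
    using Arg2pi[of z] by auto
  ultimately obtain v s where v: "v \<in> set (face_boundary e F)" "s \<in> {0..1}" "face_attach e F z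
      = virtual_path v s"
    using walk_path_in_virtual_paths by (metis face_attach_def)
  have "b = y \<and> a = x" if "edge_path b a t \<in> open_edge (y, x)" "t \<in> {0..1}" for b a t
    using that edge_point_in_open_edge_iff[of t "(b, a)" "(y, x)"]
    by (auto simp: edge_path_eq open_edge_def split: if_splits)
  note edge = this
  show ?thesis
  proof (cases v)
    case (Pos b f a)
    then have "b = y \<and> a = x"
      using edge[of b a s] v assms(2) by simp
    with Pos v show ?thesis by blast
  next
    case (Neg b f a)
    then have "b = y \<and> a = x"
      using edge[of b a "1 - s"] v assms(2) by simp
    with Neg v show ?thesis by blast
  qed
qed

locale edge_cocycle = based_cw_complex + abelian_group K for K :: "('k, 'r) ring_scheme" (structure) +
  fixes \<mu> :: "'a \<Rightarrow> 'a \<Rightarrow> 'k"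
  assumes \<mu>_closed [simp]: "\<mu> y x \<in> carrier K"
    and \<mu>_same: "\<mu> x x = \<zero>"
    and \<mu>_cocycle: "\<lbrakk>x \<in> Obj C; y \<in> Obj C; z \<in> Obj C; nonzero_Mor C y x; nonzero_Mor C z y;
        Comp C z y x (e z y) (e y x) \<noteq> \<zero>\<^bsub>Mor C z x\<^esub>\<rbrakk> \<Longrightarrow> \<mu> z x = \<mu> z y \<oplus> \<mu> y x"
begin

lemma minus_zero_right: "a \<in> carrier K \<Longrightarrow> a \<ominus> \<zero> = a"
  using r_neg[of \<zero>] by (simp add: a_minus_def)

lemma minus_swap: "a \<in> carrier K \<Longrightarrow> b \<in> carrier K \<Longrightarrow> a \<ominus> b = \<ominus> (b \<ominus> a)"
  by (simp add: a_minus_def minus_add a_comm)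

lemma add_minus_cancel: "a \<in> carrier K \<Longrightarrow> b \<in> carrier K \<Longrightarrow> (a \<oplus> b) \<ominus> b = a"
  by (simp add: a_minus_def a_assoc r_neg)

lemma \<mu>_opposite:
  assumes "(y, x) \<in> edges C" "(x, y) \<in> edges C"
    "Comp C x y x (e x y) (e y x) \<noteq> \<zero>\<^bsub>Mor C x x\<^esub> \<or> Comp C y x y (e y x) (e x y) \<noteq> \<zero>\<^bsub>Mor C y y\<^esub>"
  shows "\<zero> \<ominus> \<mu> y x = \<mu> x y"
proof -
  have "\<mu> x y \<oplus> \<mu> y x = \<zero>"
    using \<mu>_cocycle[of x y x] \<mu>_cocycle[of y x y] assms
    by (auto simp: edges_iff \<mu>_same a_comm)
  from add_minus_cancel[OF \<mu>_closed \<mu>_closed, of x y y x] this show ?thesis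
    by simp
qed

text \<open>The cocycle condition on a face says that \<open>\<mu>\<close>, restricted to the
  boundary edges, has a potential: the value of \<open>\<mu>\<close> from the base vertex of the
  face. Edges starting at the base are immediate; the edge opposite to it, or the returning edge of
  a digon, uses the relation of the face.\<close>

lemma \<mu>_face_boundary:
  assumes F: "F \<in> faces C e" and v: "Pos y f x \<in> set (face_boundary e F) \<or> Neg y f x \<in> set
      (face_boundary e F)"
  shows "\<mu> y (face_base F) \<ominus> \<mu> x (face_base F) = \<mu> y x"
  using F
proof (cases rule: faceE)
  case (triangle a b c)
  have "\<mu> c a = \<mu> c b \<oplus> \<mu> b a"
    using triangle by (intro \<mu>_cocycle) (auto simp: edges_iff)
  moreover have "(y, x) \<in> {(c, a), (c, b), (b, a)}"
    using v unfolding triangle(5) by auto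
  ultimately show ?thesis
    using triangle(6) by (auto simp: \<mu>_same minus_zero_right add_minus_cancel)
next
  case (digon a b)
  have "(y, x) \<in> {(a, b), (b, a)}"
    using v unfolding digon(4) by auto
  then show ?thesis
    using digon(5) \<mu>_opposite[OF digon(2,3,6)] by (auto simp: \<mu>_same minus_zero_right)
qed

text \<open>The region that retracts onto one open edge consists of that edge and of parts of faces
  having it in their boundary. The two chart values differ by the same amount in all of these cells,
  although their reference vertices vary.\<close>

lemma \<mu>_edge_difference:
  assumes "(y, x) \<in> edges C" "p \<in> punctured" "radial p \<in> open_edge (y, x)"
  shows "\<mu> y (cell_base p) \<ominus> \<mu> x (cell_base p) = \<mu> y x"
proof (cases p)
  case (Inl q)
  then have "cell_base p = x"
    using assms(3) by (auto simp: open_edge_def)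
  then show ?thesis
    by (simp add: \<mu>_same minus_zero_right)
next
  case (Inr r)
  then obtain F z where Fz: "p = Inr (F, z)" "F \<in> faces C e"
    using assms(2) by (auto simp: punctured_def)
  then show ?thesis
    using radial_in_open_edge[OF Fz(2), of "sgn z" y x] assms(3) \<mu>_face_boundary by auto
qed

text \<open>The stars of the skeleton are thickened by pulling them back along the radial
  retraction; the charts of faces are there to cover the centres.\<close>

fun chart_domain :: "'a + 'a face \<Rightarrow> 'a cw_point set" where
  "chart_domain (Inl v) = {p \<in> punctured. radial p \<in> open_star C v}" |
  "chart_domain (Inr F) = open_face F"

text \<open>
  The fibre over a point is identified with the fibre over the base vertex of its cell, and
  transported from there to the chart's own vertex.
\<close>

fun chart :: "'a + 'a face \<Rightarrow> 'a cw_point \<Rightarrow> 'k" where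
  "chart (Inl v) p = \<mu> v (cell_base p)" |
  "chart (Inr F) p = \<zero>"

lemma openin_radial_preimage:
  assumes "openin X1 V"
  shows "openin X2 {p \<in> punctured. radial p \<in> V}"
proof -
  have "topspace (subtopology X2 punctured) = punctured"
    using openin_subset[OF openin_punctured] by auto
  then show ?thesis
    using openin_continuous_map_preimage[OF continuous_map_radial assms] openin_trans_full[OF _
        openin_punctured]
    by auto
qed

text \<open>If one chart is a face, then near \<open>x\<close> everything happens in one open cell,
  where all charts are constant. Two stars of distinct vertices overlap only over open edges joining
  these, and over one such edge the difference is constant by
  \<open>\<mu>_edge_difference\<close>.\<close>

lemma chart_difference:
  assumes i: "i \<in> Inl ` Obj C \<union> Inr ` faces C e" and j: "j \<in> Inl ` Obj C \<union> Inr ` faces C e"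
    and x: "x \<in> chart_domain i" "x \<in> chart_domain j"
  shows "\<exists>N. openin X2 N \<and> x \<in> N \<and>
    (\<forall>y\<in>N \<inter> chart_domain i \<inter> chart_domain j. chart i y \<ominus> chart j y = chart i x \<ominus> chart j x)"
proof (cases "\<exists>F. i = Inr F \<or> j = Inr F")
  case True
  then obtain F where F: "F \<in> faces C e" "x \<in> open_face F"
    using i j x by auto
  have const: "chart k y = chart k x" if "y \<in> open_face F" for k y
    using that F(2) by (cases k) (auto simp: open_face_def)
  have "chart i y \<ominus> chart j y = chart i x \<ominus> chart j x" if "y \<in> open_face F" for y
    using const[OF that, of i] const[OF that, of j] by simp
  with openin_open_face[OF F(1)] F(2) show ?thesis
    by blast
next
  case False
  then obtain v w where vw: "i = Inl v" "j = Inl w" "v \<in> Obj C" "w \<in> Obj C"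
    using i j by auto
  have px: "x \<in> punctured" "radial x \<in> open_star C v" "radial x \<in> open_star C w"
    using x vw by auto
  show ?thesis
  proof (cases "v = w")
    case True
    have "chart i y \<ominus> chart j y = chart i x \<ominus> chart j x" for y
      using True vw r_neg by (simp add: a_minus_def)
    then show ?thesis
      using px openin_punctured by blast
  next
    case False
    then obtain a b t where ab: "(b, a) \<in> edges C" "v = a \<and> w = b \<or> v = b \<and> w = a"
      "radial x = Inr ((b, a), t)" "0 < t" "t < 1"
      using px by (auto simp: open_star_def)
    \<comment> \<open>Two edges of opposite directions may join the same vertices, with different
      values of the difference, so the neighbourhood is restricted to the part over one of
      them.\<close>
    define N where "N = {p \<in> punctured. radial p \<in> open_edge (b, a)}"
    have "openin X2 N"
      unfolding N_def by (intro openin_radial_preimage openin_open_edge ab)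
    moreover have xN: "x \<in> N"
      using ab px by (simp add: N_def open_edge_def)
    moreover have "chart i y \<ominus> chart j y = chart i x \<ominus> chart j x" if y: "y \<in> N" for y
    proof -
      have "\<mu> b (cell_base y) \<ominus> \<mu> a (cell_base y) = \<mu> b (cell_base x) \<ominus> \<mu> a (cell_base x)"
        using \<mu>_edge_difference[OF ab(1)] y xN by (simp add: N_def)
      with ab(2) vw show ?thesis
        using minus_swap[of "\<mu> a (cell_base y)" "\<mu> b (cell_base y)"]
          minus_swap[of "\<mu> a (cell_base x)" "\<mu> b (cell_base x)"] by auto
    qed
    ultimately show ?thesis
      by blast
  qed
qed

sublocale atlas: additive_atlas K X2 "Inl ` Obj C \<union> Inr ` faces C e" chart_domain chart
proof
  show "openin X2 (chart_domain i)" if "i \<in> Inl ` Obj C \<union> Inr ` faces C e" for i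
    using that openin_radial_preimage[OF openin_open_star] openin_open_face by auto
  show "topspace X2 \<subseteq> (\<Union>i\<in>Inl ` Obj C \<union> Inr ` faces C e. chart_domain i)"
  proof
    fix p assume p: "p \<in> topspace X2"
    show "p \<in> (\<Union>i\<in>Inl ` Obj C \<union> Inr ` faces C e. chart_domain i)"
    proof (cases p)
      case (Inl q)
      then have q: "q \<in> topspace X1"
        using p by (auto simp: topspace_CW)
      then obtain v where "v \<in> Obj C" "q \<in> open_star C v"
        by (auto simp: topspace_one_skeleton open_star_def edges_iff)
      then show ?thesis
        using Inl q by (auto simp: punctured_def)
    next
      case (Inr r)
      then show ?thesis
        using p by (auto simp: topspace_CW open_face_def)
    qed
  qed
  show "chart i p \<in> carrier K" for i p
    by (cases i) auto
qed (rule chart_difference)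

lemma path_integral_edge:
  assumes yx: "(y, x) \<in> edges C"
  shows "atlas.path_integral (edge y x) = \<mu> y x"
proof -
  \<comment> \<open>The jump of the lift at the end compensates for the jump of the reference vertex
    from \<open>x\<close> to \<open>y\<close>: in the chart at \<open>y\<close> the coordinate is
    \<open>\<zero> \<oplus> \<mu> y x\<close> before the end and
    \<open>\<mu> y x \<oplus> \<mu> y y\<close> at the end, and these are equal.\<close>
  define F where "F t = (if t < 1 then \<zero> else \<mu> y x)" for t :: real
  have xy: "x \<in> Obj C" "y \<in> Obj C" "x \<noteq> y" "nonzero_Mor C y x"
    using yx by (auto simp: edges_iff)
  have p: "pathin X2 (edge y x)"
    using xy by (intro pathin_Inl pathin_edge_path)
  have edge_eq: "edge_path y x = edge_point (y, x)"
    using xy by (simp add: edge_path_eq)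
  have dom: "edge y x t \<in> chart_domain (Inl v) \<longleftrightarrow> (v = x \<and> t < 1) \<or> (v = y \<and> t > 0)" if "t \<in> {0..1}"
      for t v
    using edge_point_in_open_star_iff[OF yx that] that continuous_map_funspace[OF
        continuous_map_edge_point[OF yx]]
    by (auto simp: edge_eq punctured_def)
  have base: "skeleton_base (edge_path y x t) = (if t < 1 then x else y)" if "t \<in> {0..1}" for t
    using that skeleton_base_edge_point[of t y x] by (auto simp: edge_eq edge_point_simps)
  have "atlas.lift {0..1} (edge y x) F"
  proof (rule atlas.liftI)
    show "continuous_map (top_of_set {0..1}) X2 (edge y x)"
      using p by (simp add: pathin_def)
    show "F t \<in> carrier K" for t
      by (simp add: F_def)
    fix t :: real assume t: "t \<in> {0..1}"
    define v where "v = (if t < 1 then x else y)"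
    define N where "N = {0..1::real} \<inter> (if t < 1 then {..<1} else {0<..})"
    have "openin (top_of_set {0..1}) N"
      unfolding N_def by (intro openin_open_Int) auto
    moreover have "t \<in> N"
      using t by (auto simp: N_def)
    moreover have "F s \<oplus> chart (Inl v) (edge y x s) = F t \<oplus> chart (Inl v) (edge y x t)" if "s \<in> N" for s
    proof -
      have "s \<in> {0..1}"
        using that by (auto simp: N_def)
      with t that show ?thesis
        by (auto simp: base F_def v_def N_def \<mu>_same split: if_splits)
    qed
    moreover have "edge y x t \<in> chart_domain (Inl v)"
      using dom[OF t, of v] t by (auto simp: v_def)
    moreover have "Inl v \<in> Inl ` Obj C \<union> Inr ` faces C e"
      using xy by (auto simp: v_def)
    ultimately show "\<exists>i\<in>Inl ` Obj C \<union> Inr ` faces C e. edge y x t \<in> chart_domain i \<and>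
        (\<exists>N. openin (top_of_set {0..1}) N \<and> t \<in> N \<and>
          (\<forall>s\<in>N. edge y x s \<in> chart_domain i \<longrightarrow>
            F s \<oplus> chart i (edge y x s) = F t \<oplus> chart i (edge y x t)))"
      by blast
  qed
  from atlas.path_integral_eq[OF p this] show ?thesis
    by (simp add: F_def minus_zero_right)
qed

section \<open>The homomorphism defined by a cocycle\<close>

definition character :: "(real \<Rightarrow> 'a cw_point) set \<Rightarrow> 'k" where
  "character A = atlas.path_integral (SOME p. p \<in> A)"

lemma character_path_class:
  assumes "pathin X2 p"
  shows "character (path_class X2 p) = atlas.path_integral p"
proof -
  have "(SOME q. q \<in> path_class X2 p) \<in> path_class X2 p"
    using path_class_self[OF assms] by (rule someI[where P = "\<lambda>q. q \<in> path_class X2 p"])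
  then have "path_homotopic X2 p (SOME q. q \<in> path_class X2 p)"
    by (simp add: path_class_def)
  from atlas.path_integral_homotopic[OF this] show ?thesis
    by (simp add: character_def)
qed

lemma character_hom: "character \<in> hom G (add_monoid K)"
proof (rule homI)
  fix A assume "A \<in> carrier G"
  then obtain p where p: "A = path_class X2 p" "p \<in> loops_at X2 (CW_vertex c0)"
    by (auto simp: fundamental_group_carrier)
  then have p': "pathin X2 p" "p 0 = CW_vertex c0" "p 1 = CW_vertex c0"
    by (auto simp: loops_at_def)
  show "character A \<in> carrier (add_monoid K)"
    using p p' by (simp add: character_path_class atlas.path_integral_closed)
  fix B assume "B \<in> carrier G"
  then obtain q where q: "B = path_class X2 q" "q \<in> loops_at X2 (CW_vertex c0)"
    by (auto simp: fundamental_group_carrier)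
  then have q': "pathin X2 q" "q 0 = CW_vertex c0" "q 1 = CW_vertex c0"
    by (auto simp: loops_at_def)
  show "character (A \<otimes>\<^bsub>G\<^esub> B) = character A \<otimes>\<^bsub>add_monoid K\<^esub> character B"
    using p p' q q' by (simp add: fundamental_group_mult character_path_class pathin_path_join
        atlas.path_integral_join atlas.path_integral_closed a_comm)
qed

text \<open>The degree is represented by the connector to \<open>x\<close>, the edge, and the
  connector to \<open>y\<close> backwards. The integrals over the connectors therefore survive as a
  coboundary added to \<open>\<mu>\<close>.\<close>

lemma character_degree:
  assumes "x \<in> Obj C" "y \<in> Obj C" "nonzero_Mor C y x"
  shows "character (degree y x) =
    atlas.path_integral (connector x) \<oplus> \<mu> y x \<ominus> atlas.path_integral (connector y)"
proof -
  have e: "pathin X2 (edge y x)"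
    using assms by (intro pathin_Inl pathin_edge_path)
  have val: "atlas.path_integral (edge y x) = \<mu> y x"
  proof (cases "x = y")
    case True
    then have "atlas.path_integral (edge y x) = \<zero>"
      using e by (intro atlas.path_integral_const) (auto simp: edge_path_same)
    with True show ?thesis
      by (simp add: \<mu>_same)
  next
    case False
    with assms show ?thesis
      by (intro path_integral_edge) (simp add: edges_iff)
  qed
  note con = connector[OF assms(1)] connector[OF assms(2)]
  note paths = con e val
  have "character (degree y x) = atlas.path_integral
      (path_join (path_join (connector x) (edge y x)) (reverse_path (connector y)))"
    using paths assms unfolding degree_eq[OF assms] loop_class_def
    by (intro character_path_class pathin_path_join pathin_reverse) (auto simp: CW_vertex_def)
  also have "\<dots> = atlas.path_integral (connector x) \<oplus> \<mu> y x \<oplus> \<ominus> atlas.path_integral (connector y)"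
  proof -
    have "atlas.path_integral (path_join (path_join (connector x) (edge y x)) (reverse_path
        (connector y))) =
        atlas.path_integral (path_join (connector x) (edge y x))
            \<oplus> atlas.path_integral (reverse_path (connector y))"
      using paths by (intro atlas.path_integral_join pathin_path_join pathin_reverse)
          (auto simp: CW_vertex_def)
    also have "atlas.path_integral (path_join (connector x) (edge y x))
        = atlas.path_integral (connector x) \<oplus> \<mu> y x"
      using paths by (subst atlas.path_integral_join) (auto simp: CW_vertex_def)
    also have "atlas.path_integral (reverse_path (connector y)) = \<ominus> atlas.path_integral (connector y)"
      by (rule atlas.path_integral_reverse[OF con(4)])
    finally show ?thesis .
  qed
  finally show ?thesis
    by (simp add: a_minus_def)
qed

end

section \<open>Quotients of modules\<close>

locale module_with_submodule = Module.module R M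
  for R :: "('a, 'r) ring_scheme" (structure) and M :: "('a, 'v) module" (structure) +
  fixes W assumes W: "submodule W R M"
begin

sublocale W: abelian_subgroup W M
  using W M.abelian_group_axioms
  by (intro abelian_subgroupI3 additive_subgroup.intro) (auto simp: submodule_def)

lemma quotient_carrier: "carrier (quotient_space M W) = (\<lambda>v. W +>\<^bsub>M\<^esub> v) ` carrier M"
  by (auto simp: quotient_space_def A_RCOSETS_def')

lemma coset_eq_iff:
  assumes "v \<in> carrier M" "w \<in> carrier M"
  shows "W +>\<^bsub>M\<^esub> v = W +>\<^bsub>M\<^esub> w \<longleftrightarrow> (\<exists>x\<in>W. w = x \<oplus>\<^bsub>M\<^esub> v)"
proof
  assume "W +>\<^bsub>M\<^esub> v = W +>\<^bsub>M\<^esub> w"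
  then have "w \<in> W +>\<^bsub>M\<^esub> v"
    using W.a_rcos_self assms by blast
  then show "\<exists>x\<in>W. w = x \<oplus>\<^bsub>M\<^esub> v"
    by (auto simp: a_r_coset_def')
next
  assume "\<exists>x\<in>W. w = x \<oplus>\<^bsub>M\<^esub> v"
  then have "w \<in> W +>\<^bsub>M\<^esub> v"
    by (auto simp: a_r_coset_def')
  then show "W +>\<^bsub>M\<^esub> v = W +>\<^bsub>M\<^esub> w"
    using M.a_repr_independence assms W.a_subgroup by blast
qed

lemma coset_eq_subspace_iff: "v \<in> carrier M \<Longrightarrow> W +>\<^bsub>M\<^esub> v = W \<longleftrightarrow> v \<in> W"
  using M.a_coset_join1 M.a_coset_join2 W.a_subgroup by blast

lemma quotient_add:
  "v \<in> carrier M \<Longrightarrow> w \<in> carrier M \<Longrightarrow>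
    (W +>\<^bsub>M\<^esub> v) \<oplus>\<^bsub>quotient_space M W\<^esub> (W +>\<^bsub>M\<^esub> w) = W +>\<^bsub>M\<^esub> (v \<oplus>\<^bsub>M\<^esub> w)"
  by (simp add: quotient_space_def W.a_rcos_sum)

lemma quotient_zero: "\<zero>\<^bsub>quotient_space M W\<^esub> = W +>\<^bsub>M\<^esub> \<zero>\<^bsub>M\<^esub>"
  using coset_eq_subspace_iff[of "\<zero>\<^bsub>M\<^esub>"] W.zero_closed by (simp add: quotient_space_def)

text \<open>The scalar multiple of a coset is a union over its representatives; all its members
  coincide because \<open>W\<close> is closed under scalars.\<close>

lemma quotient_smult:
  assumes a: "a \<in> carrier R" and v: "v \<in> carrier M"
  shows "a \<odot>\<^bsub>quotient_space M W\<^esub> (W +>\<^bsub>M\<^esub> v) = W +>\<^bsub>M\<^esub> (a \<odot>\<^bsub>M\<^esub> v)"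
proof -
  have "W +>\<^bsub>M\<^esub> (a \<odot>\<^bsub>M\<^esub> w) = W +>\<^bsub>M\<^esub> (a \<odot>\<^bsub>M\<^esub> v)" if w: "w \<in> W +>\<^bsub>M\<^esub> v" for w
  proof -
    obtain x where x: "x \<in> W" "w = x \<oplus>\<^bsub>M\<^esub> v"
      using w by (auto simp: a_r_coset_def')
    then have "x \<in> carrier M"
      using W.a_subset by blast
    moreover have "a \<odot>\<^bsub>M\<^esub> x \<in> W"
      using submodule.smult_closed[OF W a x(1)] .
    ultimately have "W +>\<^bsub>M\<^esub> (a \<odot>\<^bsub>M\<^esub> v) = W +>\<^bsub>M\<^esub> (a \<odot>\<^bsub>M\<^esub> w)"
      using x a v by (subst coset_eq_iff) (auto simp: smult_r_distr)
    then show ?thesis ..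
  qed
  moreover have "v \<in> W +>\<^bsub>M\<^esub> v"
    using W.a_rcos_self v by blast
  ultimately have "(\<Union>w\<in>W +>\<^bsub>M\<^esub> v. W +>\<^bsub>M\<^esub> (a \<odot>\<^bsub>M\<^esub> w)) = W +>\<^bsub>M\<^esub> (a \<odot>\<^bsub>M\<^esub> v)"
    by blast
  then show ?thesis
    by (simp add: quotient_space_def)
qed

lemma quotient_module: "Module.module R (quotient_space M W)"
proof (rule moduleI)
  let ?Q = "quotient_space M W"
  show "cring R" by (rule R.is_cring)
  show "abelian_group ?Q"
  proof (rule abelian_groupI)
    fix A assume "A \<in> carrier ?Q"
    then obtain v where v: "A = W +>\<^bsub>M\<^esub> v" "v \<in> carrier M"
      by (auto simp: quotient_carrier)
    show "\<exists>B\<in>carrier ?Q. B \<oplus>\<^bsub>?Q\<^esub> A = \<zero>\<^bsub>?Q\<^esub>"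
      using v by (intro bexI[of _ "W +>\<^bsub>M\<^esub> (\<ominus>\<^bsub>M\<^esub> v)"])
        (auto simp: quotient_carrier quotient_add quotient_zero M.l_neg)
  qed (auto simp: quotient_carrier quotient_add quotient_zero M.a_ac)
qed (auto simp: quotient_carrier quotient_add quotient_smult smult_l_distr smult_r_distr smult_assoc1)

end

lemma (in Module.module) smult_eq_zero_iff:
  assumes "Ring.field R" "a \<in> carrier R" "v \<in> carrier M"
  shows "a \<odot>\<^bsub>M\<^esub> v = \<zero>\<^bsub>M\<^esub> \<longleftrightarrow> a = \<zero> \<or> v = \<zero>\<^bsub>M\<^esub>"
proof
  assume av: "a \<odot>\<^bsub>M\<^esub> v = \<zero>\<^bsub>M\<^esub>"
  interpret field R by (rule assms(1))
  show "a = \<zero> \<or> v = \<zero>\<^bsub>M\<^esub>"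
  proof (cases "a = \<zero>")
    case False
    then have a: "a \<in> Units R"
      using assms(2) field_Units by blast
    then have "v = (inv a \<otimes> a) \<odot>\<^bsub>M\<^esub> v"
      using assms(3) by simp
    also have "\<dots> = inv a \<odot>\<^bsub>M\<^esub> (a \<odot>\<^bsub>M\<^esub> v)"
      using a assms by (simp add: smult_assoc1 del: Units_l_inv)
    also have "\<dots> = \<zero>\<^bsub>M\<^esub>"
      using a av by simp
    finally show ?thesis by simp
  qed simp
qed (use assms in auto)

lemma (in Module.module) smult_right_cancel:
  assumes "Ring.field R" "a \<in> carrier R" "b \<in> carrier R" "v \<in> carrier M" "v \<noteq> \<zero>\<^bsub>M\<^esub>"
    and "a \<odot>\<^bsub>M\<^esub> v = b \<odot>\<^bsub>M\<^esub> v"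
  shows "a = b"
proof -
  have "(a \<ominus> b) \<odot>\<^bsub>M\<^esub> v = a \<odot>\<^bsub>M\<^esub> v \<oplus>\<^bsub>M\<^esub> \<ominus>\<^bsub>M\<^esub> (b \<odot>\<^bsub>M\<^esub> v)"
    using assms by (simp add: a_minus_def smult_l_distr smult_l_minus)
  also have "\<dots> = \<zero>\<^bsub>M\<^esub>"
    using assms by (simp add: M.r_neg)
  finally have "a \<ominus> b = \<zero>"
    using assms smult_eq_zero_iff by auto
  moreover have "a = (a \<ominus> b) \<oplus> b"
    using assms by (simp add: a_minus_def R.a_assoc R.l_neg)
  ultimately show ?thesis
    using assms by simp
qed

lemma character_space_module:
  fixes K :: "('k, 'r) ring_scheme" and G :: "('g, 'n) monoid_scheme"
  assumes "cring K" "Group.group G"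
  shows "Module.module K (character_space K G)"
proof (rule moduleI)
  interpret K: cring K by (rule assms)
  interpret G: group G by (rule assms)
  let ?V = "character_space K G"
  have carrier_iff: "\<xi> \<in> carrier ?V \<longleftrightarrow>
      (\<forall>s\<in>carrier G. \<xi> s \<in> carrier K) \<and> (\<forall>s\<in>carrier G. \<forall>t\<in>carrier G. \<xi> (s \<otimes>\<^bsub>G\<^esub> t) = \<xi> s \<oplus>\<^bsub>K\<^esub> \<xi> t) \<and>
      \<xi> \<in> extensional (carrier G)" for \<xi>
    by (auto simp: character_space_def hom_def Pi_iff)
  have ext: "\<xi> = \<psi>" if "\<xi> \<in> extensional (carrier G)" "\<psi> \<in> extensional (carrier G)"
      "\<And>s. s \<in> carrier G \<Longrightarrow> \<xi> s = \<psi> s" for \<xi> \<psi> :: "'g \<Rightarrow> 'k"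
    using that by (rule extensionalityI)
  have add: "(\<xi> \<oplus>\<^bsub>?V\<^esub> \<psi>) s = \<xi> s \<oplus>\<^bsub>K\<^esub> \<psi> s" "(a \<odot>\<^bsub>?V\<^esub> \<xi>) s = a \<otimes>\<^bsub>K\<^esub> \<xi> s" "\<zero>\<^bsub>?V\<^esub> s = \<zero>\<^bsub>K\<^esub>"
    if "s \<in> carrier G" for \<xi> \<psi> a s
    using that by (simp_all add: character_space_def)
  have add_ext: "\<xi> \<oplus>\<^bsub>?V\<^esub> \<psi> \<in> extensional (carrier G)" "a \<odot>\<^bsub>?V\<^esub> \<xi> \<in> extensional (carrier G)"
    "\<zero>\<^bsub>?V\<^esub> \<in> extensional (carrier G)" for \<xi> \<psi> a
    by (simp_all add: character_space_def)
  show "cring K" by fact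
  show "abelian_group ?V"
  proof (rule abelian_groupI)
    fix \<xi> assume \<xi>: "\<xi> \<in> carrier ?V"
    define \<psi> where "\<psi> = (\<lambda>s\<in>carrier G. \<ominus>\<^bsub>K\<^esub> \<xi> s)"
    have "\<psi> \<in> carrier ?V"
      using \<xi> by (auto simp: carrier_iff \<psi>_def K.minus_add)
    moreover have "\<psi> \<oplus>\<^bsub>?V\<^esub> \<xi> = \<zero>\<^bsub>?V\<^esub>"
      using \<xi> by (intro ext add_ext) (simp add: add \<psi>_def carrier_iff K.l_neg)
    ultimately show "\<exists>\<psi>\<in>carrier ?V. \<psi> \<oplus>\<^bsub>?V\<^esub> \<xi> = \<zero>\<^bsub>?V\<^esub>" by blast
  next
    fix \<xi> \<psi> \<theta> assume *: "\<xi> \<in> carrier ?V" "\<psi> \<in> carrier ?V" "\<theta> \<in> carrier ?V"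
    show "\<xi> \<oplus>\<^bsub>?V\<^esub> \<psi> \<oplus>\<^bsub>?V\<^esub> \<theta> = \<xi> \<oplus>\<^bsub>?V\<^esub> (\<psi> \<oplus>\<^bsub>?V\<^esub> \<theta>)"
      using * by (intro ext add_ext) (simp add: add carrier_iff K.a_assoc)
  next
    fix \<xi> \<psi> assume *: "\<xi> \<in> carrier ?V" "\<psi> \<in> carrier ?V"
    show "\<xi> \<oplus>\<^bsub>?V\<^esub> \<psi> = \<psi> \<oplus>\<^bsub>?V\<^esub> \<xi>"
      using * by (intro ext add_ext) (simp add: add carrier_iff K.a_comm)
    show "\<xi> \<oplus>\<^bsub>?V\<^esub> \<psi> \<in> carrier ?V"
      using * unfolding carrier_iff[of "\<xi> \<oplus>\<^bsub>?V\<^esub> \<psi>"] by (simp add: add add_ext carrier_iff K.a_ac)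
  next
    show "\<zero>\<^bsub>?V\<^esub> \<in> carrier ?V"
      unfolding carrier_iff by (simp add: add add_ext)
    fix \<xi> assume "\<xi> \<in> carrier ?V"
    then show "\<zero>\<^bsub>?V\<^esub> \<oplus>\<^bsub>?V\<^esub> \<xi> = \<xi>"
      by (intro ext add_ext) (simp_all add: add carrier_iff)
  qed
  fix a \<xi> assume a: "a \<in> carrier K" and \<xi>: "\<xi> \<in> carrier ?V"
  show "a \<odot>\<^bsub>?V\<^esub> \<xi> \<in> carrier ?V"
    using a \<xi> unfolding carrier_iff[of "a \<odot>\<^bsub>?V\<^esub> \<xi>"] by (simp add: add add_ext carrier_iff K.r_distr)
  show "a \<odot>\<^bsub>?V\<^esub> (\<xi> \<oplus>\<^bsub>?V\<^esub> \<psi>) = a \<odot>\<^bsub>?V\<^esub> \<xi> \<oplus>\<^bsub>?V\<^esub> a \<odot>\<^bsub>?V\<^esub> \<psi>" if "\<psi> \<in> carrier ?V" for \<psi>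
    using a \<xi> that by (intro ext add_ext) (simp add: add carrier_iff K.r_distr)
  show "(a \<oplus>\<^bsub>K\<^esub> b) \<odot>\<^bsub>?V\<^esub> \<xi> = a \<odot>\<^bsub>?V\<^esub> \<xi> \<oplus>\<^bsub>?V\<^esub> b \<odot>\<^bsub>?V\<^esub> \<xi>"
    "(a \<otimes>\<^bsub>K\<^esub> b) \<odot>\<^bsub>?V\<^esub> \<xi> = a \<odot>\<^bsub>?V\<^esub> (b \<odot>\<^bsub>?V\<^esub> \<xi>)" if "b \<in> carrier K" for b
    using a \<xi> that by (intro ext add_ext; simp add: add carrier_iff K.l_distr K.m_assoc)+
next
  interpret K: cring K by (rule assms)
  fix \<xi> assume \<xi>: "\<xi> \<in> carrier (character_space K G)"
  show "\<one>\<^bsub>K\<^esub> \<odot>\<^bsub>character_space K G\<^esub> \<xi> = \<xi>"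
    using \<xi> by (intro extensionalityI[of _ "carrier G"]) (auto simp: character_space_def hom_def Pi_iff)
qed

section \<open>Derivations of a Schurian category\<close>

locale schurian_category = k_category K C + based_cw_complex C e c0 u
  for K :: "('k, 'r) ring_scheme" (structure) and C :: "('o, 'k, 'm) kcat" and e c0 u +
  assumes schurian: "schurian K C" and connected: "connected_category C"
begin

sublocale K: Ring.field K
  by (rule field)

lemma Mor_one_dimensional:
  assumes "x \<in> Obj C" "y \<in> Obj C" "nonzero_Mor C y x"
  shows "one_dimensional K (Mor C y x)"
  using assms schurian by (auto simp: schurian_def nonzero_Mor_def)

text \<open>One-dimensionality provides some generator \<open>b\<close>. The chosen element
  \<open>e y x\<close> is a multiple of \<open>b\<close> by a non-zero scalar, hence a unit, so it
  generates as well.\<close>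

lemma multiple_of_basis:
  assumes xy: "x \<in> Obj C" "y \<in> Obj C" "nonzero_Mor C y x" and f: "f \<in> carrier (Mor C y x)"
  obtains a where "a \<in> carrier K" "f = a \<odot>\<^bsub>Mor C y x\<^esub> e y x"
proof -
  interpret M: Module.module K "Mor C y x"
    by (rule Mor_module[OF xy(1,2)])
  obtain b where b: "b \<in> carrier (Mor C y x)"
    "\<And>v. v \<in> carrier (Mor C y x) \<Longrightarrow> \<exists>a. a \<in> carrier K \<and> v = a \<odot>\<^bsub>Mor C y x\<^esub> b"
    using Mor_one_dimensional[OF xy] unfolding one_dimensional_def by (elim bexE) (meson ex1_implies_ex)
  obtain c where c: "c \<in> carrier K" "e y x = c \<odot>\<^bsub>Mor C y x\<^esub> b"
    using b(2)[OF basis_in(1)[OF xy]] by blast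
  obtain a where a: "a \<in> carrier K" "f = a \<odot>\<^bsub>Mor C y x\<^esub> b"
    using b(2)[OF f] by blast
  have "c \<noteq> \<zero>"
    using c b(1) basis_in(2)[OF xy] by auto
  then have c': "c \<in> Units K"
    using c K.field_Units by blast
  note inv_c = K.Units_inv_closed[OF c']
  have "a = (a \<otimes> inv c) \<otimes> c"
    using a(1) c(1) inv_c K.Units_l_inv[OF c'] by (simp add: K.m_assoc)
  then have "f = (a \<otimes> inv c) \<odot>\<^bsub>Mor C y x\<^esub> (c \<odot>\<^bsub>Mor C y x\<^esub> b)"
    using a M.smult_assoc1[OF K.m_closed[OF a(1) inv_c] c(1) b(1)] by simp
  then show thesis
    using that[of "a \<otimes> inv c"] a(1) inv_c unfolding c(2) by simp
qed

lemma basis_same: "x \<in> Obj C \<Longrightarrow> e x x = Id C x"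
  using basis by (simp add: basis_choice_def)

text \<open>A vanishing identity would make all morphisms into and out of \<open>x\<close> zero.
  Connectedness excludes this: a walk from \<open>x\<close> to \<open>x\<close> is non-empty and
  consists of non-zero morphisms, one of which starts or ends at \<open>x\<close>.\<close>

lemma nonzero_Mor_same:
  assumes x: "x \<in> Obj C"
  shows "nonzero_Mor C x x"
proof (rule ccontr)
  assume "\<not> nonzero_Mor C x x"
  then have Mor0: "carrier (Mor C x x) = {\<zero>\<^bsub>Mor C x x\<^esub>}"
    by (simp add: nonzero_Mor_def)
  interpret X: Module.module K "Mor C x x"
    by (rule Mor_module[OF x x])
  have Id0: "Id C x = \<zero> \<odot>\<^bsub>Mor C x x\<^esub> Id C x"
    using Id_closed[OF x] Mor0 by auto
  obtain w where w: "is_walk C x w x"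
    using connected x by (auto simp: connected_category_def)
  then obtain v where v: "virtual_in C v" "vtarget v = x"
    by (cases w) (auto simp: is_walk_def)
  \<comment> \<open>The virtual morphism with target \<open>x\<close> is either a morphism into
    \<open>x\<close> or a formal inverse of one out of \<open>x\<close>; the two claims treat these
    cases.\<close>
  have zero: "f = \<zero>\<^bsub>Mor C x z\<^esub>" if z: "z \<in> Obj C" and f: "f \<in> carrier (Mor C x z)" for z f
  proof -
    interpret M: Module.module K "Mor C x z"
      by (rule Mor_module[OF z x])
    have "f = Comp C x x z (\<zero> \<odot>\<^bsub>Mor C x x\<^esub> Id C x) f"
      using Id_left[OF z x f] Id0 by simp
    also have "\<dots> = \<zero> \<odot>\<^bsub>Mor C x z\<^esub> Comp C x x z (Id C x) f"
      using z x f Id_closed[OF x] by (intro Comp_smult_left) auto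
    also have "\<dots> = \<zero>\<^bsub>Mor C x z\<^esub>"
      using Comp_closed[OF z x x Id_closed[OF x] f] by simp
    finally show ?thesis .
  qed
  have zero': "f = \<zero>\<^bsub>Mor C z x\<^esub>" if z: "z \<in> Obj C" and f: "f \<in> carrier (Mor C z x)" for z f
  proof -
    interpret M: Module.module K "Mor C z x"
      by (rule Mor_module[OF x z])
    have "f = Comp C z x x f (\<zero> \<odot>\<^bsub>Mor C x x\<^esub> Id C x)"
      using Id_right[OF x z f] Id0 by simp
    also have "\<dots> = \<zero> \<odot>\<^bsub>Mor C z x\<^esub> Comp C z x x f (Id C x)"
      using z x f Id_closed[OF x] by (intro Comp_smult_right) auto
    also have "\<dots> = \<zero>\<^bsub>Mor C z x\<^esub>"
      using Comp_closed[OF x x z f Id_closed[OF x]] by simp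
    finally show ?thesis .
  qed
  show False
    using v zero zero' by (cases v) auto
qed

lemma Comp_multiples:
  assumes "x \<in> Obj C" "y \<in> Obj C" "z \<in> Obj C" "a \<in> carrier K" "b \<in> carrier K"
    and "g \<in> carrier (Mor C z y)" "f \<in> carrier (Mor C y x)"
  shows "Comp C z y x (a \<odot>\<^bsub>Mor C z y\<^esub> g) (b \<odot>\<^bsub>Mor C y x\<^esub> f) = (a \<otimes> b) \<odot>\<^bsub>Mor C z x\<^esub> Comp C z y x g f"
proof -
  interpret Mzy: Module.module K "Mor C z y" by (rule Mor_module[OF assms(2,3)])
  interpret Myx: Module.module K "Mor C y x" by (rule Mor_module[OF assms(1,2)])
  interpret Mzx: Module.module K "Mor C z x" by (rule Mor_module[OF assms(1,3)])
  show ?thesis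
    using assms by (simp add: Comp_smult_left Comp_smult_right Comp_closed
        Mzx.smult_assoc1[symmetric] K.m_comm)
qed

lemma Comp_zero:
  assumes obj: "x \<in> Obj C" "y \<in> Obj C" "z \<in> Obj C"
    and g: "g \<in> carrier (Mor C z y)" and f: "f \<in> carrier (Mor C y x)"
  shows "Comp C z y x \<zero>\<^bsub>Mor C z y\<^esub> f = \<zero>\<^bsub>Mor C z x\<^esub>"
    "Comp C z y x g \<zero>\<^bsub>Mor C y x\<^esub> = \<zero>\<^bsub>Mor C z x\<^esub>"
proof -
  interpret Mzy: Module.module K "Mor C z y" by (rule Mor_module[OF obj(2,3)])
  interpret Myx: Module.module K "Mor C y x" by (rule Mor_module[OF obj(1,2)])
  interpret Mzx: Module.module K "Mor C z x" by (rule Mor_module[OF obj(1,3)])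
  show "Comp C z y x \<zero>\<^bsub>Mor C z y\<^esub> f = \<zero>\<^bsub>Mor C z x\<^esub>"
    using Comp_smult_left[OF obj K.zero_closed g f] Comp_closed[OF obj g f] g by simp
  show "Comp C z y x g \<zero>\<^bsub>Mor C y x\<^esub> = \<zero>\<^bsub>Mor C z x\<^esub>"
    using Comp_smult_right[OF obj K.zero_closed g f] Comp_closed[OF obj g f] f by simp
qed

text \<open>All morphisms are multiples of basis elements and composition is bilinear, so a non-zero
  composite of any two forces the basis elements to have a non-zero composite.\<close>

lemma Comp_nonzero:
  assumes obj: "x \<in> Obj C" "y \<in> Obj C" "z \<in> Obj C"
    and g: "g \<in> carrier (Mor C z y)" and f: "f \<in> carrier (Mor C y x)"
    and nz: "Comp C z y x g f \<noteq> \<zero>\<^bsub>Mor C z x\<^esub>"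
  shows "nonzero_Mor C y x" "nonzero_Mor C z y" "nonzero_Mor C z x"
    "Comp C z y x (e z y) (e y x) \<noteq> \<zero>\<^bsub>Mor C z x\<^esub>"
proof -
  interpret Mzy: Module.module K "Mor C z y" by (rule Mor_module[OF obj(2,3)])
  interpret Myx: Module.module K "Mor C y x" by (rule Mor_module[OF obj(1,2)])
  interpret Mzx: Module.module K "Mor C z x" by (rule Mor_module[OF obj(1,3)])
  show yx: "nonzero_Mor C y x"
    using f Comp_zero(2)[OF obj g f] nz by (auto simp: nonzero_Mor_def)
  show zy: "nonzero_Mor C z y"
    using g Comp_zero(1)[OF obj g f] nz by (auto simp: nonzero_Mor_def)
  show "nonzero_Mor C z x"
    using Comp_closed[OF obj g f] nz by (auto simp: nonzero_Mor_def)
  obtain a where a: "a \<in> carrier K" "g = a \<odot>\<^bsub>Mor C z y\<^esub> e z y"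
    using multiple_of_basis[OF obj(2,3) zy g] .
  obtain b where b: "b \<in> carrier K" "f = b \<odot>\<^bsub>Mor C y x\<^esub> e y x"
    using multiple_of_basis[OF obj(1,2) yx f] .
  have "Comp C z y x g f = (a \<otimes> b) \<odot>\<^bsub>Mor C z x\<^esub> Comp C z y x (e z y) (e y x)"
    unfolding a(2) b(2) by (intro Comp_multiples obj a b basis_in yx zy)
  then show "Comp C z y x (e z y) (e y x) \<noteq> \<zero>\<^bsub>Mor C z x\<^esub>"
    using nz a(1) b(1) by auto
qed

lemma Id_nonzero: "x \<in> Obj C \<Longrightarrow> Comp C x x x (e x x) (e x x) \<noteq> \<zero>\<^bsub>Mor C x x\<^esub>"
  using basis_in[OF _ _ nonzero_Mor_same, of x] Id_left[of x x "Id C x"] Id_closed[of x]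
      by (simp add: basis_same)

section \<open>Derivations as scalar functions on pairs of objects\<close>

definition scaling :: "('o \<Rightarrow> 'o \<Rightarrow> 'k) \<Rightarrow> 'o \<Rightarrow> 'o \<Rightarrow> 'm \<Rightarrow> 'm" where
  "scaling \<mu> = (\<lambda>y\<in>Obj C. \<lambda>x\<in>Obj C. \<lambda>f\<in>carrier (Mor C y x). \<mu> y x \<odot>\<^bsub>Mor C y x\<^esub> f)"

text \<open>Cellular 1-cocycles of the complex. Instances with coinciding objects are included: they
  give the relations of digons and force the value zero on identities.\<close>

definition cocycle :: "('o \<Rightarrow> 'o \<Rightarrow> 'k) \<Rightarrow> bool" where
  "cocycle \<mu> \<longleftrightarrow> (\<forall>x\<in>Obj C. \<forall>y\<in>Obj C. \<mu> y x \<in> carrier K) \<and>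
     (\<forall>x\<in>Obj C. \<forall>y\<in>Obj C. \<forall>z\<in>Obj C. nonzero_Mor C y x \<longrightarrow> nonzero_Mor C z y \<longrightarrow>
        Comp C z y x (e z y) (e y x) \<noteq> \<zero>\<^bsub>Mor C z x\<^esub> \<longrightarrow> \<mu> z x = \<mu> z y \<oplus> \<mu> y x)"

lemma cocycle_closed: "cocycle \<mu> \<Longrightarrow> x \<in> Obj C \<Longrightarrow> y \<in> Obj C \<Longrightarrow> \<mu> y x \<in> carrier K"
  by (simp add: cocycle_def)

lemma cocycleD:
  "\<lbrakk>cocycle \<mu>; x \<in> Obj C; y \<in> Obj C; z \<in> Obj C; nonzero_Mor C y x; nonzero_Mor C z y;
    Comp C z y x (e z y) (e y x) \<noteq> \<zero>\<^bsub>Mor C z x\<^esub>\<rbrakk> \<Longrightarrow> \<mu> z x = \<mu> z y \<oplus> \<mu> y x"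
  by (simp add: cocycle_def)

lemma cocycle_same:
  assumes "cocycle \<mu>" "x \<in> Obj C"
  shows "\<mu> x x = \<zero>"
proof -
  \<comment> \<open>The cocycle condition for the identity composed with itself, a non-zero
    composite.\<close>
  have "\<mu> x x = \<mu> x x \<oplus> \<mu> x x"
    using cocycleD[OF assms(1,2,2,2)] nonzero_Mor_same Id_nonzero assms by simp
  then show ?thesis
    using cocycle_closed[OF assms(1)] assms(2) K.add.l_cancel_one' by metis
qed

lemma scaling_apply:
  "x \<in> Obj C \<Longrightarrow> y \<in> Obj C \<Longrightarrow> f \<in> carrier (Mor C y x) \<Longrightarrow> scaling \<mu> y x f = \<mu> y x \<odot>\<^bsub>Mor C y x\<^esub> f"
  by (simp add: scaling_def)

lemma scaling_derivation:
  assumes \<mu>: "cocycle \<mu>"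
  shows "scaling \<mu> \<in> derivations K C"
proof -
  have mod: "Module.module K (Mor C y x)" if "x \<in> Obj C" "y \<in> Obj C" for x y
    using Mor_module that .
  have closed: "\<mu> y x \<in> carrier K" if "x \<in> Obj C" "y \<in> Obj C" for x y
    using cocycle_closed[OF \<mu>] that .
  have leibniz: "scaling \<mu> z x (Comp C z y x g f) =
      Comp C z y x (scaling \<mu> z y g) f \<oplus>\<^bsub>Mor C z x\<^esub> Comp C z y x g (scaling \<mu> y x f)"
    if obj: "x \<in> Obj C" "y \<in> Obj C" "z \<in> Obj C" and g: "g \<in> carrier (Mor C z y)"
        and f: "f \<in> carrier (Mor C y x)"
    for x y z g f
  proof -
    interpret Mzx: Module.module K "Mor C z x" by (rule Mor_module[OF obj(1,3)])
    have gf: "Comp C z y x g f \<in> carrier (Mor C z x)"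
      by (rule Comp_closed[OF obj g f])
    have "Comp C z y x (scaling \<mu> z y g) f \<oplus>\<^bsub>Mor C z x\<^esub> Comp C z y x g (scaling \<mu> y x f) =
        (\<mu> z y \<oplus> \<mu> y x) \<odot>\<^bsub>Mor C z x\<^esub> Comp C z y x g f"
      using obj g f gf closed by (simp add: scaling_apply Comp_smult_left Comp_smult_right
          Mzx.smult_l_distr)
    also have "\<dots> = \<mu> z x \<odot>\<^bsub>Mor C z x\<^esub> Comp C z y x g f"
    \<comment> \<open>Where the composite vanishes, the two scalars may differ without harm; this is
      why \<open>cocycle\<close> restricts to non-zero composites.\<close>
    proof (cases "Comp C z y x g f = \<zero>\<^bsub>Mor C z x\<^esub>")
      case True
      then show ?thesis
        using obj closed by simp
    next
      case False
      from Comp_nonzero[OF obj g f this] show ?thesis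
        using cocycleD[OF \<mu> obj] by simp
    qed
    finally show ?thesis
      using obj gf by (simp add: scaling_apply)
  qed
  show ?thesis
    unfolding derivations_def
  proof (intro CollectI conjI ballI)
    show "scaling \<mu> \<in> (\<Pi>\<^sub>E y\<in>Obj C. \<Pi>\<^sub>E x\<in>Obj C. carrier (Mor C y x) \<rightarrow>\<^sub>E carrier (Mor C y x))"
      unfolding scaling_def by (intro restrict_PiE_iff[THEN iffD2] ballI
          Module.module.smult_closed[OF mod] closed)
  next
    fix x y f f' assume *: "x \<in> Obj C" "y \<in> Obj C" "f \<in> carrier (Mor C y x)" "f' \<in> carrier (Mor C y x)"
    then interpret M: Module.module K "Mor C y x" by (intro mod)
    show "scaling \<mu> y x (f \<oplus>\<^bsub>Mor C y x\<^esub> f') = scaling \<mu> y x f \<oplus>\<^bsub>Mor C y x\<^esub> scaling \<mu> y x f'"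
      using * closed by (simp add: scaling_apply M.smult_r_distr)
  next
    fix x y a f assume *: "x \<in> Obj C" "y \<in> Obj C" "a \<in> carrier K" "f \<in> carrier (Mor C y x)"
    then interpret M: Module.module K "Mor C y x" by (intro mod)
    show "scaling \<mu> y x (a \<odot>\<^bsub>Mor C y x\<^esub> f) = a \<odot>\<^bsub>Mor C y x\<^esub> scaling \<mu> y x f"
      using * closed by (simp add: scaling_apply M.smult_assoc1[symmetric] K.m_comm)
  qed (rule leibniz)
qed

lemma derivation_is_scaling:
  assumes d: "d \<in> derivations K C"
  obtains \<mu> where "cocycle \<mu>" "\<And>x y. \<mu> y x \<in> carrier K" "\<And>x. \<mu> x x = \<zero>" "d = scaling \<mu>"
proof -
  have d_ext: "d \<in> (\<Pi>\<^sub>E y\<in>Obj C. \<Pi>\<^sub>E x\<in>Obj C. carrier (Mor C y x) \<rightarrow>\<^sub>E carrier (Mor C y x))"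
    using d by (simp add: derivations_def)
  have d_closed: "d y x f \<in> carrier (Mor C y x)" if "x \<in> Obj C" "y \<in> Obj C"
      "f \<in> carrier (Mor C y x)" for x y f
    using d_ext that by (auto simp: PiE_iff)
  have d_smult: "d y x (a \<odot>\<^bsub>Mor C y x\<^esub> f) = a \<odot>\<^bsub>Mor C y x\<^esub> d y x f"
    if "x \<in> Obj C" "y \<in> Obj C" "a \<in> carrier K" "f \<in> carrier (Mor C y x)" for x y a f
    using d that by (simp add: derivations_def)
  have d_Comp: "d z x (Comp C z y x g f) = Comp C z y x (d z y g) f
      \<oplus>\<^bsub>Mor C z x\<^esub> Comp C z y x g (d y x f)"
    if "x \<in> Obj C" "y \<in> Obj C" "z \<in> Obj C" "g \<in> carrier (Mor C z y)" "f \<in> carrier (Mor C y x)"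
        for x y z g f
    using d that by (simp add: derivations_def)
  \<comment> \<open>The value zero where there is no non-zero morphism makes \<open>\<mu>\<close> a
    total function into the field, as the locale \<open>edge_cocycle\<close> demands.\<close>
  define \<mu> where "\<mu> y x = (if x \<in> Obj C \<and> y \<in> Obj C \<and> nonzero_Mor C y x
      then SOME a. a \<in> carrier K \<and> d y x (e y x) = a \<odot>\<^bsub>Mor C y x\<^esub> e y x else \<zero>)" for y x
  have \<mu>: "\<mu> y x \<in> carrier K" "d y x (e y x) = \<mu> y x \<odot>\<^bsub>Mor C y x\<^esub> e y x"
    if "x \<in> Obj C" "y \<in> Obj C" "nonzero_Mor C y x" for x y
  proof -
    have "\<exists>a. a \<in> carrier K \<and> d y x (e y x) = a \<odot>\<^bsub>Mor C y x\<^esub> e y x"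
      using multiple_of_basis[OF that d_closed[OF that(1,2) basis_in(1)[OF that]]] by metis
    from someI_ex[OF this] show "\<mu> y x \<in> carrier K" "d y x (e y x) = \<mu> y x \<odot>\<^bsub>Mor C y x\<^esub> e y x"
      using that by (simp_all add: \<mu>_def)
  qed
  have \<mu>_closed: "\<mu> y x \<in> carrier K" for x y
    using \<mu>(1)[of x y] by (cases "x \<in> Obj C \<and> y \<in> Obj C \<and> nonzero_Mor C y x") (auto simp: \<mu>_def)
  have d_apply: "d y x f = \<mu> y x \<odot>\<^bsub>Mor C y x\<^esub> f"
    if xy: "x \<in> Obj C" "y \<in> Obj C" and f: "f \<in> carrier (Mor C y x)" for x y f
  proof -
    interpret M: Module.module K "Mor C y x" by (rule Mor_module[OF xy])
    show ?thesis
    proof (cases "nonzero_Mor C y x")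
      case True
      obtain a where a: "a \<in> carrier K" "f = a \<odot>\<^bsub>Mor C y x\<^esub> e y x"
        using multiple_of_basis[OF xy True f] .
      have "d y x f = a \<odot>\<^bsub>Mor C y x\<^esub> (\<mu> y x \<odot>\<^bsub>Mor C y x\<^esub> e y x)"
        using a d_smult[OF xy a(1) basis_in(1)[OF xy True]] \<mu>(2)[OF xy True] by simp
      also have "\<dots> = \<mu> y x \<odot>\<^bsub>Mor C y x\<^esub> f"
        using a \<mu>_closed basis_in(1)[OF xy True] by (simp add: M.smult_assoc1[symmetric] K.m_comm)
      finally show ?thesis .
    next
      case False
      then have zero: "v = \<zero>\<^bsub>Mor C y x\<^esub>" if "v \<in> carrier (Mor C y x)" for v
        using that by (simp add: nonzero_Mor_def)
      show ?thesis
        using zero[OF d_closed[OF xy f]] zero[OF M.smult_closed[OF \<mu>_closed f]] by simp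
    qed
  qed
  have "d = scaling \<mu>"
  proof
    fix y show "d y = scaling \<mu> y"
    proof
      fix x show "d y x = scaling \<mu> y x"
      proof
        fix f show "d y x f = scaling \<mu> y x f"
          using d_ext d_apply by (cases "y \<in> Obj C"; cases "x \<in> Obj C"; cases "f \<in> carrier (Mor C y x)")
            (auto simp: scaling_def PiE_iff extensional_def)
      qed
    qed
  qed
  moreover have cocycle: "cocycle \<mu>"
    unfolding cocycle_def
  proof (intro conjI ballI impI \<mu>_closed)
    fix x y z assume obj: "x \<in> Obj C" "y \<in> Obj C" "z \<in> Obj C"
      and nz: "nonzero_Mor C y x" "nonzero_Mor C z y"
          and comp: "Comp C z y x (e z y) (e y x) \<noteq> \<zero>\<^bsub>Mor C z x\<^esub>"
    interpret Mzx: Module.module K "Mor C z x" by (rule Mor_module[OF obj(1,3)])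
    let ?c = "Comp C z y x (e z y) (e y x)"
    note b = basis_in(1)[OF obj(2,3) nz(2)] basis_in(1)[OF obj(1,2) nz(1)]
    have c: "?c \<in> carrier (Mor C z x)"
      by (rule Comp_closed[OF obj b])
    \<comment> \<open>The Leibniz rule on basis elements; the composite \<open>?c\<close> is
      non-zero and can be cancelled.\<close>
    have "\<mu> z x \<odot>\<^bsub>Mor C z x\<^esub> ?c = (\<mu> z y \<oplus> \<mu> y x) \<odot>\<^bsub>Mor C z x\<^esub> ?c"
      using d_Comp[OF obj b] d_apply[OF obj(1,3) c] d_apply[OF obj(2,3) b(1)] d_apply[OF obj(1,2) b(2)]
        Comp_smult_left[OF obj \<mu>_closed b] Comp_smult_right[OF obj \<mu>_closed b] c \<mu>_closed
      by (simp add: Mzx.smult_l_distr)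
    then show "\<mu> z x = \<mu> z y \<oplus> \<mu> y x"
      using Mzx.smult_right_cancel[OF K.field_axioms _ _ c comp] \<mu>_closed by simp
  qed
  moreover have "\<mu> x x = \<zero>" for x
  proof (cases "x \<in> Obj C")
    case True
    then show ?thesis by (rule cocycle_same[OF cocycle])
  qed (simp add: \<mu>_def)
  ultimately show thesis
    using that \<mu>_closed by blast
qed

lemma scaling_cong:
  assumes "\<And>x y. x \<in> Obj C \<Longrightarrow> y \<in> Obj C \<Longrightarrow> nonzero_Mor C y x \<Longrightarrow> \<mu> y x = \<mu>' y x"
    and "\<And>x y. x \<in> Obj C \<Longrightarrow> y \<in> Obj C \<Longrightarrow> \<mu> y x \<in> carrier K"
    and "\<And>x y. x \<in> Obj C \<Longrightarrow> y \<in> Obj C \<Longrightarrow> \<mu>' y x \<in> carrier K"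
  shows "scaling \<mu> = scaling \<mu>'"
  unfolding scaling_def
proof (intro restrict_ext)
  fix y x f assume xy: "y \<in> Obj C" "x \<in> Obj C" and f: "f \<in> carrier (Mor C y x)"
  interpret M: Module.module K "Mor C y x" by (rule Mor_module[OF xy(2,1)])
  show "\<mu> y x \<odot>\<^bsub>Mor C y x\<^esub> f = \<mu>' y x \<odot>\<^bsub>Mor C y x\<^esub> f"
  proof (cases "nonzero_Mor C y x")
    case True
    with assms(1) xy show ?thesis by simp
  next
    case False
    then have "f = \<zero>\<^bsub>Mor C y x\<^esub>"
      using f by (simp add: nonzero_Mor_def)
    with assms(2,3) xy show ?thesis by simp
  qed
qed

lemma scaling_eqD:
  assumes "scaling \<mu> = scaling \<mu>'" "x \<in> Obj C" "y \<in> Obj C" "nonzero_Mor C y x"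
    and "\<mu> y x \<in> carrier K" "\<mu>' y x \<in> carrier K"
  shows "\<mu> y x = \<mu>' y x"
proof -
  interpret M: Module.module K "Mor C y x" by (rule Mor_module[OF assms(2,3)])
  note b = basis_in[OF assms(2-4)]
  have "\<mu> y x \<odot>\<^bsub>Mor C y x\<^esub> e y x = \<mu>' y x \<odot>\<^bsub>Mor C y x\<^esub> e y x"
    using fun_cong[OF fun_cong[OF fun_cong[OF assms(1)]], of y x "e y x"]
    unfolding scaling_apply[OF assms(2,3) b(1)] .
  then show ?thesis
    by (rule M.smult_right_cancel[OF K.field_axioms assms(5,6) b])
qed

section \<open>The space of derivations and its inner part\<close>

abbreviation "DS \<equiv> derivation_space K C"

lemma scaling_add:
  assumes "\<And>x y. x \<in> Obj C \<Longrightarrow> y \<in> Obj C \<Longrightarrow> \<mu> y x \<in> carrier K"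
    and "\<And>x y. x \<in> Obj C \<Longrightarrow> y \<in> Obj C \<Longrightarrow> \<mu>' y x \<in> carrier K"
  shows "scaling \<mu> \<oplus>\<^bsub>DS\<^esub> scaling \<mu>' = scaling (\<lambda>y x. \<mu> y x \<oplus> \<mu>' y x)"
proof -
  have "\<mu> y x \<odot>\<^bsub>Mor C y x\<^esub> f \<oplus>\<^bsub>Mor C y x\<^esub> \<mu>' y x \<odot>\<^bsub>Mor C y x\<^esub> f = (\<mu> y x \<oplus> \<mu>' y x) \<odot>\<^bsub>Mor C y x\<^esub> f"
    if "x \<in> Obj C" "y \<in> Obj C" "f \<in> carrier (Mor C y x)" for x y f
    using Module.module.smult_l_distr[OF Mor_module] assms that by metis
  then show ?thesis
    by (auto simp: derivation_space_def scaling_def intro!: restrict_ext)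
qed

lemma scaling_smult:
  assumes "\<And>x y. x \<in> Obj C \<Longrightarrow> y \<in> Obj C \<Longrightarrow> \<mu> y x \<in> carrier K" "a \<in> carrier K"
  shows "a \<odot>\<^bsub>DS\<^esub> scaling \<mu> = scaling (\<lambda>y x. a \<otimes> \<mu> y x)"
proof -
  have "a \<odot>\<^bsub>Mor C y x\<^esub> (\<mu> y x \<odot>\<^bsub>Mor C y x\<^esub> f) = (a \<otimes> \<mu> y x) \<odot>\<^bsub>Mor C y x\<^esub> f"
    if "x \<in> Obj C" "y \<in> Obj C" "f \<in> carrier (Mor C y x)" for x y f
    using Module.module.smult_assoc1[OF Mor_module] assms that by metis
  then show ?thesis
    by (auto simp: derivation_space_def scaling_def intro!: restrict_ext)
qed

lemma scaling_zero: "\<zero>\<^bsub>DS\<^esub> = scaling (\<lambda>_ _. \<zero>)"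
  unfolding derivation_space_def scaling_def
  using Module.module.smult_l_null[OF Mor_module] by (auto intro!: restrict_ext)

lemma cocycle_add: "cocycle \<mu> \<Longrightarrow> cocycle \<mu>' \<Longrightarrow> cocycle (\<lambda>y x. \<mu> y x \<oplus> \<mu>' y x)"
  by (auto simp: cocycle_def K.a_ac)

lemma cocycle_smult: "cocycle \<mu> \<Longrightarrow> a \<in> carrier K \<Longrightarrow> cocycle (\<lambda>y x. a \<otimes> \<mu> y x)"
  by (auto simp: cocycle_def K.r_distr)

lemma cocycle_zero: "cocycle (\<lambda>_ _. \<zero>)"
  by (simp add: cocycle_def)

lemma cocycle_coboundary:
  assumes "\<And>x. x \<in> Obj C \<Longrightarrow> \<alpha> x \<in> carrier K"
  shows "cocycle (\<lambda>y x. \<alpha> y \<ominus> \<alpha> x)"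
  using assms by (auto simp: cocycle_def a_minus_def K.a_assoc K.r_neg1)

text \<open>Turns the vector space laws for derivations into identities between scalars, to be
  checked on each pair of objects.\<close>

lemma carrier_DS: "carrier DS = scaling ` {\<mu>. cocycle \<mu>}"
  using scaling_derivation derivation_is_scaling by (force simp: derivation_space_def)

lemma derivation_space_module: "Module.module K DS"
proof (rule moduleI)
  show "cring K" by (rule K.is_cring)
  show "abelian_group DS"
  proof (rule abelian_groupI)
    fix d assume "d \<in> carrier DS"
    then obtain \<mu> where \<mu>: "cocycle \<mu>" "d = scaling \<mu>"
      by (auto simp: carrier_DS)
    have "cocycle (\<lambda>y x. \<ominus> \<one> \<otimes> \<mu> y x)"
      by (intro cocycle_smult \<mu>) simp
    moreover have "scaling (\<lambda>y x. \<ominus> \<one> \<otimes> \<mu> y x) \<oplus>\<^bsub>DS\<^esub> d = \<zero>\<^bsub>DS\<^esub>"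
      using \<mu> cocycle_closed[OF \<mu>(1)]
      by (auto simp: scaling_add scaling_zero K.l_minus K.l_neg intro!: scaling_cong)
    ultimately show "\<exists>d'\<in>carrier DS. d' \<oplus>\<^bsub>DS\<^esub> d = \<zero>\<^bsub>DS\<^esub>"
      by (auto simp: carrier_DS)
  qed (auto simp: carrier_DS scaling_add scaling_zero cocycle_closed cocycle_add cocycle_zero K.a_ac
      intro!: scaling_cong)
qed (auto simp: carrier_DS scaling_add scaling_smult cocycle_closed cocycle_add cocycle_smult
    K.l_distr K.r_distr K.m_assoc intro!: scaling_cong)

lemma inner_derivation_scaling:
  assumes \<alpha>: "\<And>x. x \<in> Obj C \<Longrightarrow> \<alpha> x \<in> carrier K"
    and a: "\<And>x. x \<in> Obj C \<Longrightarrow> a x = \<alpha> x \<odot>\<^bsub>Mor C x x\<^esub> e x x"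
  shows "inner_derivation C a = scaling (\<lambda>y x. \<alpha> y \<ominus> \<alpha> x)"
proof -
  have "Comp C y y x (a y) f \<ominus>\<^bsub>Mor C y x\<^esub> Comp C y x x f (a x) = (\<alpha> y \<ominus> \<alpha> x) \<odot>\<^bsub>Mor C y x\<^esub> f"
    if xy: "x \<in> Obj C" "y \<in> Obj C" and f: "f \<in> carrier (Mor C y x)" for x y f
  proof -
    interpret M: Module.module K "Mor C y x" by (rule Mor_module[OF xy])
    have "Comp C y y x (a y) f = \<alpha> y \<odot>\<^bsub>Mor C y x\<^esub> f"
      using xy f \<alpha> by (simp add: a basis_same Comp_smult_left Id_closed Id_left)
    moreover have "Comp C y x x f (a x) = \<alpha> x \<odot>\<^bsub>Mor C y x\<^esub> f"
      using xy f \<alpha> by (simp add: a basis_same Comp_smult_right Id_closed Id_right)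
    ultimately show ?thesis
      using xy f \<alpha> by (simp add: a_minus_def M.smult_l_distr M.smult_l_minus)
  qed
  then show ?thesis
    unfolding inner_derivation_def scaling_def by (auto intro!: restrict_ext)
qed

text \<open>Every endomorphism space is one-dimensional and spanned by the identity, so a family
  \<open>a\<close> is a family of scalars \<open>\<alpha>\<close> and its inner derivation is the
  coboundary of \<open>\<alpha>\<close>.\<close>

lemma inner_derivations_eq:
  "inner_derivations C = {scaling (\<lambda>y x. \<alpha> y \<ominus> \<alpha> x) | \<alpha>. \<forall>x\<in>Obj C. \<alpha> x \<in> carrier K}"
proof (intro equalityI subsetI)
  fix d assume "d \<in> inner_derivations C"
  then obtain a where a: "d = inner_derivation C a" "\<And>x. x \<in> Obj C \<Longrightarrow> a x \<in> carrier (Mor C x x)"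
    by (auto simp: inner_derivations_def)
  have "\<exists>b. x \<in> Obj C \<longrightarrow> b \<in> carrier K \<and> a x = b \<odot>\<^bsub>Mor C x x\<^esub> e x x" for x
    using multiple_of_basis[OF _ _ nonzero_Mor_same a(2)] by metis
  then obtain \<alpha> where "\<And>x. x \<in> Obj C \<Longrightarrow> \<alpha> x \<in> carrier K \<and> a x = \<alpha> x \<odot>\<^bsub>Mor C x x\<^esub> e x x"
    by metis
  then show "d \<in> {scaling (\<lambda>y x. \<alpha> y \<ominus> \<alpha> x) | \<alpha>. \<forall>x\<in>Obj C. \<alpha> x \<in> carrier K}"
    using a(1) inner_derivation_scaling[of \<alpha> a] by blast
next
  fix d assume "d \<in> {scaling (\<lambda>y x. \<alpha> y \<ominus> \<alpha> x) | \<alpha>. \<forall>x\<in>Obj C. \<alpha> x \<in> carrier K}"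
  then obtain \<alpha> where \<alpha>: "d = scaling (\<lambda>y x. \<alpha> y \<ominus> \<alpha> x)" "\<And>x. x \<in> Obj C \<Longrightarrow> \<alpha> x \<in> carrier K"
    by blast
  have "d = inner_derivation C (\<lambda>x. \<alpha> x \<odot>\<^bsub>Mor C x x\<^esub> e x x)"
    using inner_derivation_scaling[of \<alpha>] \<alpha> by simp
  moreover have "\<alpha> x \<odot>\<^bsub>Mor C x x\<^esub> e x x \<in> carrier (Mor C x x)" if "x \<in> Obj C" for x
    using that \<alpha> Module.module.smult_closed[OF Mor_module] basis_in(1) nonzero_Mor_same by metis
  ultimately show "d \<in> inner_derivations C"
    unfolding inner_derivations_def by blast
qed

lemma inner_derivations_submodule: "submodule (inner_derivations C) K DS"
proof (rule Module.module.submoduleI[OF derivation_space_module])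
  interpret DS: Module.module K DS by (rule derivation_space_module)
  have innerI: "scaling (\<lambda>y x. \<alpha> y \<ominus> \<alpha> x) \<in> inner_derivations C" if "\<And>x. x \<in> Obj C
      \<Longrightarrow> \<alpha> x \<in> carrier K" for \<alpha>
    using that by (auto simp: inner_derivations_eq)
  show sub: "inner_derivations C \<subseteq> carrier DS"
    using cocycle_coboundary by (auto simp: inner_derivations_eq carrier_DS)
  show "\<zero>\<^bsub>DS\<^esub> \<in> inner_derivations C"
    using innerI[of "\<lambda>_. \<zero>"] K.r_neg[of \<zero>] by (simp add: scaling_zero a_minus_def)
  have smult: "a \<odot>\<^bsub>DS\<^esub> d \<in> inner_derivations C" if "a \<in> carrier K" "d \<in> inner_derivations C" for a d
  proof -
    obtain \<alpha> where \<alpha>: "d = scaling (\<lambda>y x. \<alpha> y \<ominus> \<alpha> x)" "\<And>x. x \<in> Obj C \<Longrightarrow> \<alpha> x \<in> carrier K"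
      using \<open>d \<in> inner_derivations C\<close> by (auto simp: inner_derivations_eq)
    have "a \<odot>\<^bsub>DS\<^esub> d = scaling (\<lambda>y x. a \<otimes> \<alpha> y \<ominus> a \<otimes> \<alpha> x)"
      using \<alpha> that by (auto simp: scaling_smult a_minus_def K.r_distr K.r_minus intro!: scaling_cong)
    with innerI[of "\<lambda>x. a \<otimes> \<alpha> x"] \<alpha>(2) that show ?thesis by simp
  qed
  then show "a \<in> carrier K \<Longrightarrow> d \<in> inner_derivations C \<Longrightarrow> a \<odot>\<^bsub>DS\<^esub> d \<in> inner_derivations C" for a d .
  show "\<ominus>\<^bsub>DS\<^esub> d \<in> inner_derivations C" if d: "d \<in> inner_derivations C" for d
    using smult[of "\<ominus> \<one>" d] DS.smult_l_minus[of \<one> d] d sub by auto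
  show "d \<oplus>\<^bsub>DS\<^esub> d' \<in> inner_derivations C" if dd': "d \<in> inner_derivations C"
      "d' \<in> inner_derivations C" for d d'
  proof -
    obtain \<alpha> \<beta> where \<alpha>: "d = scaling (\<lambda>y x. \<alpha> y \<ominus> \<alpha> x)" "\<And>x. x \<in> Obj C \<Longrightarrow> \<alpha> x \<in> carrier K"
      and \<beta>: "d' = scaling (\<lambda>y x. \<beta> y \<ominus> \<beta> x)" "\<And>x. x \<in> Obj C \<Longrightarrow> \<beta> x \<in> carrier K"
      using dd' by (auto simp: inner_derivations_eq)
    have "d \<oplus>\<^bsub>DS\<^esub> d' = scaling (\<lambda>y x. (\<alpha> y \<oplus> \<beta> y) \<ominus> (\<alpha> x \<oplus> \<beta> x))"
      using \<alpha> \<beta> by (auto simp: scaling_add a_minus_def K.minus_add K.a_ac intro!: scaling_cong)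
    with innerI[of "\<lambda>x. \<alpha> x \<oplus> \<beta> x"] \<alpha>(2) \<beta>(2) show ?thesis by simp
  qed
qed

end

section \<open>The universal grading and its Hurewicz morphism\<close>

context schurian_category
begin

abbreviation "U \<equiv> universal_grading C e u"

lemma universal_grading_eq:
  "U s y x = (if s = degree y x then carrier (Mor C y x) else {\<zero>\<^bsub>Mor C y x\<^esub>})"
  by (simp add: universal_grading_def degree_def)

text \<open>The only possible non-zero part sits in degree \<open>degree y x\<close>. If the
  morphism space is zero, that degree is not known to belong to the group, whence the case
  distinctions; then \<open>f\<close> and all its parts are zero anyway.\<close>

lemma homogeneous_parts_iff:
  assumes xy: "x \<in> Obj C" "y \<in> Obj C" and f: "f \<in> carrier (Mor C y x)"
  shows "homogeneous_parts C G U y x f c \<longleftrightarrow>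
    c = (\<lambda>s\<in>carrier G. if s = degree y x then f else \<zero>\<^bsub>Mor C y x\<^esub>)"
proof -
  interpret M: Module.module K "Mor C y x" by (rule Mor_module[OF xy])
  let ?c = "\<lambda>s\<in>carrier G. if s = degree y x then f else \<zero>\<^bsub>Mor C y x\<^esub>"
  have deg: "degree y x \<in> carrier G" if "v \<in> carrier (Mor C y x)" "v \<noteq> \<zero>\<^bsub>Mor C y x\<^esub>" for v
    using that xy by (intro degree_closed) (auto simp: nonzero_Mor_def)
  have sum: "(\<Oplus>\<^bsub>Mor C y x\<^esub>s\<in>part_support C G y x c. c s) =
      (if degree y x \<in> carrier G then c (degree y x) else \<zero>\<^bsub>Mor C y x\<^esub>)"
    and supp: "part_support C G y x c \<subseteq> {degree y x}"
    if c: "c \<in> (\<Pi>\<^sub>E s\<in>carrier G. U s y x)" for c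
  proof -
    have c_other: "c s = \<zero>\<^bsub>Mor C y x\<^esub>" if "s \<in> carrier G" "s \<noteq> degree y x" for s
      using PiE_mem[OF c that(1)] that(2) by (simp add: universal_grading_eq)
    then show supp: "part_support C G y x c \<subseteq> {degree y x}"
      by (auto simp: part_support_def)
    show "(\<Oplus>\<^bsub>Mor C y x\<^esub>s\<in>part_support C G y x c. c s) =
        (if degree y x \<in> carrier G then c (degree y x) else \<zero>\<^bsub>Mor C y x\<^esub>)"
    proof (cases "part_support C G y x c = {}")
      case True
      then have "degree y x \<in> carrier G \<Longrightarrow> c (degree y x) = \<zero>\<^bsub>Mor C y x\<^esub>"
        by (auto simp: part_support_def)
      with True show ?thesis
        by simp
    next
      case False
      then have "part_support C G y x c = {degree y x}"
        using supp by blast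
      moreover from this have "degree y x \<in> carrier G"
        by (auto simp: part_support_def)
      moreover from this have "c (degree y x) \<in> carrier (Mor C y x)"
        using c by (auto simp: PiE_iff universal_grading_eq split: if_splits)
      ultimately show ?thesis
        by simp
    qed
  qed
  show ?thesis
  proof
    assume "homogeneous_parts C G U y x f c"
    then have c: "c \<in> (\<Pi>\<^sub>E s\<in>carrier G. U s y x)"
      and f_sum: "f = (\<Oplus>\<^bsub>Mor C y x\<^esub>s\<in>part_support C G y x c. c s)"
      by (auto simp: homogeneous_parts_def)
    show "c = ?c"
    proof (rule extensionalityI[of _ "carrier G"])
      show "c \<in> extensional (carrier G)"
        using c by (simp add: PiE_iff)
      fix s assume s: "s \<in> carrier G"
      then show "c s = ?c s"
        using PiE_mem[OF c s] f_sum sum[OF c] by (cases "s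
            = degree y x") (simp_all add: universal_grading_eq)
    qed simp
  next
    assume c_eq: "c = ?c"
    have c: "c \<in> (\<Pi>\<^sub>E s\<in>carrier G. U s y x)"
      using f by (auto simp: c_eq universal_grading_eq)
    moreover have "finite (part_support C G y x c)"
      using supp[OF c] finite_subset by blast
    moreover have "f = (\<Oplus>\<^bsub>Mor C y x\<^esub>s\<in>part_support C G y x c. c s)"
      unfolding sum[OF c] using deg[OF f] by (auto simp: c_eq)
    ultimately show "homogeneous_parts C G U y x f c"
      by (simp add: homogeneous_parts_def)
  qed
qed

text \<open>Only a non-zero composite needs an argument for multiplicativity: it forces
  \<open>t\<close> and \<open>s\<close> to be the degrees of the two basis elements, and
  \<open>degree_mult\<close> applies.\<close>

lemma grading_U: "grading K C G U"
  unfolding grading_def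
proof (intro conjI ballI group_G)
  fix x y assume xy: "x \<in> Obj C" "y \<in> Obj C"
  interpret M: Module.module K "Mor C y x" by (rule Mor_module[OF xy])
  show "submodule (U s y x) K (Mor C y x)" for s
    unfolding universal_grading_eq using M.carrier_is_submodule
    by (auto intro!: M.submoduleI simp: M.add.inv_one[simplified])
  show "\<exists>!c. homogeneous_parts C G U y x f c" if "f \<in> carrier (Mor C y x)" for f
    using homogeneous_parts_iff[OF xy that] by auto
next
  fix x y z s t g f assume obj: "x \<in> Obj C" "y \<in> Obj C" "z \<in> Obj C" and st: "s \<in> carrier G"
      "t \<in> carrier G"
    and g: "g \<in> U t z y" and f: "f \<in> U s y x"
  interpret Mzy: Module.module K "Mor C z y" by (rule Mor_module[OF obj(2,3)])
  interpret Myx: Module.module K "Mor C y x" by (rule Mor_module[OF obj(1,2)])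
  have gf: "g \<in> carrier (Mor C z y)" "f \<in> carrier (Mor C y x)"
    using g f by (auto simp: universal_grading_eq split: if_splits)
  show "Comp C z y x g f \<in> U (t \<otimes>\<^bsub>G\<^esub> s) z x"
  proof (cases "Comp C z y x g f = \<zero>\<^bsub>Mor C z x\<^esub>")
    case True
    interpret Mzx: Module.module K "Mor C z x" by (rule Mor_module[OF obj(1,3)])
    show ?thesis
      using True by (simp add: universal_grading_eq)
  next
    case False
    have "t = degree z y" "s = degree y x"
      using False g f Comp_zero[OF obj gf] by (auto simp: universal_grading_eq split: if_splits)
    then have "t \<otimes>\<^bsub>G\<^esub> s = degree z x"
      using degree_mult[OF obj] Comp_nonzero[OF obj gf False] by simp
    then show ?thesis
      using Comp_closed[OF obj gf] by (simp add: universal_grading_eq)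
  qed
qed

text \<open>The default zero avoids evaluating \<open>\<xi>\<close> at the degree of a zero morphism
  space, which need not lie in the group.\<close>

definition character_scale :: "((real \<Rightarrow> 'o cw_point) set \<Rightarrow> 'k) \<Rightarrow> 'o \<Rightarrow> 'o \<Rightarrow> 'k" where
  "character_scale \<xi> y x = (if nonzero_Mor C y x then \<xi> (degree y x) else \<zero>)"

lemma hurewicz_derivation_eq:
  assumes \<xi>: "\<xi> \<in> hom G (add_monoid K)"
  shows "hurewicz_derivation C G U \<xi> = scaling (character_scale \<xi>)"
  unfolding hurewicz_derivation_def scaling_def
proof (intro restrict_ext)
  fix y x f assume xy: "y \<in> Obj C" "x \<in> Obj C" and f: "f \<in> carrier (Mor C y x)"
  interpret M: Module.module K "Mor C y x" by (rule Mor_module[OF xy(2,1)])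
  define c where "c = (\<lambda>s\<in>carrier G. if s = degree y x then f else \<zero>\<^bsub>Mor C y x\<^esub>)"
  have "(THE c. homogeneous_parts C G U y x f c) = c"
    using homogeneous_parts_iff[OF xy(2,1) f] by (simp add: c_def)
  moreover have "(\<Oplus>\<^bsub>Mor C y x\<^esub>s\<in>part_support C G y x c. \<xi> s \<odot>\<^bsub>Mor C y x\<^esub> c s) =
      character_scale \<xi> y x \<odot>\<^bsub>Mor C y x\<^esub> f"
  proof (cases "f = \<zero>\<^bsub>Mor C y x\<^esub>")
    case True
    then have "part_support C G y x c = {}"
      by (auto simp: part_support_def c_def)
    moreover have "character_scale \<xi> y x \<in> carrier K"
      using xy \<xi> degree_closed by (auto simp: character_scale_def hom_def)
    ultimately show ?thesis
      using True by simp
  next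
    case False
    then have nz: "nonzero_Mor C y x"
      using f by (auto simp: nonzero_Mor_def)
    then have deg: "degree y x \<in> carrier G"
      using xy by (intro degree_closed)
    then have "part_support C G y x c = {degree y x}"
      using False by (auto simp: part_support_def c_def)
    moreover have "\<xi> (degree y x) \<in> carrier K"
      using deg \<xi> by (auto simp: hom_def)
    ultimately show ?thesis
      using deg nz f by (simp add: c_def character_scale_def)
  qed
  ultimately show "(let c = THE c. homogeneous_parts C G U y x f c
      in \<Oplus>\<^bsub>Mor C y x\<^esub>s\<in>part_support C G y x c. \<xi> s \<odot>\<^bsub>Mor C y x\<^esub> c s) =
      character_scale \<xi> y x \<odot>\<^bsub>Mor C y x\<^esub> f"
    by (simp add: Let_def)
qed

lemma character_scale_cocycle:
  assumes \<xi>: "\<xi> \<in> hom G (add_monoid K)"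
  shows "cocycle (character_scale \<xi>)"
  unfolding cocycle_def
proof (intro conjI ballI impI)
  show "character_scale \<xi> y x \<in> carrier K" if "x \<in> Obj C" "y \<in> Obj C" for x y
    using that \<xi> degree_closed by (auto simp: character_scale_def hom_def)
  fix x y z assume obj: "x \<in> Obj C" "y \<in> Obj C" "z \<in> Obj C"
    and nz: "nonzero_Mor C y x" "nonzero_Mor C z y"
        and comp: "Comp C z y x (e z y) (e y x) \<noteq> \<zero>\<^bsub>Mor C z x\<^esub>"
  have nz': "nonzero_Mor C z x"
    using Comp_nonzero(3)[OF obj basis_in(1)[OF obj(2,3) nz(2)] basis_in(1)[OF obj(1,2) nz(1)] comp] .
  have "\<xi> (degree z x) = \<xi> (degree z y) \<oplus> \<xi> (degree y x)"
    unfolding degree_mult[OF obj nz nz' comp, symmetric]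
    using \<xi> degree_closed[OF obj(2,3) nz(2)] degree_closed[OF obj(1,2) nz(1)] by (auto simp: hom_def)
  then show "character_scale \<xi> z x = character_scale \<xi> z y \<oplus> character_scale \<xi> y x"
    using nz nz' by (simp add: character_scale_def)
qed

section \<open>Linearity, kernel and image of the Hurewicz morphism\<close>

abbreviation "CH \<equiv> character_space K G"

abbreviation "h \<equiv> hurewicz K C G U"

lemma characterD: "\<xi> \<in> carrier CH \<Longrightarrow> \<xi> \<in> hom G (add_monoid K)"
  by (simp add: character_space_def)

sublocale HH: module_with_submodule K DS "inner_derivations C"
  by (intro module_with_submodule.intro module_with_submodule_axioms.intro
      derivation_space_module inner_derivations_submodule)

lemma HH1_eq: "HH1 K C = quotient_space DS (inner_derivations C)"
  by (simp add: HH1_def)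

lemma hurewicz_eq:
  "\<xi> \<in> carrier CH \<Longrightarrow> h \<xi> = inner_derivations C +>\<^bsub>DS\<^esub> scaling (character_scale \<xi>)"
  by (simp add: hurewicz_def hurewicz_derivation_eq characterD)

lemma scaling_in_DS: "cocycle \<mu> \<Longrightarrow> scaling \<mu> \<in> carrier DS"
  by (auto simp: carrier_DS)

lemma character_scale_add:
  assumes "\<xi> \<in> carrier CH" "\<psi> \<in> carrier CH"
  shows "scaling (character_scale (\<xi> \<oplus>\<^bsub>CH\<^esub> \<psi>)) = scaling (character_scale \<xi>)
      \<oplus>\<^bsub>DS\<^esub> scaling (character_scale \<psi>)"
proof -
  interpret CH: Module.module K CH
    by (rule character_space_module[OF K.is_cring group_G])
  note cc = character_scale_cocycle[OF characterD]
  show ?thesis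
    using cocycle_closed[OF cc[OF assms(1)]] cocycle_closed[OF cc[OF assms(2)]]
      cocycle_closed[OF cc[OF CH.a_closed[OF assms]]]
    by (auto simp: scaling_add intro!: scaling_cong)
        (auto simp: character_scale_def character_space_def degree_closed)
qed

lemma character_scale_smult:
  assumes "a \<in> carrier K" "\<xi> \<in> carrier CH"
  shows "scaling (character_scale (a \<odot>\<^bsub>CH\<^esub> \<xi>)) = a \<odot>\<^bsub>DS\<^esub> scaling (character_scale \<xi>)"
proof -
  interpret CH: Module.module K CH
    by (rule character_space_module[OF K.is_cring group_G])
  note cc = character_scale_cocycle[OF characterD]
  show ?thesis
    using assms cocycle_closed[OF cc[OF assms(2)]] cocycle_closed[OF cc[OF CH.smult_closed[OF assms]]]
    by (auto simp: scaling_smult intro!: scaling_cong)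
        (auto simp: character_scale_def character_space_def degree_closed)
qed

text \<open>Comparing coefficients on basis elements shows that the values of \<open>\<xi>\<close>
  on the degrees of edges form a coboundary; \<open>hom_trivial\<close> then makes
  \<open>\<xi>\<close> vanish on the whole group.\<close>

lemma hurewicz_kernel:
  assumes \<xi>: "\<xi> \<in> carrier CH" and inner: "scaling (character_scale \<xi>) \<in> inner_derivations C"
  shows "\<xi> = \<zero>\<^bsub>CH\<^esub>"
proof -
  obtain \<alpha> where \<alpha>: "scaling (character_scale \<xi>) = scaling (\<lambda>y x. \<alpha> y \<ominus> \<alpha> x)" "\<And>x. x \<in> Obj C
      \<Longrightarrow> \<alpha> x \<in> carrier K"
    using inner by (auto simp: inner_derivations_eq)
  note closed = cocycle_closed[OF character_scale_cocycle[OF characterD[OF \<xi>]]]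
  have "\<xi> (degree y x) = \<alpha> y \<ominus> \<alpha> x" if "(y, x) \<in> edges C" for x y
    using scaling_eqD[OF \<alpha>(1), of x y] that \<alpha>(2) closed[of x y]
        by (simp add: edges_iff character_scale_def)
  then have "\<xi> A = \<zero>" if "A \<in> carrier G" for A
    using hom_trivial[OF K.abelian_group_axioms characterD[OF \<xi>] \<alpha>(2) _ that] by simp
  then show ?thesis
    using \<xi> by (intro extensionalityI[of _ "carrier G"]) (auto simp: character_space_def)
qed

lemma hurewicz_surjective:
  assumes d: "d \<in> carrier DS"
  shows "\<exists>\<xi>\<in>carrier CH. h \<xi> = inner_derivations C +>\<^bsub>DS\<^esub> d"
proof -
  obtain \<mu> where \<mu>: "cocycle \<mu>" "\<And>x y. \<mu> y x \<in> carrier K" "\<And>x. \<mu> x x = \<zero>" "d = scaling \<mu>"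
    using derivation_is_scaling[of d] d by (auto simp: derivation_space_def)
  interpret E: edge_cocycle C e c0 u K \<mu>
    by (intro edge_cocycle.intro edge_cocycle_axioms.intro based_cw_complex_axioms
        K.abelian_group_axioms)
      (use \<mu> cocycleD[OF \<mu>(1)] in auto)
  define \<xi> where "\<xi> = restrict E.character (carrier G)"
  have \<xi>: "\<xi> \<in> carrier CH"
    using E.character_hom Group.group.is_monoid[OF group_G]
    by (auto simp: character_space_def \<xi>_def hom_def monoid.m_closed)
  \<comment> \<open>The sign turns the connector terms of \<open>character_degree\<close> into the
    coboundary \<open>\<alpha> y \<ominus> \<alpha> x\<close>, so that the derivation of
    \<open>\<xi>\<close> is \<open>d\<close> plus an inner one.\<close>
  define \<alpha> where "\<alpha> x = \<ominus> E.atlas.path_integral (connector x)" for x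
  have int: "E.atlas.path_integral (connector x) \<in> carrier K" if "x \<in> Obj C" for x
    using that by (intro E.atlas.path_integral_closed connector)
  then have \<alpha>: "\<alpha> x \<in> carrier K" if "x \<in> Obj C" for x
    using that by (simp add: \<alpha>_def)
  have "scaling (character_scale \<xi>) = scaling (\<lambda>y x. (\<alpha> y \<ominus> \<alpha> x) \<oplus> \<mu> y x)"
  proof (rule scaling_cong)
    fix x y assume xy: "x \<in> Obj C" "y \<in> Obj C" and nz: "nonzero_Mor C y x"
    show "character_scale \<xi> y x = (\<alpha> y \<ominus> \<alpha> x) \<oplus> \<mu> y x"
      using E.character_degree[OF xy nz] degree_closed[OF xy nz] nz int[OF xy(1)] int[OF xy(2)] \<mu>(2)
      by (simp add: character_scale_def \<xi>_def \<alpha>_def a_minus_def K.a_ac)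
  qed (use \<alpha> \<mu>(2) cocycle_closed[OF character_scale_cocycle[OF characterD[OF \<xi>]]] in auto)
  also have "\<dots> = scaling (\<lambda>y x. \<alpha> y \<ominus> \<alpha> x) \<oplus>\<^bsub>DS\<^esub> d"
    using \<alpha> \<mu> by (simp add: scaling_add)
  finally have "scaling (character_scale \<xi>) = scaling (\<lambda>y x. \<alpha> y \<ominus> \<alpha> x) \<oplus>\<^bsub>DS\<^esub> d" .
  moreover have "scaling (\<lambda>y x. \<alpha> y \<ominus> \<alpha> x) \<in> inner_derivations C"
    using \<alpha> by (auto simp: inner_derivations_eq)
  ultimately have "inner_derivations C +>\<^bsub>DS\<^esub> d = inner_derivations C +>\<^bsub>DS\<^esub> scaling
      (character_scale \<xi>)"
    using HH.coset_eq_iff[OF d scaling_in_DS[OF character_scale_cocycle[OF characterD[OF \<xi>]]]] by blast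
  then show ?thesis
    using \<xi> hurewicz_eq by auto
qed

lemma hurewicz_iso: "vector_space_iso K CH (HH1 K C) h"
proof -
  have CH: "Module.module K CH"
    by (rule character_space_module[OF K.is_cring group_G])
  have Q: "Module.module K (HH1 K C)"
    unfolding HH1_eq by (rule HH.quotient_module)
  interpret CH: Module.module K CH by (rule CH)
  interpret Q: Module.module K "HH1 K C" by (rule Q)
  have in_DS: "scaling (character_scale \<xi>) \<in> carrier DS" if "\<xi> \<in> carrier CH" for \<xi>
    by (intro scaling_in_DS character_scale_cocycle characterD that)
  have hom: "h \<in> hom (add_monoid CH) (add_monoid (HH1 K C))"
  proof (rule homI)
    show "h \<xi> \<in> carrier (add_monoid (HH1 K C))" if "\<xi> \<in> carrier (add_monoid CH)" for \<xi>
      using that in_DS by (simp add: HH1_eq HH.quotient_carrier hurewicz_eq)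
    show "h (\<xi> \<otimes>\<^bsub>add_monoid CH\<^esub> \<psi>) = h \<xi> \<otimes>\<^bsub>add_monoid (HH1 K C)\<^esub> h \<psi>"
      if "\<xi> \<in> carrier (add_monoid CH)" "\<psi> \<in> carrier (add_monoid CH)" for \<xi> \<psi>
      using that in_DS by (simp add: hurewicz_eq HH1_eq HH.quotient_add character_scale_add)
  qed
  have "inj_on h (carrier (add_monoid CH))"
    unfolding inj_on_one_iff'[OF hom CH.a_group Q.a_group]
  proof (intro allI impI)
    fix \<xi> assume "\<xi> \<in> carrier (add_monoid CH)" and h: "h \<xi> = \<one>\<^bsub>add_monoid (HH1 K C)\<^esub>"
    then have \<xi>: "\<xi> \<in> carrier CH"
      by simp
    have "inner_derivations C +>\<^bsub>DS\<^esub> scaling (character_scale \<xi>) = inner_derivations C"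
      using h by (simp add: hurewicz_eq[OF \<xi>] HH1_eq quotient_space_def)
    then have "\<xi> = \<zero>\<^bsub>CH\<^esub>"
      by (intro hurewicz_kernel[OF \<xi>]) (simp add: HH.coset_eq_subspace_iff in_DS[OF \<xi>])
    then show "\<xi> = \<one>\<^bsub>add_monoid CH\<^esub>"
      by simp
  qed
  moreover have "h ` carrier (add_monoid CH) = carrier (add_monoid (HH1 K C))"
  proof (intro equalityI subsetI)
    fix A assume "A \<in> carrier (add_monoid (HH1 K C))"
    then obtain d where "d \<in> carrier DS" "A = inner_derivations C +>\<^bsub>DS\<^esub> d"
      by (auto simp: HH1_eq HH.quotient_carrier)
    then show "A \<in> h ` carrier (add_monoid CH)"
      using hurewicz_surjective by fastforce
  qed (use hom in \<open>auto simp: hom_def\<close>)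
  ultimately have "h \<in> iso (add_monoid CH) (add_monoid (HH1 K C))"
    using hom by (simp add: iso_def bij_betw_def)
  moreover have "h (a \<odot>\<^bsub>CH\<^esub> \<xi>) = a \<odot>\<^bsub>HH1 K C\<^esub> h \<xi>" if "a \<in> carrier K" "\<xi> \<in> carrier CH" for a \<xi>
    using that in_DS by (simp add: hurewicz_eq HH1_eq HH.quotient_smult character_scale_smult)
  ultimately show ?thesis
    using CH Q by (simp add: vector_space_iso_def)
qed

end

theorem theorem4p6:
  fixes K :: "('k, 'r) ring_scheme"
    and C :: "('o, 'k, 'm) kcat"
    and e :: "'o \<Rightarrow> 'o \<Rightarrow> 'm"
    and c0 :: 'o
    and u :: "'o \<Rightarrow> ('o, 'm) virtual list"
  assumes "k_category K C"
    and "connected_category C"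
    and "schurian K C"
    and "basis_choice C e"
    and "c0 \<in> Obj C"
    and "connectors C c0 u"
  shows "grading K C (CW_pi1 C e c0) (universal_grading C e u) \<and>
    vector_space_iso K (character_space K (CW_pi1 C e c0)) (HH1 K C)
      (hurewicz K C (CW_pi1 C e c0) (universal_grading C e u))"
proof -
  interpret schurian_category K C e c0 u
    by (intro schurian_category.intro based_cw_complex.intro cw_complex.intro
        based_cw_complex_axioms.intro schurian_category_axioms.intro assms)
  show ?thesis
    using grading_U hurewicz_iso by simp
qed

end
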